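(* Let $1<r<\infty$. There is a constant $C$, depending only on $n,r$, such that for every $\kappa\in\mathbb{N}$ and every vector-valued Haar-shift operator $\mathcal{S}_r$ of complexity $\kappa$ on $\mathbb{R}^n$, $$\|\mathcal{S}_r\|_{L^1_{\ell^r}\to L^{1,\infty}}\le C\,\kappa^{1+\frac1r}.$$
   Context: $\mathbb{N}=\{1,2,\dots\}$. $\mathcal{D}=\{2^{-k}([0,1)^n+m):k\in\mathbb{Z},m\in\mathbb{Z}^n\}$ is the standard dyadic grid; $\ell(I)$ is the side length and $|I|$ the volume of a cube $I$. A generalized Haar shift operator of complexity $\kappa$ is an operator of the form $Sf=\sum_{I\in\mathcal{D}}S_If$, $S_If=\langle f,k_I\rangle h_I$, where $\langle f,g\rangle=\int fg\,dx$, the functions $h_I,k_I$ are supported on $I$ and constant on the dyadic subcubes of $I$ of side length $2^{-\kappa}\ell(I)$, $\|h_I\|_\infty\|k_I\|_\infty\le|I|^{-1}$, and $S$ is bounded on $L^2(\mathbb{R}^n)$ with norm at most $1$. The series is understood as the limit, as $N\to\infty$, of $\sum_{2^{-N}\le\ell(I)\le2^N}S_If$: for $f\in L^2$ the limit is assumed to exist in $L^2$, and for general $f\in L^1_{\rm loc}(\mathbb{R}^n)$, $Sf$ is said to be defined if the limit exists in measure on bounded sets. Given a sequence $\{S^j\}_{j\ge1}$ of generalized Haar shift operators of complexity $\kappa$, the associated vector-valued Haar-shift operator of complexity $\kappa$ is $$\mathcal{S}_r\mathbf{f}(x)=\Big(\sum_{j=1}^\infty|S^jf_j(x)|^r\Big)^{1/r},\qquad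 \mathbf{f}=\{f_j\},\ f_j\in L^1_{\rm loc}(\mathbb{R}^n),$$ for those $\mathbf{f}$ for which all $S^jf_j$ are defined. $L^1_{\ell^r}$ consists of sequences $\mathbf{f}=\{f_j\}$ of measurable functions with $\|\mathbf{f}\|_{L^1_{\ell^r}}=\int_{\mathbb{R}^n}(\sum_j|f_j(x)|^r)^{1/r}dx<\infty$. The norm $\|\mathcal{S}_r\|_{L^1_{\ell^r}\to L^{1,\infty}}$ is the least $A$ with $\sup_{\lambda>0}\lambda\,|\{x\in\mathbb{R}^n:\mathcal{S}_r\mathbf{f}(x)>\lambda\}|\le A\|\mathbf{f}\|_{L^1_{\ell^r}}$ for all $\mathbf{f}\in L^1_{\ell^r}$ for which $\mathcal{S}_r\mathbf{f}$ is defined. *)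

theory Defs
  imports "HOL-Analysis.Analysis"
begin

text \<open>
  Conventions.  Euclidean space is \<open>real ^ 'n\<close>.  Functions take values in a scalar field
  \<open>'k :: {real_normed_field, euclidean_space}\<close>; the instances of interest are \<open>real\<close> and
  \<open>complex\<close>, and the pairing below is bilinear in both cases.  Measurability and integrals
  refer to Lebesgue measure.  Sequences indexed by \<open>j \<ge> 1\<close> are indexed here by
  \<open>j :: nat\<close> starting from \<open>0\<close>.
\<close>

subsection \<open>Dyadic cubes\<close>

text \<open>The cubes of generation \<open>i\<close>; these are exactly the dyadic cubes of side length \<open>2 powi (- i)\<close>.\<close>

definition dyadic_cubes :: "int \<Rightarrow> (real ^ 'n) set set" where
  "dyadic_cubes i =
     {(\<lambda>x. 2 powi (- i) *\<^sub>R (x + (\<chi> l. real_of_int (m $ l)))) ` {x. \<forall>l. 0 \<le> x $ l \<and> x $ l < 1}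
      | m :: int ^ 'n. True}"

definition dyadic_grid :: "(real ^ 'n) set set" where
  "dyadic_grid = (\<Union>i. dyadic_cubes i)"

subsection \<open>Function spaces\<close>

definition L1_loc :: "(real ^ 'n \<Rightarrow> 'k::{real_normed_field, euclidean_space}) set" where
  "L1_loc = {f. \<forall>K. compact K \<longrightarrow> f absolutely_integrable_on K}"

definition L2 :: "(real ^ 'n \<Rightarrow> 'k::{real_normed_field, euclidean_space}) set" where
  "L2 = {f. f \<in> borel_measurable lebesgue \<and> integrable lebesgue (\<lambda>x. (norm (f x))\<^sup>2)}"

definition L2_norm :: "(real ^ 'n \<Rightarrow> 'k::{real_normed_field, euclidean_space}) \<Rightarrow> real" where
  "L2_norm f = sqrt (\<integral>x. (norm (f x))\<^sup>2 \<partial>lebesgue)"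

definition tendsto_L2 ::
  "(nat \<Rightarrow> real ^ 'n \<Rightarrow> 'k::{real_normed_field, euclidean_space}) \<Rightarrow> (real ^ 'n \<Rightarrow> 'k) \<Rightarrow> bool" where
  "tendsto_L2 F g \<longleftrightarrow>
     (\<forall>N. F N \<in> L2) \<and> g \<in> L2 \<and> (\<lambda>N. L2_norm (\<lambda>x. F N x - g x)) \<longlonglongrightarrow> 0"

definition tendsto_in_measure_on_bounded ::
  "(nat \<Rightarrow> real ^ 'n \<Rightarrow> 'k::{real_normed_field, euclidean_space}) \<Rightarrow> (real ^ 'n \<Rightarrow> 'k) \<Rightarrow> bool" where
  "tendsto_in_measure_on_bounded F g \<longleftrightarrow>
     (\<forall>N. F N \<in> borel_measurable lebesgue) \<and> g \<in> borel_measurable lebesgue \<and>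
     (\<forall>B \<epsilon>. bounded B \<longrightarrow> B \<in> sets lebesgue \<longrightarrow> \<epsilon> > 0 \<longrightarrow>
        (\<lambda>N. emeasure lebesgue {x \<in> B. norm (F N x - g x) > \<epsilon>}) \<longlonglongrightarrow> 0)"

text \<open>Real powers of extended nonnegative reals, for exponents \<open>p > 0\<close>.\<close>

definition ennreal_powr :: "ennreal \<Rightarrow> real \<Rightarrow> ennreal" where
  "ennreal_powr a p = (if a = \<infinity> then \<infinity> else ennreal (enn2real a powr p))"

definition lr_norm :: "real \<Rightarrow> (nat \<Rightarrow> 'k::real_normed_vector) \<Rightarrow> ennreal" where
  "lr_norm r a = ennreal_powr (\<Sum>j. ennreal (norm (a j) powr r)) (1 / r)"

definition L1_lr_norm ::
  "real \<Rightarrow> (nat \<Rightarrow> real ^ 'n \<Rightarrow> 'k::{real_normed_field, euclidean_space}) \<Rightarrow> ennreal" where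
  "L1_lr_norm r f = (\<integral>\<^sup>+x. lr_norm r (\<lambda>j. f j x) \<partial>lebesgue)"

definition L1_lr ::
  "real \<Rightarrow> (nat \<Rightarrow> real ^ 'n \<Rightarrow> 'k::{real_normed_field, euclidean_space}) set" where
  "L1_lr r = {f. (\<forall>j. f j \<in> borel_measurable lebesgue) \<and> L1_lr_norm r f < \<infinity>}"

subsection \<open>Generalized Haar shifts\<close>

definition pairing ::
  "(real ^ 'n \<Rightarrow> 'k::{real_normed_field, euclidean_space}) \<Rightarrow> (real ^ 'n \<Rightarrow> 'k) \<Rightarrow> 'k" where
  "pairing f g = (\<integral>x. f x * g x \<partial>lebesgue)"

text \<open>
  A shift is given by the families \<open>h\<close>, \<open>k\<close> of functions indexed by the dyadic cubes.
  In the truncated operator, \<open>\<Sum>\<close> over the infinitely many cubes of side length between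
  \<open>2\<^sup>-\<^sup>N\<close> and \<open>2\<^sup>N\<close> is evaluated pointwise: as \<open>h I\<close> vanishes off \<open>I\<close>, only the finitely
  many cubes containing \<open>x\<close> (one in each generation) contribute at \<open>x\<close>.
\<close>

definition haar_trunc ::
  "((real ^ 'n) set \<Rightarrow> real ^ 'n \<Rightarrow> 'k::{real_normed_field, euclidean_space}) \<Rightarrow>
   ((real ^ 'n) set \<Rightarrow> real ^ 'n \<Rightarrow> 'k) \<Rightarrow> nat \<Rightarrow> (real ^ 'n \<Rightarrow> 'k) \<Rightarrow> real ^ 'n \<Rightarrow> 'k" where
  "haar_trunc h k N f x =
     (\<Sum>I \<in> {I \<in> (\<Union>i\<in>{- int N..int N}. dyadic_cubes i). x \<in> I}. pairing f (k I) * h I x)"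

text \<open>
  The suprema below are over finite sets of values, by the support and constancy conditions.
  They agree with the essential suprema, as the functions are constant on cubes of positive measure.
\<close>

definition haar_shift ::
  "nat \<Rightarrow> ((real ^ 'n) set \<Rightarrow> real ^ 'n \<Rightarrow> 'k::{real_normed_field, euclidean_space}) \<Rightarrow>
   ((real ^ 'n) set \<Rightarrow> real ^ 'n \<Rightarrow> 'k) \<Rightarrow> bool" where
  "haar_shift \<kappa> h k \<longleftrightarrow>
     (\<forall>I \<in> dyadic_grid. \<forall>x. x \<notin> I \<longrightarrow> h I x = 0 \<and> k I x = 0) \<and>
     (\<forall>i. \<forall>I \<in> dyadic_cubes i. \<forall>J \<in> dyadic_cubes (i + int \<kappa>).
        J \<subseteq> I \<longrightarrow> h I constant_on J \<and> k I constant_on J) \<and>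
     (\<forall>I \<in> dyadic_grid. (SUP x. norm (h I x)) * (SUP x. norm (k I x)) \<le> inverse (measure lebesgue I)) \<and>
     (\<forall>f \<in> L2. \<exists>g. tendsto_L2 (\<lambda>N. haar_trunc h k N f) g \<and> L2_norm g \<le> L2_norm f)"

definition haar_defined ::
  "((real ^ 'n) set \<Rightarrow> real ^ 'n \<Rightarrow> 'k::{real_normed_field, euclidean_space}) \<Rightarrow>
   ((real ^ 'n) set \<Rightarrow> real ^ 'n \<Rightarrow> 'k) \<Rightarrow> (real ^ 'n \<Rightarrow> 'k) \<Rightarrow> bool" where
  "haar_defined h k f \<longleftrightarrow>
     f \<in> L1_loc \<and> (\<exists>g. tendsto_in_measure_on_bounded (\<lambda>N. haar_trunc h k N f) g)"

text \<open>A representative of \<open>Sf\<close>; limits in measure on bounded sets are unique almost everywhere.\<close>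

definition haar_apply ::
  "((real ^ 'n) set \<Rightarrow> real ^ 'n \<Rightarrow> 'k::{real_normed_field, euclidean_space}) \<Rightarrow>
   ((real ^ 'n) set \<Rightarrow> real ^ 'n \<Rightarrow> 'k) \<Rightarrow> (real ^ 'n \<Rightarrow> 'k) \<Rightarrow> real ^ 'n \<Rightarrow> 'k" where
  "haar_apply h k f = (SOME g. tendsto_in_measure_on_bounded (\<lambda>N. haar_trunc h k N f) g)"

subsection \<open>Vector-valued Haar shifts\<close>

definition vector_haar_defined ::
  "(nat \<Rightarrow> (real ^ 'n) set \<Rightarrow> real ^ 'n \<Rightarrow> 'k::{real_normed_field, euclidean_space}) \<Rightarrow>
   (nat \<Rightarrow> (real ^ 'n) set \<Rightarrow> real ^ 'n \<Rightarrow> 'k) \<Rightarrow> (nat \<Rightarrow> real ^ 'n \<Rightarrow> 'k) \<Rightarrow> bool" where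
  "vector_haar_defined h k f \<longleftrightarrow> (\<forall>j. haar_defined (h j) (k j) (f j))"

definition vector_haar_apply ::
  "real \<Rightarrow> (nat \<Rightarrow> (real ^ 'n) set \<Rightarrow> real ^ 'n \<Rightarrow> 'k::{real_normed_field, euclidean_space}) \<Rightarrow>
   (nat \<Rightarrow> (real ^ 'n) set \<Rightarrow> real ^ 'n \<Rightarrow> 'k) \<Rightarrow> (nat \<Rightarrow> real ^ 'n \<Rightarrow> 'k) \<Rightarrow> real ^ 'n \<Rightarrow> ennreal" where
  "vector_haar_apply r h k f x = lr_norm r (\<lambda>j. haar_apply (h j) (k j) (f j) x)"

definition weak_norm :: "(real ^ 'n \<Rightarrow> ennreal) \<Rightarrow> ennreal" where
  "weak_norm u = (SUP t\<in>{0<..}. ennreal t * emeasure lebesgue {x. u x > ennreal t})"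

text \<open>The norm from \<open>L1_lr r\<close> to weak \<open>L1\<close>; it is \<open>\<infinity>\<close> if there is no finite admissible constant.\<close>

definition vector_haar_weak_norm ::
  "real \<Rightarrow> (nat \<Rightarrow> (real ^ 'n) set \<Rightarrow> real ^ 'n \<Rightarrow> 'k::{real_normed_field, euclidean_space}) \<Rightarrow>
   (nat \<Rightarrow> (real ^ 'n) set \<Rightarrow> real ^ 'n \<Rightarrow> 'k) \<Rightarrow> ennreal" where
  "vector_haar_weak_norm r h k =
     Inf {A. \<forall>f \<in> L1_lr r. vector_haar_defined h k f \<longrightarrow>
               weak_norm (vector_haar_apply r h k f) \<le> A * L1_lr_norm r f}"

end

theory Submission
  imports Defs
begin

text \<open>
  The theorem follows from a Calderon-Zygmund decomposition once every scalar shift is known to be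
  bounded on \<open>L\<^sup>r\<close> with norm \<open>O(\<kappa>)\<close>.

  Bound on \<open>L\<^sup>r\<close>.  Given a cube \<open>Q\<close>, stop at the maximal subcubes on which the mean of \<open>\<bar>f\<bar>\<close>
  or of \<open>\<bar>g\<bar>\<close> exceeds four times its mean over \<open>Q\<close>; they cover at most half of \<open>Q\<close>.  In the form
  \<open>\<langle>Tf, g\<rangle>\<close> consider the scales above the stopping cubes.  If \<open>f\<close> and \<open>g\<close> are replaced by their
  means over the stopping cubes, they become bounded, and the \<open>L\<^sup>2\<close> bound applies.  What remains has
  mean zero on each stopping cube; as the kernels are constant on subcubes \<open>\<kappa>\<close> generations below, it
  is seen only by the at most \<open>\<kappa>\<close> scales just above that cube, where the size condition suffices.
  So these scales contribute at most \<open>C \<kappa> \<bar>Q\<bar>\<close> times the means of \<open>\<bar>f\<bar>\<close> and \<open>\<bar>g\<bar>\<close> over \<open>Q\<close>, and the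
  scales inside a stopping cube pose the same problem on a smaller cube.  By induction the form is
  dominated by \<open>C \<kappa> \<integral> Mf Mg\<close> with the dyadic maximal function (\<open>sparse_domination\<close>).  The maximal
  inequality (\<open>maxfn_strong_type\<close>) and duality give the \<open>L\<^sup>r\<close> bound (\<open>strong_type\<close>).

  Weak type.  Let \<open>A = O(\<kappa>)\<close> bound the shifts on \<open>L\<^sup>r\<close>, and hence their vector-valued version on
  \<open>L\<^sup>r(\<ell>\<^sup>r)\<close>.  Decompose the sequence at height \<open>\<lambda>/A\<close>.  The exceptional set, the good part by
  Chebyshev in \<open>L\<^sup>r\<close>, and the bad part, again through \<open>\<kappa>\<close> scales only, contribute \<open>O(A)\<close>, \<open>O(A)\<close> and
  \<open>O(\<kappa>)\<close> (\<open>vector_weak_type\<close>).  The total is \<open>O(\<kappa>)\<close>, which is at most \<open>O(\<kappa>\<^bsup>1+1/r\<^esup>)\<close>.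

  Reduction to finite sums.  The truncation to side lengths between \<open>2\<^sup>-\<^sup>N\<close> and \<open>2\<^sup>N\<close> acts separately on
  each cube of side \<open>2\<^sup>N\<close>, and there only through the means of \<open>f\<close> over cells of side
  \<open>2\<^bsup>-(N+\<kappa>)\<^esup>\<close>.  So the estimates above are made for functions on a finite tree of cubes.  They
  need the \<open>L\<^sup>2\<close> bound for the part of the shift inside a cube and above a given scale, with a constant
  independent of \<open>N\<close>.  It follows from the bound for the full shift: on a cube \<open>Q\<close>, the contributions
  of the cubes strictly containing \<open>Q\<close> form a geometric series bounded by the mean of \<open>\<bar>f\<bar>\<close> over \<open>Q\<close>
  (\<open>layers_energy_le\<close>).  The weak type bound for truncations, being uniform in \<open>N\<close>, survives
  the limit in measure (\<open>limit_weak_type\<close>).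
\<close>

section \<open>Sums over the blocks of a partition\<close>

text \<open>
  A partition of a finite set is given by the function that sends a point to its block.  Sums over
  blocks then become sums over points, and the set of blocks is never needed.
\<close>
definition block_map :: "('a \<Rightarrow> 'a set) \<Rightarrow> 'a set \<Rightarrow> bool" where
  "block_map P Z \<longleftrightarrow> finite Z \<and> (\<forall>x\<in>Z. x \<in> P x \<and> P x \<subseteq> Z \<and> (\<forall>y\<in>P x. P y = P x))"

lemma block_mapD:
  assumes "block_map P Z" "x \<in> Z"
  shows "x \<in> P x" "P x \<subseteq> Z" "finite (P x)" "\<And>y. y \<in> P x \<Longrightarrow> P y = P x" "card (P x) > 0"
proof -
  have *: "finite Z" "x \<in> P x" "P x \<subseteq> Z" "\<forall>y\<in>P x. P y = P x"
    using assms unfolding block_map_def by blast+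
  show "x \<in> P x" "P x \<subseteq> Z" by fact+
  show fin: "finite (P x)" using * finite_subset by blast
  show "\<And>y. y \<in> P x \<Longrightarrow> P y = P x" using * by blast
  show "card (P x) > 0" using fin *(2) unfolding card_gt_0_iff by blast
qed

lemma sum_swap_blocks:
  fixes \<phi> :: "'a \<Rightarrow> 'a \<Rightarrow> 'b::comm_monoid_add"
  assumes "block_map P Z"
  shows "(\<Sum>x\<in>Z. \<Sum>y\<in>P x. \<phi> x y) = (\<Sum>y\<in>Z. \<Sum>x\<in>P y. \<phi> x y)"
proof -
  have fin: "finite Z" using assms by (simp add: block_map_def)
  have 1: "P x = {y. y \<in> Z \<and> y \<in> P x}" if "x \<in> Z" for x
    using block_mapD(2)[OF assms that] by auto
  have 2: "P y = {x. x \<in> Z \<and> y \<in> P x}" if "y \<in> Z" for y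
  proof -
    have "x \<in> Z \<and> y \<in> P x" if "x \<in> P y" for x
      using block_mapD(1,2)[OF assms \<open>y \<in> Z\<close>] block_mapD(4)[OF assms \<open>y \<in> Z\<close> that] that by blast
    moreover have "x \<in> P y" if "x \<in> Z" "y \<in> P x" for x
      using block_mapD(1)[OF assms \<open>x \<in> Z\<close>] block_mapD(4)[OF assms \<open>x \<in> Z\<close> that(2)] by blast
    ultimately show ?thesis by blast
  qed
  have "(\<Sum>x\<in>Z. \<Sum>y\<in>P x. \<phi> x y) = (\<Sum>x\<in>Z. \<Sum>y\<in>{y. y \<in> Z \<and> y \<in> P x}. \<phi> x y)"
    using 1 by (intro sum.cong) auto
  also have "\<dots> = (\<Sum>y\<in>Z. \<Sum>x\<in>{x. x \<in> Z \<and> y \<in> P x}. \<phi> x y)"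
    by (rule sum.swap_restrict[OF fin fin])
  also have "\<dots> = (\<Sum>y\<in>Z. \<Sum>x\<in>P y. \<phi> x y)"
    using 2 by (intro sum.cong) auto
  finally show ?thesis .
qed

text \<open>
  Replacing a function by its block means preserves the sum: a block with \<open>c\<close> points contributes its
  mean \<open>c\<close> times.
\<close>

lemma sum_block_averages:
  fixes \<phi> :: "'a \<Rightarrow> 'b::real_vector"
  assumes "block_map P Z"
  shows "(\<Sum>x\<in>Z. (\<Sum>y\<in>P x. \<phi> y) /\<^sub>R real (card (P x))) = sum \<phi> Z"
proof -
  have "(\<Sum>x\<in>Z. (\<Sum>y\<in>P x. \<phi> y) /\<^sub>R real (card (P x)))
      = (\<Sum>x\<in>Z. \<Sum>y\<in>P x. \<phi> y /\<^sub>R real (card (P x)))"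
    by (simp add: scaleR_sum_right)
  also have "\<dots> = (\<Sum>y\<in>Z. \<Sum>x\<in>P y. \<phi> y /\<^sub>R real (card (P x)))"
    by (rule sum_swap_blocks[OF assms])
  also have "\<dots> = (\<Sum>y\<in>Z. \<Sum>x\<in>P y. \<phi> y /\<^sub>R real (card (P y)))"
    by (intro sum.cong refl) (metis block_mapD(4)[OF assms])
  also have "\<dots> = (\<Sum>y\<in>Z. \<phi> y)"
    using block_mapD(5)[OF assms] by (intro sum.cong) (auto simp: scaleR_sum_left[symmetric] sum_constant_scaleR)
  finally show ?thesis by simp
qed

text \<open>
  This turns estimates on the individual stopping cubes into one on their union.
\<close>

lemma norm_sum_le_blocks:
  fixes \<psi> :: "'a \<Rightarrow> 'b::real_normed_vector" and \<phi> :: "'a \<Rightarrow> real"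
  assumes P: "block_map P Z"
    and le: "\<And>x. x \<in> Z \<Longrightarrow> norm (\<Sum>y\<in>P x. \<psi> y) \<le> (\<Sum>y\<in>P x. \<phi> y)"
  shows "norm (sum \<psi> Z) \<le> sum \<phi> Z"
proof -
  have "norm (sum \<psi> Z) \<le> (\<Sum>x\<in>Z. norm ((\<Sum>y\<in>P x. \<psi> y) /\<^sub>R real (card (P x))))"
    unfolding sum_block_averages[OF P, of \<psi>, symmetric] by (rule norm_sum)
  also have "\<dots> \<le> (\<Sum>x\<in>Z. (\<Sum>y\<in>P x. \<phi> y) /\<^sub>R real (card (P x)))"
    using le by (intro sum_mono) (auto intro!: mult_left_mono)
  also have "\<dots> = sum \<phi> Z" by (rule sum_block_averages[OF P])
  finally show ?thesis .
qed

section \<open>Finite trees of cubes and stopping times\<close>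

text \<open>
  Here \<open>cube i x\<close> is the cube of generation \<open>i\<close> around \<open>x\<close>, in a finite set with counting measure.
  A smaller generation number means a larger cube; \<open>D\<close> bounds the number of children.
\<close>

locale cube_tree =
  fixes X :: "'a set" and cube :: "nat \<Rightarrow> 'a \<Rightarrow> 'a set" and D :: real
  assumes finite_X: "finite X"
    and cube_subset: "x \<in> X \<Longrightarrow> cube i x \<subseteq> X"
    and cube_self: "x \<in> X \<Longrightarrow> x \<in> cube i x"
    and cube_eq: "x \<in> X \<Longrightarrow> y \<in> cube i x \<Longrightarrow> cube i y = cube i x"
    and cube_Suc: "x \<in> X \<Longrightarrow> cube (Suc i) x \<subseteq> cube i x"
    and card_cube: "x \<in> X \<Longrightarrow> real (card (cube i x)) \<le> D * real (card (cube (Suc i) x))"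
begin

lemma finite_cube: "x \<in> X \<Longrightarrow> finite (cube i x)"
  using cube_subset finite_X finite_subset by blast

lemma card_cube_pos: "x \<in> X \<Longrightarrow> card (cube i x) > 0"
  using cube_self finite_cube by (fastforce simp: card_gt_0_iff)

lemma cube_mono: 
  assumes "x \<in> X" "i \<le> j" shows "cube j x \<subseteq> cube i x"
  using assms(2) by (induction rule: dec_induct) (use assms cube_Suc in auto)

lemma cube_in_X: "x \<in> X \<Longrightarrow> y \<in> cube i x \<Longrightarrow> y \<in> X"
  using cube_subset by blast

lemma cube_block_map:
  assumes "x0 \<in> X" "m \<le> i" shows "block_map (cube i) (cube m x0)"
  unfolding block_map_def
proof (intro conjI ballI)
  show "finite (cube m x0)" using finite_cube assms by auto
  fix x assume x: "x \<in> cube m x0"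
  then have X: "x \<in> X" using assms cube_subset by blast
  show "x \<in> cube i x" using cube_self X by auto
  show "cube i x \<subseteq> cube m x0" using cube_mono[OF X assms(2)] cube_eq[OF assms(1) x] by simp
  show "cube i y = cube i x" if "y \<in> cube i x" for y using cube_eq[OF X that] .
qed

definition avg :: "nat \<Rightarrow> ('a \<Rightarrow> 'b::real_vector) \<Rightarrow> 'a \<Rightarrow> 'b" where
  "avg i u x = (\<Sum>y\<in>cube i x. u y) /\<^sub>R real (card (cube i x))"

lemma avg_cong: "x \<in> X \<Longrightarrow> y \<in> cube i x \<Longrightarrow> avg i u y = avg i u x"
  unfolding avg_def by (metis cube_eq)

lemma avg_nonneg: "(\<And>y. 0 \<le> u y) \<Longrightarrow> 0 \<le> avg i u x" for u :: "'a \<Rightarrow> real"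
  unfolding avg_def by (simp add: sum_nonneg)

lemma avg_mono: "x \<in> X \<Longrightarrow> (\<And>y. y \<in> cube i x \<Longrightarrow> u y \<le> v y) \<Longrightarrow> avg i u x \<le> avg i v x" for u v :: "'a \<Rightarrow> real"
  unfolding avg_def by (auto intro!: mult_left_mono sum_mono)

lemma avg_const: "x \<in> X \<Longrightarrow> avg i (\<lambda>_. c) x = c" for c :: real
  unfolding avg_def using card_cube_pos[of x i] by simp

lemma avg_le: "x \<in> X \<Longrightarrow> (\<And>y. y \<in> cube i x \<Longrightarrow> u y \<le> c) \<Longrightarrow> avg i u x \<le> c" for c :: real
  using avg_mono[of x i u "\<lambda>_. c"] avg_const by simp

lemma sum_eq_avg: "x \<in> X \<Longrightarrow> (\<Sum>y\<in>cube i x. u y) = real (card (cube i x)) * avg i u x" for u :: "'a \<Rightarrow> real"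
  unfolding avg_def using card_cube_pos[of x i] by simp

lemma norm_avg_le: "norm (avg i f x) \<le> avg i (\<lambda>y. norm (f y)) x" for f :: "'a \<Rightarrow> 'b::real_normed_vector"
  unfolding avg_def by (simp add: norm_sum mult_left_mono)

lemma D_pos: "x \<in> X \<Longrightarrow> D \<ge> 1"
proof -
  assume x: "x \<in> X"
  have "real (card (cube 1 x)) \<le> real (card (cube 0 x))"
    using cube_Suc[OF x, of 0] finite_cube[OF x] by (simp add: card_mono)
  also have "\<dots> \<le> D * real (card (cube 1 x))" using card_cube[OF x, of 0] by simp
  finally show ?thesis using card_cube_pos[OF x, of 1] by simp
qed

lemma avg_Suc_le:
  fixes u :: "'a \<Rightarrow> real"
  assumes x: "x \<in> X" and u: "\<And>y. 0 \<le> u y"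
  shows "avg (Suc i) u x \<le> D * avg i u x"
proof -
  have "(\<Sum>y\<in>cube (Suc i) x. u y) \<le> (\<Sum>y\<in>cube i x. u y)"
    using cube_Suc[OF x, of i] finite_cube[OF x] u by (intro sum_mono2) auto
  then have "avg (Suc i) u x \<le> (\<Sum>y\<in>cube i x. u y) / real (card (cube (Suc i) x))"
    unfolding avg_def by (simp add: divide_inverse mult.commute mult_right_mono)
  also have "\<dots> \<le> (\<Sum>y\<in>cube i x. u y) * (D / real (card (cube i x)))"
    using card_cube[OF x, of i] card_cube_pos[OF x] u
    by (simp only: divide_inverse, intro mult_left_mono)
       (auto simp: sum_nonneg field_simps)
  finally show ?thesis by (simp add: avg_def field_simps)
qed

text \<open>
  The cubes \<open>cube (\<tau> x) x\<close>, for \<open>x\<close> in \<open>Z\<close>, form the partition into stopping cubes: \<open>\<tau>\<close> is a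
  stopping time for the filtration generated by the generations.
\<close>

definition stopping :: "'a set \<Rightarrow> ('a \<Rightarrow> nat) \<Rightarrow> bool" where
  "stopping Z \<tau> \<longleftrightarrow> (\<forall>x\<in>Z. \<forall>y\<in>cube (\<tau> x) x. \<tau> y = \<tau> x)"

definition stop_cube :: "('a \<Rightarrow> nat) \<Rightarrow> 'a \<Rightarrow> 'a set" where
  "stop_cube \<tau> x = cube (\<tau> x) x"

lemma stop_block_map:
  assumes x0: "x0 \<in> X" and st: "stopping (cube m x0) \<tau>" and m: "\<And>x. x \<in> cube m x0 \<Longrightarrow> m \<le> \<tau> x"
  shows "block_map (stop_cube \<tau>) (cube m x0)"
  unfolding block_map_def stop_cube_def
proof (intro conjI ballI)
  show "finite (cube m x0)" using finite_cube assms by auto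
  fix x assume x: "x \<in> cube m x0"
  then have X: "x \<in> X" using assms cube_subset by blast
  show "x \<in> cube (\<tau> x) x" using cube_self X by auto
  show "cube (\<tau> x) x \<subseteq> cube m x0" using cube_mono[OF X m[OF x]] cube_eq[OF x0 x] by simp
  show "cube (\<tau> y) y = cube (\<tau> x) x" if "y \<in> cube (\<tau> x) x" for y
    using cube_eq[OF X that] st x that unfolding stopping_def by auto
qed

lemma stopping_less_iff:
  assumes x0: "x0 \<in> X" and st: "stopping (cube m x0) \<tau>" and i: "m \<le> i"
    and x: "x \<in> cube m x0" and y: "y \<in> cube i x"
  shows "i < \<tau> y \<longleftrightarrow> i < \<tau> x"
proof -
  have X: "x \<in> X" using x x0 cube_subset by blast
  have yZ: "y \<in> cube m x0" using cube_mono[OF X i] y cube_eq[OF x0 x] by auto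
  have Y: "y \<in> X" using yZ x0 cube_subset by blast
  have xy: "x \<in> cube i y" using cube_eq[OF X y] cube_self[OF X] by auto
  have "\<tau> y = \<tau> x" if "\<tau> x \<le> i"
    using st x y cube_mono[OF X that] unfolding stopping_def by blast
  moreover have "\<tau> x = \<tau> y" if "\<tau> y \<le> i"
    using st yZ xy cube_mono[OF Y that] unfolding stopping_def by blast
  ultimately show ?thesis by (metis not_less)
qed

text \<open>
  The points where \<open>P\<close> never holds before generation \<open>N\<close> are stopped at \<open>N\<close>, so that every point lies in
  a stopping cube.  Since the operators below have no scales from \<open>N\<close> on, nothing is left to estimate
  inside those cubes.
\<close>

definition first_stop :: "nat \<Rightarrow> nat \<Rightarrow> (nat \<Rightarrow> 'a \<Rightarrow> bool) \<Rightarrow> 'a \<Rightarrow> nat" where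
  "first_stop m N P x = (LEAST i. m \<le> i \<and> (N \<le> i \<or> P i x))"

lemma first_stop:
  assumes "m \<le> N"
  shows "m \<le> first_stop m N P x" "first_stop m N P x \<le> N"
    "\<And>i. m \<le> i \<Longrightarrow> i < first_stop m N P x \<Longrightarrow> \<not> P i x"
    "first_stop m N P x < N \<Longrightarrow> P (first_stop m N P x) x"
proof -
  let ?Q = "\<lambda>i. m \<le> i \<and> (N \<le> i \<or> P i x)"
  have N: "?Q N" using assms by simp
  have *: "?Q (first_stop m N P x)" unfolding first_stop_def by (rule LeastI[of ?Q, OF N])
  show "m \<le> first_stop m N P x" using * by simp
  show "first_stop m N P x \<le> N" unfolding first_stop_def by (rule Least_le[of ?Q, OF N])
  show "\<not> P i x" if "m \<le> i" "i < first_stop m N P x" for i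
    using not_less_Least[of i ?Q] that unfolding first_stop_def by auto
  show "first_stop m N P x < N \<Longrightarrow> P (first_stop m N P x) x" using * by auto
qed

lemma first_stop_stopping:
  assumes x0: "x0 \<in> X" and m: "m \<le> N"
    and P: "\<And>i x y. x \<in> X \<Longrightarrow> y \<in> cube i x \<Longrightarrow> P i y = P i x"
  shows "stopping (cube m x0) (first_stop m N P)"
  unfolding stopping_def
proof (intro ballI)
  fix x y assume x: "x \<in> cube m x0" and y: "y \<in> cube (first_stop m N P x) x"
  let ?t = "first_stop m N P x"
  have X: "x \<in> X" using x x0 cube_subset by blast
  have eq: "P i y = P i x" if "i \<le> ?t" for i
    using P[OF X] cube_mono[OF X that] y by blast
  note fs = first_stop[OF m, where P = P and x = x]
  show "first_stop m N P y = ?t"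
    unfolding first_stop_def[of m N P y]
  proof (rule Least_equality)
    show "m \<le> ?t \<and> (N \<le> ?t \<or> P ?t y)" using fs eq by (meson le_refl not_less)
    fix i assume i: "m \<le> i \<and> (N \<le> i \<or> P i y)"
    show "?t \<le> i"
    proof (rule ccontr)
      assume "\<not> ?t \<le> i"
      then have "i < ?t" by simp
      then show False using i fs(2) fs(3)[of i] eq[of i] by auto
    qed
  qed
qed

text \<open>
  The part of the shift with scales from \<open>m\<close> up to but excluding \<open>n\<close>.  The values \<open>h i x\<close> and \<open>k i y\<close>
  stand for \<open>h\<^sub>I(x)\<close> and \<open>k\<^sub>I(y)\<close>, where \<open>I\<close> is the cube of generation \<open>i\<close> around the point.
  Taking \<open>n = \<tau> x\<close> at the point \<open>x\<close> selects the scales above the stopping cubes.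
\<close>

definition shift_op :: "(nat \<Rightarrow> 'a \<Rightarrow> 'b::real_normed_field) \<Rightarrow> (nat \<Rightarrow> 'a \<Rightarrow> 'b) \<Rightarrow> nat \<Rightarrow> nat \<Rightarrow> ('a \<Rightarrow> 'b) \<Rightarrow> 'a \<Rightarrow> 'b" where
  "shift_op h k m n f x = (\<Sum>i\<in>{m..<n}. h i x * (\<Sum>y\<in>cube i x. k i y * f y))"

lemma shift_op_split:
  "m \<le> n \<Longrightarrow> n \<le> N \<Longrightarrow> shift_op h k m N f x = shift_op h k m n f x + shift_op h k n N f x"
  unfolding shift_op_def by (simp add: sum.atLeastLessThan_concat)

lemma shift_op_diff: "shift_op h k m n (\<lambda>x. f x - g x) x = shift_op h k m n f x - shift_op h k m n g x"
  unfolding shift_op_def by (simp add: algebra_simps sum_subtractf)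

lemma shift_op_add: "shift_op h k m n (\<lambda>x. f x + g x) x = shift_op h k m n f x + shift_op h k m n g x"
  unfolding shift_op_def by (simp add: algebra_simps sum.distrib)

text \<open>
  The pairs \<open>(x, y)\<close> in a common cube of generation \<open>i\<close> with \<open>i < \<tau> x\<close> form a symmetric relation,
  because \<open>i < \<tau> x\<close> holds at one point of the cube exactly if it holds at all of them.
\<close>

lemma sum_tree_swap:
  fixes \<phi> :: "nat \<Rightarrow> 'a \<Rightarrow> 'a \<Rightarrow> 'b::comm_monoid_add"
  assumes x0: "x0 \<in> X" and st: "stopping (cube m x0) \<tau>" and N: "\<And>x. x \<in> cube m x0 \<Longrightarrow> \<tau> x \<le> N"
  shows "(\<Sum>x\<in>cube m x0. \<Sum>i\<in>{m..<\<tau> x}. \<Sum>y\<in>cube i x. \<phi> i x y)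
       = (\<Sum>y\<in>cube m x0. \<Sum>i\<in>{m..<\<tau> y}. \<Sum>x\<in>cube i y. \<phi> i x y)"
proof -
  let ?Z = "cube m x0"
  have restrict: "(\<Sum>i\<in>{m..<\<tau> x}. F i) = (\<Sum>i\<in>{m..<N}. if i < \<tau> x then F i else 0)"
    if "x \<in> ?Z" for x and F :: "nat \<Rightarrow> 'b"
    using N[OF that] by (intro sum.mono_neutral_cong_left) auto
  have "(\<Sum>x\<in>?Z. \<Sum>i\<in>{m..<\<tau> x}. \<Sum>y\<in>cube i x. \<phi> i x y)
      = (\<Sum>x\<in>?Z. \<Sum>i\<in>{m..<N}. if i < \<tau> x then \<Sum>y\<in>cube i x. \<phi> i x y else 0)"
    by (rule sum.cong[OF refl], rule restrict)
  also have "\<dots> = (\<Sum>i\<in>{m..<N}. \<Sum>x\<in>?Z. if i < \<tau> x then \<Sum>y\<in>cube i x. \<phi> i x y else 0)"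
    by (rule sum.swap)
  also have "\<dots> = (\<Sum>i\<in>{m..<N}. \<Sum>x\<in>?Z. \<Sum>y\<in>cube i x. if i < \<tau> x then \<phi> i x y else 0)"
    by (intro sum.cong) auto
  also have "\<dots> = (\<Sum>i\<in>{m..<N}. \<Sum>y\<in>?Z. \<Sum>x\<in>cube i y. if i < \<tau> x then \<phi> i x y else 0)"
    by (intro sum.cong refl sum_swap_blocks cube_block_map x0) auto
  also have "\<dots> = (\<Sum>i\<in>{m..<N}. \<Sum>y\<in>?Z. if i < \<tau> y then \<Sum>x\<in>cube i y. \<phi> i x y else 0)"
  proof (intro sum.cong refl)
    fix i y assume i: "i \<in> {m..<N}" and y: "y \<in> ?Z"
    show "(\<Sum>x\<in>cube i y. if i < \<tau> x then \<phi> i x y else 0) = (if i < \<tau> y then \<Sum>x\<in>cube i y. \<phi> i x y else 0)"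
      using stopping_less_iff[OF x0 st _ y] i by (auto intro: sum.cong)
  qed
  also have "\<dots> = (\<Sum>y\<in>?Z. \<Sum>i\<in>{m..<N}. if i < \<tau> y then \<Sum>x\<in>cube i y. \<phi> i x y else 0)"
    by (rule sum.swap)
  also have "\<dots> = (\<Sum>y\<in>?Z. \<Sum>i\<in>{m..<\<tau> y}. \<Sum>x\<in>cube i y. \<phi> i x y)"
    by (rule sum.cong[OF refl], rule restrict[symmetric])
  finally show ?thesis .
qed

lemma shift_op_adjoint:
  assumes x0: "x0 \<in> X" and st: "stopping (cube m x0) \<tau>" and N: "\<And>x. x \<in> cube m x0 \<Longrightarrow> \<tau> x \<le> N"
  shows "(\<Sum>x\<in>cube m x0. g x * shift_op h k m (\<tau> x) f x) = (\<Sum>x\<in>cube m x0. f x * shift_op k h m (\<tau> x) g x)"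
proof -
  have "(\<Sum>x\<in>cube m x0. g x * shift_op h k m (\<tau> x) f x)
      = (\<Sum>x\<in>cube m x0. \<Sum>i\<in>{m..<\<tau> x}. \<Sum>y\<in>cube i x. g x * h i x * k i y * f y)"
    by (simp add: shift_op_def sum_distrib_left mult.assoc)
  also have "\<dots> = (\<Sum>y\<in>cube m x0. \<Sum>i\<in>{m..<\<tau> y}. \<Sum>x\<in>cube i y. g x * h i x * k i y * f y)"
    by (rule sum_tree_swap[OF assms])
  also have "\<dots> = (\<Sum>x\<in>cube m x0. f x * shift_op k h m (\<tau> x) g x)"
    by (simp add: shift_op_def sum_distrib_left sum_distrib_right mult_ac)
  finally show ?thesis .
qed

text \<open>
  After exchanging the sums, each \<open>F y\<close> is multiplied by means of \<open>G\<close> over cubes above the stopping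
  cube of \<open>y\<close>, each at most \<open>\<beta>\<close>; only the generations \<open>i\<close> with \<open>i < \<tau> y < i + \<kappa>\<close> occur, and there are
  fewer than \<open>\<kappa>\<close> of them.  This is the source of the factor \<open>\<kappa>\<close>.
\<close>

lemma tree_kernel_sum_le:
  fixes F G :: "'a \<Rightarrow> real"
  assumes x0: "x0 \<in> X" and st: "stopping (cube m x0) \<tau>" and N: "\<And>x. x \<in> cube m x0 \<Longrightarrow> \<tau> x \<le> N"
    and F: "\<And>x. 0 \<le> F x" and \<beta>: "0 \<le> \<beta>"
    and G: "\<And>y i. y \<in> cube m x0 \<Longrightarrow> m \<le> i \<Longrightarrow> i < \<tau> y \<Longrightarrow> avg i G y \<le> \<beta>"
  shows "(\<Sum>x\<in>cube m x0. G x * (\<Sum>i\<in>{m..<\<tau> x}. \<Sum>y\<in>cube i x. (if \<tau> y < i + \<kappa> then F y else 0) / real (card (cube i x))))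
     \<le> real \<kappa> * \<beta> * (\<Sum>y\<in>cube m x0. F y)"
proof -
  let ?c = "\<lambda>i x y. (if \<tau> y < i + \<kappa> then F y else 0) / real (card (cube i x))"
  let ?Z = "cube m x0"
  have "(\<Sum>x\<in>?Z. G x * (\<Sum>i\<in>{m..<\<tau> x}. \<Sum>y\<in>cube i x. ?c i x y))
     = (\<Sum>x\<in>?Z. \<Sum>i\<in>{m..<\<tau> x}. \<Sum>y\<in>cube i x. G x * ?c i x y)"
    by (simp add: sum_distrib_left)
  also have "\<dots> = (\<Sum>y\<in>?Z. \<Sum>i\<in>{m..<\<tau> y}. \<Sum>x\<in>cube i y. G x * ?c i x y)"
    by (rule sum_tree_swap[OF x0 st N])
  also have "\<dots> \<le> (\<Sum>y\<in>?Z. real \<kappa> * \<beta> * F y)"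
  proof (rule sum_mono)
    fix y assume y: "y \<in> ?Z"
    then have Y: "y \<in> X" using cube_in_X x0 by blast
    have "(\<Sum>i\<in>{m..<\<tau> y}. \<Sum>x\<in>cube i y. G x * ?c i x y)
      = (\<Sum>i\<in>{m..<\<tau> y}. if \<tau> y < i + \<kappa> then F y * avg i G y else 0)"
    proof (intro sum.cong refl)
      fix i
      have "(\<Sum>x\<in>cube i y. G x * (c / real (card (cube i x)))) = c * avg i G y" for c
      proof -
        have "(\<Sum>x\<in>cube i y. G x * (c / real (card (cube i x)))) = (\<Sum>x\<in>cube i y. G x * (c / real (card (cube i y))))"
          by (intro sum.cong refl) (metis cube_eq[OF Y])
        then show ?thesis by (simp add: avg_def sum_distrib_left sum_distrib_right divide_inverse mult_ac)
      qed
      then show "(\<Sum>x\<in>cube i y. G x * ?c i x y)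
        = (if \<tau> y < i + \<kappa> then F y * avg i G y else 0)" by auto
    qed
    also have "\<dots> \<le> (\<Sum>i\<in>{m..<\<tau> y}. if \<tau> y < i + \<kappa> then F y * \<beta> else 0)"
      using G[OF y] F[of y] by (intro sum_mono) (auto intro!: mult_left_mono)
    also have "\<dots> = (\<Sum>i\<in>{i\<in>{m..<\<tau> y}. \<tau> y < i + \<kappa>}. F y * \<beta>)"
      by (simp only: sum.inter_filter finite_atLeastLessThan)
    also have "\<dots> = real (card {i\<in>{m..<\<tau> y}. \<tau> y < i + \<kappa>}) * (F y * \<beta>)" by simp
    also have "\<dots> \<le> real \<kappa> * (F y * \<beta>)"
    proof -
      have "card {i\<in>{m..<\<tau> y}. \<tau> y < i + \<kappa>} \<le> card {\<tau> y - \<kappa>..<\<tau> y}"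
        by (rule card_mono) auto
      then have "card {i\<in>{m..<\<tau> y}. \<tau> y < i + \<kappa>} \<le> \<kappa>" by simp
      then show ?thesis using F[of y] \<beta> by (intro mult_right_mono) auto
    qed
    finally show "(\<Sum>i\<in>{m..<\<tau> y}. \<Sum>x\<in>cube i y. G x * ?c i x y) \<le> real \<kappa> * \<beta> * F y"
      by (simp add: mult_ac)
  qed
  finally show ?thesis by (simp add: sum_distrib_left)
qed

end

section \<open>Cancellation against the kernels of a shift\<close>

locale haar_kernel = cube_tree X cube D for X :: "'a set" and cube D +
  fixes h k :: "nat \<Rightarrow> 'a \<Rightarrow> 'b::real_normed_field" and N \<kappa> :: nat
  assumes size: "x \<in> X \<Longrightarrow> y \<in> cube i x \<Longrightarrow> i < N \<Longrightarrow> norm (h i x) * norm (k i y) \<le> 1 / real (card (cube i x))"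
    and h_const: "x \<in> X \<Longrightarrow> y \<in> cube (i + \<kappa>) x \<Longrightarrow> i < N \<Longrightarrow> h i y = h i x"
    and k_const: "x \<in> X \<Longrightarrow> y \<in> cube (i + \<kappa>) x \<Longrightarrow> i < N \<Longrightarrow> k i y = k i x"
begin

lemma haar_kernel_adjoint: "haar_kernel X cube D k h N \<kappa>"
proof unfold_locales
  fix x y i assume a: "x \<in> X" "y \<in> cube i x" "i < N"
  then have "y \<in> X" "x \<in> cube i y" "cube i y = cube i x"
    using cube_in_X cube_eq cube_self by blast+
  then show "norm (k i x) * norm (h i y) \<le> 1 / real (card (cube i x))"
    using size[of y x i] a by (simp add: mult.commute)
qed (use h_const k_const in auto)

text \<open>
  If the stopping cube of \<open>y\<close> lies \<open>\<kappa>\<close> or more generations below \<open>i\<close>, then \<open>k i\<close> is constant on it and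
  annihilates \<open>b\<close>, which has mean zero there.  The size condition bounds the remaining terms.
\<close>

lemma cancelled_pairing:
  assumes x0: "x0 \<in> X" and st: "stopping (cube m x0) \<tau>"
    and m: "\<And>x. x \<in> cube m x0 \<Longrightarrow> m \<le> \<tau> x"
    and b: "\<And>x. x \<in> cube m x0 \<Longrightarrow> (\<Sum>y\<in>stop_cube \<tau> x. b y) = 0"
    and x: "x \<in> cube m x0" and i: "m \<le> i" "i < \<tau> x" "i < N"
  shows "norm (h i x * (\<Sum>y\<in>cube i x. k i y * b y))
     \<le> (\<Sum>y\<in>cube i x. (if \<tau> y < i + \<kappa> then norm (b y) else 0) / real (card (cube i x)))"
proof -
  let ?Y = "{y\<in>cube i x. i + \<kappa> \<le> \<tau> y}" and ?W = "{y\<in>cube i x. \<tau> y < i + \<kappa>}"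
  have X: "x \<in> X" using x x0 cube_in_X by blast
  have fin: "finite (cube i x)" using finite_cube[OF X] .
  have sub: "cube i x \<subseteq> cube m x0" using cube_mono[OF X i(1)] cube_eq[OF x0 x] by simp
  note bm = stop_block_map[OF x0 st m]
  have block: "stop_cube \<tau> y \<subseteq> cube (i + \<kappa>) y \<and> stop_cube \<tau> y \<subseteq> ?Y" if y: "y \<in> ?Y" for y
  proof -
    have yZ: "y \<in> cube m x0" using y sub by blast
    then have Y: "y \<in> X" using x0 cube_in_X by blast
    have 1: "stop_cube \<tau> y \<subseteq> cube (i + \<kappa>) y" using cube_mono[OF Y] y unfolding stop_cube_def by blast
    have 2: "cube (i + \<kappa>) y \<subseteq> cube i x" using cube_mono[OF Y, of i "i+\<kappa>"] cube_eq[OF X, of y i] y by auto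
    have "\<tau> z = \<tau> y" if "z \<in> stop_cube \<tau> y" for z
      using st yZ that unfolding stopping_def stop_cube_def by blast
    with 1 2 y show ?thesis by auto
  qed
  have bY: "block_map (stop_cube \<tau>) ?Y"
    unfolding block_map_def
  proof (intro conjI ballI)
    show "finite ?Y" using fin by auto
    fix y assume y: "y \<in> ?Y"
    then have yZ: "y \<in> cube m x0" using sub by blast
    show "y \<in> stop_cube \<tau> y" using block_mapD(1)[OF bm yZ] .
    show "stop_cube \<tau> y \<subseteq> ?Y" using block[OF y] ..
    show "stop_cube \<tau> z = stop_cube \<tau> y" if "z \<in> stop_cube \<tau> y" for z
      using block_mapD(4)[OF bm yZ that] .
  qed
  have "norm (\<Sum>y\<in>?Y. k i y * b y) \<le> (\<Sum>y\<in>?Y. 0)"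
  proof (rule norm_sum_le_blocks[OF bY])
    fix y assume y: "y \<in> ?Y"
    then have yZ: "y \<in> cube m x0" using sub by blast
    then have Y: "y \<in> X" using x0 cube_in_X by blast
    have "(\<Sum>z\<in>stop_cube \<tau> y. k i z * b z) = (\<Sum>z\<in>stop_cube \<tau> y. k i y * b z)"
    proof (intro sum.cong refl)
      fix z assume "z \<in> stop_cube \<tau> y"
      then have "z \<in> cube (i + \<kappa>) y" using block[OF y] by blast
      from k_const[OF Y this i(3)] show "k i z * b z = k i y * b z" by simp
    qed
    also have "\<dots> = 0" using b[OF yZ] by (simp add: sum_distrib_left[symmetric])
    finally show "norm (\<Sum>z\<in>stop_cube \<tau> y. k i z * b z) \<le> (\<Sum>z\<in>stop_cube \<tau> y. 0)" by simp
  qed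
  then have Y0: "(\<Sum>y\<in>?Y. k i y * b y) = 0" by simp
  have "(\<Sum>y\<in>cube i x. k i y * b y) = (\<Sum>y\<in>?Y \<union> ?W. k i y * b y)"
    by (rule arg_cong[where f = "sum _"]) auto
  also have "\<dots> = (\<Sum>y\<in>?Y. k i y * b y) + (\<Sum>y\<in>?W. k i y * b y)"
    by (rule sum.union_disjoint) (use fin in auto)
  finally have "(\<Sum>y\<in>cube i x. k i y * b y) = (\<Sum>y\<in>?W. k i y * b y)" using Y0 by simp
  then have "norm (h i x * (\<Sum>y\<in>cube i x. k i y * b y)) = norm (\<Sum>y\<in>?W. h i x * (k i y * b y))"
    by (simp add: sum_distrib_left)
  also have "\<dots> \<le> (\<Sum>y\<in>?W. norm (h i x * (k i y * b y)))" by (rule norm_sum)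
  also have "\<dots> \<le> (\<Sum>y\<in>?W. norm (b y) / real (card (cube i x)))"
  proof (rule sum_mono)
    fix y assume "y \<in> ?W"
    then have "norm (h i x) * norm (k i y) \<le> 1 / real (card (cube i x))" using size[OF X _ i(3)] by blast
    from mult_right_mono[OF this, of "norm (b y)"]
    show "norm (h i x * (k i y * b y)) \<le> norm (b y) / real (card (cube i x))"
      by (simp add: norm_mult mult.assoc)
  qed
  also have "\<dots> = (\<Sum>y\<in>cube i x. (if \<tau> y < i + \<kappa> then norm (b y) else 0) / real (card (cube i x)))"
    using fin by (intro sum.mono_neutral_cong_left) auto
  finally show ?thesis .
qed

lemma cancelled_shift_op_le:
  assumes x0: "x0 \<in> X" and st: "stopping (cube m x0) \<tau>"
    and m: "\<And>x. x \<in> cube m x0 \<Longrightarrow> m \<le> \<tau> x" and N: "\<And>x. x \<in> cube m x0 \<Longrightarrow> \<tau> x \<le> N"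
    and b: "\<And>x. x \<in> cube m x0 \<Longrightarrow> (\<Sum>y\<in>stop_cube \<tau> x. b y) = 0"
    and x: "x \<in> cube m x0"
  shows "norm (shift_op h k m (\<tau> x) b x)
     \<le> (\<Sum>i\<in>{m..<\<tau> x}. \<Sum>y\<in>cube i x. (if \<tau> y < i + \<kappa> then norm (b y) else 0) / real (card (cube i x)))"
  unfolding shift_op_def
  using N[OF x] by (intro order_trans[OF norm_sum] sum_mono cancelled_pairing[OF x0 st m b x]) auto

lemma cancelled_form_le:
  assumes x0: "x0 \<in> X" and st: "stopping (cube m x0) \<tau>"
    and m: "\<And>x. x \<in> cube m x0 \<Longrightarrow> m \<le> \<tau> x" and N: "\<And>x. x \<in> cube m x0 \<Longrightarrow> \<tau> x \<le> N"
    and b: "\<And>x. x \<in> cube m x0 \<Longrightarrow> (\<Sum>y\<in>stop_cube \<tau> x. b y) = 0"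
    and \<beta>: "0 \<le> \<beta>"
    and g: "\<And>y i. y \<in> cube m x0 \<Longrightarrow> m \<le> i \<Longrightarrow> i < \<tau> y \<Longrightarrow> avg i (\<lambda>y. norm (g y)) y \<le> \<beta>"
  shows "norm (\<Sum>x\<in>cube m x0. g x * shift_op h k m (\<tau> x) b x) \<le> real \<kappa> * \<beta> * (\<Sum>y\<in>cube m x0. norm (b y))"
proof -
  have "norm (\<Sum>x\<in>cube m x0. g x * shift_op h k m (\<tau> x) b x) \<le> (\<Sum>x\<in>cube m x0. norm (g x) * 
     (\<Sum>i\<in>{m..<\<tau> x}. \<Sum>y\<in>cube i x. (if \<tau> y < i + \<kappa> then norm (b y) else 0) / real (card (cube i x))))"
    using cancelled_shift_op_le[OF x0 st m N b]
    by (intro order_trans[OF norm_sum] sum_mono) (auto simp: norm_mult intro!: mult_left_mono)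
  also have "\<dots> \<le> real \<kappa> * \<beta> * (\<Sum>y\<in>cube m x0. norm (b y))"
    by (rule tree_kernel_sum_le[OF x0 st N _ \<beta> g]) auto
  finally show ?thesis .
qed

end

text \<open>
  The \<open>L\<^sup>2\<close> bound is required for the part of the operator inside every cube, as the stopping argument
  restarts on smaller cubes.
\<close>

locale haar_model = haar_kernel X cube D h k N \<kappa> for X :: "'a set" and cube D and h k :: "nat \<Rightarrow> 'a \<Rightarrow> 'b::real_normed_field" and N \<kappa> +
  fixes c :: real
  assumes c_nonneg: "0 \<le> c"
    and \<kappa>_pos: "1 \<le> \<kappa>"
    and L2: "x0 \<in> X \<Longrightarrow> m \<le> N \<Longrightarrow>
       (\<Sum>x\<in>cube m x0. (norm (shift_op h k m N f x))\<^sup>2) \<le> c\<^sup>2 * (\<Sum>x\<in>cube m x0. (norm (f x))\<^sup>2)"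
begin

lemma bounded_form_le:
  assumes x0: "x0 \<in> X" and m: "m \<le> N" and a: "0 \<le> a" and b: "0 \<le> b"
    and f: "\<And>x. x \<in> cube m x0 \<Longrightarrow> norm (f x) \<le> a" and g: "\<And>x. x \<in> cube m x0 \<Longrightarrow> norm (g x) \<le> b"
  shows "norm (\<Sum>x\<in>cube m x0. g x * shift_op h k m N f x) \<le> c * a * b * real (card (cube m x0))"
proof -
  let ?Z = "cube m x0" and ?T = "\<lambda>x. norm (shift_op h k m N f x)"
  have fin: "finite ?Z" using finite_cube[OF x0] .
  have "(sum ?T ?Z)\<^sup>2 \<le> (\<Sum>x\<in>?Z. (?T x)\<^sup>2) * real (card ?Z)"
    by (rule sum_squared_le_sum_of_squares) 
  also have "\<dots> \<le> (c\<^sup>2 * (\<Sum>x\<in>?Z. (norm (f x))\<^sup>2)) * real (card ?Z)"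
    by (intro mult_right_mono L2[OF x0 m]) auto
  also have "\<dots> \<le> (c\<^sup>2 * (\<Sum>x\<in>?Z. a\<^sup>2)) * real (card ?Z)"
    using f by (intro mult_right_mono mult_left_mono sum_mono power_mono) auto
  also have "\<dots> = (c * a * real (card ?Z))\<^sup>2" by (simp add: power2_eq_square mult_ac)
  finally have T: "sum ?T ?Z \<le> c * a * real (card ?Z)"
    using c_nonneg a by (elim power2_le_imp_le) auto
  have "norm (\<Sum>x\<in>?Z. g x * shift_op h k m N f x) \<le> (\<Sum>x\<in>?Z. b * ?T x)"
    using g by (intro order_trans[OF norm_sum] sum_mono) (auto simp: norm_mult intro!: mult_right_mono)
  also have "\<dots> \<le> b * (c * a * real (card ?Z))"
    unfolding sum_distrib_left[symmetric] by (rule mult_left_mono[OF T b])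
  finally show ?thesis by (simp add: mult_ac)
qed

text \<open>
  The scales above the stopping cubes are all scales minus those inside the stopping cubes, and both
  operators are bounded on \<open>L\<^sup>2\<close>, the second one because it acts separately on disjoint cubes.
\<close>

lemma bounded_tree_form_le:
  assumes x0: "x0 \<in> X" and m: "m \<le> N" and st: "stopping (cube m x0) \<tau>"
    and m': "\<And>x. x \<in> cube m x0 \<Longrightarrow> m \<le> \<tau> x" and N: "\<And>x. x \<in> cube m x0 \<Longrightarrow> \<tau> x \<le> N"
    and a: "0 \<le> a" and b: "0 \<le> b"
    and f: "\<And>x. x \<in> cube m x0 \<Longrightarrow> norm (f x) \<le> a" and g: "\<And>x. x \<in> cube m x0 \<Longrightarrow> norm (g x) \<le> b"
  shows "norm (\<Sum>x\<in>cube m x0. g x * shift_op h k m (\<tau> x) f x) \<le> 2 * (c * a * b * real (card (cube m x0)))"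
proof -
  let ?Z = "cube m x0"
  note bm = stop_block_map[OF x0 st m']
  have "(\<Sum>x\<in>?Z. g x * shift_op h k m (\<tau> x) f x) = (\<Sum>x\<in>?Z. g x * shift_op h k m N f x - g x * shift_op h k (\<tau> x) N f x)"
  proof (rule sum.cong[OF refl])
    fix x assume x: "x \<in> ?Z"
    show "g x * shift_op h k m (\<tau> x) f x = g x * shift_op h k m N f x - g x * shift_op h k (\<tau> x) N f x"
      unfolding shift_op_split[OF m'[OF x] N[OF x]] by (simp add: algebra_simps)
  qed
  then have "norm (\<Sum>x\<in>?Z. g x * shift_op h k m (\<tau> x) f x)
     \<le> norm (\<Sum>x\<in>?Z. g x * shift_op h k m N f x) + norm (\<Sum>x\<in>?Z. g x * shift_op h k (\<tau> x) N f x)"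
    by (simp add: sum_subtractf norm_triangle_ineq4)
  moreover have "norm (\<Sum>x\<in>?Z. g x * shift_op h k m N f x) \<le> c * a * b * real (card ?Z)"
    by (rule bounded_form_le[OF x0 m a b f g])
  moreover have "norm (\<Sum>x\<in>?Z. g x * shift_op h k (\<tau> x) N f x) \<le> (\<Sum>x\<in>?Z. c * a * b)"
  proof (rule norm_sum_le_blocks[OF bm])
    fix x assume x: "x \<in> ?Z"
    then have X: "x \<in> X" using x0 cube_in_X by blast
    have sub: "cube (\<tau> x) x \<subseteq> ?Z" using block_mapD(2)[OF bm x] by (simp add: stop_cube_def)
    have "(\<Sum>y\<in>stop_cube \<tau> x. g y * shift_op h k (\<tau> y) N f y) = (\<Sum>y\<in>cube (\<tau> x) x. g y * shift_op h k (\<tau> x) N f y)"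
      using st x unfolding stop_cube_def stopping_def by (intro sum.cong) auto
    also have "norm \<dots> \<le> c * a * b * real (card (cube (\<tau> x) x))"
      by (rule bounded_form_le[OF X N[OF x] a b]) (use f g sub in auto)
    finally show "norm (\<Sum>y\<in>stop_cube \<tau> x. g y * shift_op h k (\<tau> y) N f y) \<le> (\<Sum>y\<in>stop_cube \<tau> x. c * a * b)"
      by (simp add: stop_cube_def mult_ac)
  qed
  ultimately show ?thesis by (simp add: mult_ac)
qed

end

section \<open>The maximal function\<close>

lemma (in cube_tree) sum_avg_times:
  fixes u w :: "'a \<Rightarrow> real"
  assumes x0: "x0 \<in> X" and i: "m \<le> i"
    and w: "\<And>x y. x \<in> cube m x0 \<Longrightarrow> y \<in> cube i x \<Longrightarrow> w y = w x"
  shows "(\<Sum>x\<in>cube m x0. avg i u x * w x) = (\<Sum>x\<in>cube m x0. u x * w x)"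
proof -
  have "(\<Sum>x\<in>cube m x0. avg i u x * w x)
     = (\<Sum>x\<in>cube m x0. (\<Sum>y\<in>cube i x. u y * w y) /\<^sub>R real (card (cube i x)))"
  proof (rule sum.cong[OF refl])
    fix x assume x: "x \<in> cube m x0"
    have "(\<Sum>y\<in>cube i x. u y * w y) = (\<Sum>y\<in>cube i x. u y * w x)"
      by (intro sum.cong refl) (metis w[OF x])
    then show "avg i u x * w x = (\<Sum>y\<in>cube i x. u y * w y) /\<^sub>R real (card (cube i x))"
      by (simp add: avg_def sum_distrib_right)
  qed
  also have "\<dots> = (\<Sum>x\<in>cube m x0. u x * w x)"
    by (rule sum_block_averages[OF cube_block_map[OF x0 i]])
  finally show ?thesis .
qed

definition (in cube_tree) maxfn :: "nat \<Rightarrow> nat \<Rightarrow> ('a \<Rightarrow> real) \<Rightarrow> 'a \<Rightarrow> real" where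
  "maxfn m n u x = Max ((\<lambda>i. avg i u x) ` {m..n})"

context cube_tree begin

lemma avg_le_maxfn: "m \<le> i \<Longrightarrow> i \<le> n \<Longrightarrow> avg i u x \<le> maxfn m n u x"
  unfolding maxfn_def by (intro Max_ge) auto

lemma maxfn_nonneg: "m \<le> n \<Longrightarrow> (\<And>y. 0 \<le> u y) \<Longrightarrow> 0 \<le> maxfn m n u x"
  using order_trans[OF avg_nonneg avg_le_maxfn[of m m n u x]] by blast

lemma maxfn_antimono: "m \<le> m' \<Longrightarrow> m' \<le> n \<Longrightarrow> maxfn m' n u x \<le> maxfn m n u x"
  unfolding maxfn_def by (intro Max_mono) auto

lemma maxfn_same: "maxfn m m u x = avg m u x"
  unfolding maxfn_def by simp

lemma maxfn_Suc: "m \<le> n \<Longrightarrow> maxfn m (Suc n) u x = max (avg (Suc n) u x) (maxfn m n u x)"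
  unfolding maxfn_def by (simp add: atLeastAtMostSuc_conv)

lemma maxfn_cong:
  assumes "x \<in> X" "y \<in> cube n x" shows "maxfn m n u y = maxfn m n u x"
proof -
  have "avg i u y = avg i u x" if "i \<in> {m..n}" for i
    using avg_cong[OF assms(1), of y i u] cube_mono[OF assms(1), of i n] assms(2) that by auto
  then have "(\<lambda>i. avg i u y) ` {m..n} = (\<lambda>i. avg i u x) ` {m..n}" by (rule image_cong[OF refl])
  then show ?thesis unfolding maxfn_def by simp
qed

text \<open>
  Young's inequality for \<open>a b\<^bsup>p-1\<^esup>\<close>, written as a discrete chain rule: the constant \<open>p / (p - 1)\<close> is
  the one in Doob's inequality.
\<close>

lemma powr_diff_le:
  fixes a b :: real
  assumes p: "1 < p" and b: "0 \<le> b" "b \<le> a"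
  shows "a powr p - b powr p \<le> p / (p - 1) * (a * (a powr (p - 1) - b powr (p - 1)))"
proof -
  define q where "q = p / (p - 1)"
  have q: "1 < q" "1 / p + 1 / q = 1" using p by (auto simp: q_def field_simps)
  have pq: "(p - 1) * q = p" "q / p = q - 1" using p by (auto simp: q_def field_simps)
  have "a * b powr (p - 1) \<le> a powr p / p + (b powr (p - 1)) powr q / q"
    by (rule Youngs_inequality) (use p q b in auto)
  then have "a * b powr (p - 1) \<le> a powr p / p + b powr p / q"
    using pq by (simp add: powr_powr)
  then have "q * (a * b powr (p - 1)) \<le> q * (a powr p / p + b powr p / q)"
    using q by (intro mult_left_mono) auto
  also have "\<dots> = q / p * a powr p + b powr p" using q by (simp add: field_simps)
  also have "\<dots> = (q - 1) * a powr p + b powr p" unfolding pq ..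
  finally have 1: "q * (a * b powr (p - 1)) \<le> (q - 1) * a powr p + b powr p" .
  have 2: "a * a powr (p - 1) = a powr p" using b by (simp add: powr_mult_base)
  show ?thesis using 1 2 unfolding q_def[symmetric] by (simp add: algebra_simps)
qed

text \<open>
  Doob's argument.  When the running maximum increases at generation \<open>n + 1\<close>, its new value is the mean
  \<open>avg (n + 1) u\<close>; the increment of the power \<open>p - 1\<close> of the maximum is constant on the cubes of that
  generation, so the mean may be replaced by \<open>u\<close>, and the increments add up.
\<close>

lemma maxfn_powr_le:
  fixes u :: "'a \<Rightarrow> real"
  assumes x0: "x0 \<in> X" and p: "1 < p" and u: "\<And>x. 0 \<le> u x" and mn: "m \<le> n"
  shows "(\<Sum>x\<in>cube m x0. maxfn m n u x powr p)
    \<le> p / (p - 1) * (\<Sum>x\<in>cube m x0. u x * maxfn m n u x powr (p - 1))"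
  using mn
proof (induction n rule: dec_induct)
  case base
  have *: "1 \<le> p / (p - 1)" using p by simp
  have "(\<Sum>x\<in>cube m x0. maxfn m m u x powr p) = (\<Sum>x\<in>cube m x0. avg m u x * avg m u x powr (p - 1))"
    using avg_nonneg[OF u] by (simp add: maxfn_same powr_mult_base)
  also have "\<dots> = (\<Sum>x\<in>cube m x0. u x * avg m u x powr (p - 1))"
    by (rule sum_avg_times[OF x0 order_refl]) (metis avg_cong cube_in_X x0)
  also have "\<dots> \<le> p / (p - 1) * \<dots>"
    using mult_right_mono[OF *, of "\<Sum>x\<in>cube m x0. u x * avg m u x powr (p - 1)"] u
    by (simp add: sum_nonneg)
  finally show ?case by (simp add: maxfn_same)
next
  case (step n)
  define q where "q = p / (p - 1)"
  let ?M = "\<lambda>n x. maxfn m n u x"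
  define w where "w = (\<lambda>x. ?M (Suc n) x powr (p - 1) - ?M n x powr (p - 1))"
  have w: "w y = w x" if x: "x \<in> cube m x0" and y: "y \<in> cube (Suc n) x" for x y
  proof -
    have X: "x \<in> X" using x cube_in_X x0 by blast
    have "y \<in> cube n x" using y cube_Suc[OF X] by blast
    then show ?thesis unfolding w_def using maxfn_cong[OF X] y by metis
  qed
  have "?M (Suc n) x powr p \<le> ?M n x powr p + q * (avg (Suc n) u x * w x)" for x
  proof (cases "avg (Suc n) u x \<le> ?M n x")
    case True then show ?thesis using step by (simp add: maxfn_Suc w_def max_def)
  next
    case False
    then have *: "?M (Suc n) x = avg (Suc n) u x" using step by (simp add: maxfn_Suc)
    have "0 \<le> ?M n x" using maxfn_nonneg u step by blast
    from powr_diff_le[OF p this, of "avg (Suc n) u x"] False show ?thesis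
      unfolding w_def q_def * by simp
  qed
  then have "(\<Sum>x\<in>cube m x0. ?M (Suc n) x powr p)
     \<le> (\<Sum>x\<in>cube m x0. ?M n x powr p + q * (avg (Suc n) u x * w x))" by (intro sum_mono)
  also have "\<dots> = (\<Sum>x\<in>cube m x0. ?M n x powr p) + q * (\<Sum>x\<in>cube m x0. avg (Suc n) u x * w x)"
    by (simp add: sum.distrib sum_distrib_left)
  also have "(\<Sum>x\<in>cube m x0. avg (Suc n) u x * w x) = (\<Sum>x\<in>cube m x0. u x * w x)"
    by (rule sum_avg_times[OF x0 _ w]) (use step in auto)
  also have "(\<Sum>x\<in>cube m x0. ?M n x powr p) + q * (\<Sum>x\<in>cube m x0. u x * w x)
     \<le> q * (\<Sum>x\<in>cube m x0. u x * ?M n x powr (p - 1)) + q * (\<Sum>x\<in>cube m x0. u x * w x)"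
    using step.IH by (simp add: q_def)
  also have "\<dots> = q * (\<Sum>x\<in>cube m x0. u x * ?M (Suc n) x powr (p - 1))"
    by (simp add: w_def algebra_simps sum_subtractf)
  finally show ?case unfolding q_def .
qed

text \<open>
  The integrand \<open>u M\<^bsup>p-1\<^esup>\<close> of the previous bound is absorbed: either \<open>u\<close> is a small multiple of \<open>M\<close>, and
  the term is at most half of \<open>M\<^sup>p\<close>, or \<open>M\<close> is at most a multiple of \<open>u\<close>.
\<close>

theorem maxfn_strong_type:
  fixes u :: "'a \<Rightarrow> real"
  assumes x0: "x0 \<in> X" and p: "1 < p" and u: "\<And>x. 0 \<le> u x" and mn: "m \<le> n"
  shows "(\<Sum>x\<in>cube m x0. maxfn m n u x powr p)
    \<le> (2 * (p / (p - 1))) powr p * (\<Sum>x\<in>cube m x0. u x powr p)"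
proof -
  define q where "q = p / (p - 1)"
  have q: "1 < q" using p by (simp add: q_def field_simps)
  let ?M = "\<lambda>x. maxfn m n u x"
  have M0: "0 \<le> ?M x" for x using maxfn_nonneg u mn by blast
  have pt: "q * (u x * ?M x powr (p - 1)) \<le> 1/2 * ?M x powr p + 1/2 * ((2 * q) powr p * u x powr p)" for x
  proof (cases "2 * q * u x \<le> ?M x")
    case True
    have "2 * q * u x * ?M x powr (p - 1) \<le> ?M x * ?M x powr (p - 1)"
      by (rule mult_right_mono[OF True]) simp
    also have "\<dots> = ?M x powr p" using M0 by (simp add: powr_mult_base)
    finally have "q * (u x * ?M x powr (p - 1)) \<le> 1/2 * ?M x powr p" by simp
    moreover have "0 \<le> 1/2 * ((2 * q) powr p * u x powr p)" by simp
    ultimately show ?thesis by linarith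
  next
    case False
    have "2 * q * u x * ?M x powr (p - 1) \<le> 2 * q * u x * (2 * q * u x) powr (p - 1)"
      using False q u[of x] p M0 by (intro mult_left_mono powr_mono2) auto
    also have "\<dots> = (2 * q * u x) powr p" using q u by (simp add: powr_mult_base)
    also have "\<dots> = (2 * q) powr p * u x powr p" using q u by (simp add: powr_mult)
    finally have "q * (u x * ?M x powr (p - 1)) \<le> 1/2 * ((2 * q) powr p * u x powr p)" by simp
    moreover have "0 \<le> 1/2 * ?M x powr p" by simp
    ultimately show ?thesis by linarith
  qed
  have "(\<Sum>x\<in>cube m x0. ?M x powr p) \<le> (\<Sum>x\<in>cube m x0. q * (u x * ?M x powr (p - 1)))"
    using maxfn_powr_le[OF assms] by (simp add: q_def sum_distrib_left)
  also have "\<dots> \<le> (\<Sum>x\<in>cube m x0. 1/2 * ?M x powr p + 1/2 * ((2 * q) powr p * u x powr p))"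
    by (intro sum_mono pt)
  also have "\<dots> = 1/2 * (\<Sum>x\<in>cube m x0. ?M x powr p) + 1/2 * ((2 * q) powr p * (\<Sum>x\<in>cube m x0. u x powr p))"
    by (simp add: sum.distrib sum_distrib_left)
  finally show ?thesis unfolding q_def by linarith
qed

section \<open>Domination by the maximal function\<close>

definition stop_avg :: "('a \<Rightarrow> nat) \<Rightarrow> ('a \<Rightarrow> 'b::real_vector) \<Rightarrow> 'a \<Rightarrow> 'b" where
  "stop_avg \<tau> f x = avg (\<tau> x) f x"

lemma sum_stop_avg:
  assumes x0: "x0 \<in> X" and st: "stopping (cube m x0) \<tau>" and m: "\<And>x. x \<in> cube m x0 \<Longrightarrow> m \<le> \<tau> x"
  shows "(\<Sum>x\<in>cube m x0. stop_avg \<tau> u x) = (\<Sum>x\<in>cube m x0. u x)"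
  using sum_block_averages[OF stop_block_map[OF assms], of u]
  by (simp add: stop_avg_def avg_def stop_cube_def)

lemma stop_avg_cancel:
  assumes x0: "x0 \<in> X" and st: "stopping (cube m x0) \<tau>" and x: "x \<in> cube m x0"
  shows "(\<Sum>y\<in>stop_cube \<tau> x. f y - stop_avg \<tau> f y) = 0"
proof -
  have X: "x \<in> X" using x x0 cube_in_X by blast
  have "stop_avg \<tau> f y = avg (\<tau> x) f x" if "y \<in> stop_cube \<tau> x" for y
  proof -
    have "\<tau> y = \<tau> x" using st x that unfolding stopping_def stop_cube_def by blast
    then show ?thesis using avg_cong[OF X] that unfolding stop_avg_def stop_cube_def by metis
  qed
  then have "(\<Sum>y\<in>stop_cube \<tau> x. stop_avg \<tau> f y) = real (card (cube (\<tau> x) x)) *\<^sub>R avg (\<tau> x) f x"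
    by (simp add: stop_cube_def sum_constant_scaleR)
  also have "\<dots> = (\<Sum>y\<in>stop_cube \<tau> x. f y)"
    using card_cube_pos[OF X, of "\<tau> x"] by (simp add: avg_def stop_cube_def)
  finally show ?thesis by (simp add: sum_subtractf)
qed

lemma sum_norm_diff_stop_avg_le:
  fixes f :: "'a \<Rightarrow> 'b::real_normed_vector"
  assumes x0: "x0 \<in> X" and st: "stopping (cube m x0) \<tau>" and m: "\<And>x. x \<in> cube m x0 \<Longrightarrow> m \<le> \<tau> x"
  shows "(\<Sum>x\<in>cube m x0. norm (f x - stop_avg \<tau> f x)) \<le> 2 * (\<Sum>x\<in>cube m x0. norm (f x))"
proof -
  have "norm (f x - stop_avg \<tau> f x) \<le> norm (f x) + stop_avg \<tau> (\<lambda>y. norm (f y)) x" for x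
    unfolding stop_avg_def by (rule order_trans[OF norm_triangle_ineq4 add_left_mono[OF norm_avg_le]])
  then have "(\<Sum>x\<in>cube m x0. norm (f x - stop_avg \<tau> f x))
     \<le> (\<Sum>x\<in>cube m x0. norm (f x) + stop_avg \<tau> (\<lambda>y. norm (f y)) x)" by (rule sum_mono)
  also have "\<dots> = 2 * (\<Sum>x\<in>cube m x0. norm (f x))"
    by (simp add: sum.distrib sum_stop_avg[OF assms])
  finally show ?thesis .
qed

text \<open>
  A stopping cube may have a large mean, but its parent was not stopped, and passing to a child
  increases the mean of a nonnegative function by the factor \<open>D\<close> at most.
\<close>

lemma stop_avg_le:
  fixes u :: "'a \<Rightarrow> real"
  assumes x: "x \<in> X" and u: "\<And>y. 0 \<le> u y" and m: "m < \<tau> x"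
    and a: "\<And>i. m \<le> i \<Longrightarrow> i < \<tau> x \<Longrightarrow> avg i u x \<le> a"
  shows "stop_avg \<tau> u x \<le> D * a"
proof -
  obtain i where i: "\<tau> x = Suc i" using m by (cases "\<tau> x") auto
  have "avg (Suc i) u x \<le> D * avg i u x" by (rule avg_Suc_le[OF x u])
  also have "\<dots> \<le> D * a" using D_pos[OF x] a[of i] m i by (intro mult_left_mono) auto
  finally show ?thesis by (simp add: stop_avg_def i)
qed

end

context haar_model begin

definition sparse_const :: real where "sparse_const = (64 * c + 32) * D\<^sup>2 * real \<kappa>"

text \<open>
  With \<open>f = f' + f''\<close> and \<open>g = g' + g''\<close> split into stopped means and mean-zero remainders, the form is
  the sum of \<open>(f', g')\<close>, \<open>(f', g'')\<close> and \<open>(f'', g)\<close>.  The first is bounded through \<open>L\<^sup>2\<close>, the last by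
  cancellation against \<open>k\<close>, and the middle one by cancellation against \<open>h\<close> after passing to the adjoint.
\<close>

lemma tree_form_le:
  assumes x0: "x0 \<in> X" and m: "m < N" and st: "stopping (cube m x0) \<tau>"
    and m': "\<And>x. x \<in> cube m x0 \<Longrightarrow> m < \<tau> x" and N: "\<And>x. x \<in> cube m x0 \<Longrightarrow> \<tau> x \<le> N"
    and a: "0 \<le> a" "\<And>x i. x \<in> cube m x0 \<Longrightarrow> m \<le> i \<Longrightarrow> i < \<tau> x \<Longrightarrow> avg i (\<lambda>y. norm (f y)) x \<le> 4 * a"
      "(\<Sum>x\<in>cube m x0. norm (f x)) = a * real (card (cube m x0))"
    and b: "0 \<le> b" "\<And>x i. x \<in> cube m x0 \<Longrightarrow> m \<le> i \<Longrightarrow> i < \<tau> x \<Longrightarrow> avg i (\<lambda>y. norm (g y)) x \<le> 4 * b"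
      "(\<Sum>x\<in>cube m x0. norm (g x)) = b * real (card (cube m x0))"
  shows "norm (\<Sum>x\<in>cube m x0. g x * shift_op h k m (\<tau> x) f x) \<le> sparse_const / 2 * (a * b * real (card (cube m x0)))"
proof -
  let ?Z = "cube m x0" and ?C = "real (card (cube m x0))"
  interpret adj: haar_kernel X cube D k h N \<kappa> by (rule haar_kernel_adjoint)
  have m'': "m \<le> \<tau> x" if "x \<in> ?Z" for x using m'[OF that] by simp
  have inX: "x \<in> X" if "x \<in> ?Z" for x using that x0 cube_in_X by blast
  have D1: "1 \<le> D" using D_pos[OF x0] .
  define f' f'' where "f' = stop_avg \<tau> f" and "f'' = (\<lambda>x. f x - stop_avg \<tau> f x)"
  define g' g'' where "g' = stop_avg \<tau> g" and "g'' = (\<lambda>x. g x - stop_avg \<tau> g x)"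
  have f': "norm (f' x) \<le> D * (4 * a)" if x: "x \<in> ?Z" for x
  proof -
    have "norm (f' x) \<le> stop_avg \<tau> (\<lambda>y. norm (f y)) x" unfolding f'_def stop_avg_def by (rule norm_avg_le)
    also have "\<dots> \<le> D * (4 * a)" by (rule stop_avg_le[where m = m]) (use inX[OF x] m'[OF x] a(2)[OF x] in auto)
    finally show ?thesis .
  qed
  have g': "norm (g' x) \<le> D * (4 * b)" if x: "x \<in> ?Z" for x
  proof -
    have "norm (g' x) \<le> stop_avg \<tau> (\<lambda>y. norm (g y)) x" unfolding g'_def stop_avg_def by (rule norm_avg_le)
    also have "\<dots> \<le> D * (4 * b)" by (rule stop_avg_le[where m = m]) (use inX[OF x] m'[OF x] b(2)[OF x] in auto)
    finally show ?thesis .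
  qed
  have 1: "norm (\<Sum>x\<in>?Z. g' x * shift_op h k m (\<tau> x) f' x) \<le> 2 * (c * (D * (4 * a)) * (D * (4 * b)) * ?C)"
    by (rule bounded_tree_form_le[OF x0 less_imp_le[OF m] st m'' N _ _ f' g']) (use a b D1 in auto)
  have "norm (\<Sum>x\<in>?Z. f' x * shift_op k h m (\<tau> x) g'' x) \<le> real \<kappa> * (D * (4 * a)) * (\<Sum>y\<in>?Z. norm (g'' y))"
  proof (rule adj.cancelled_form_le[OF x0 st m'' N])
    show "(\<Sum>y\<in>stop_cube \<tau> x. g'' y) = 0" if "x \<in> ?Z" for x
      unfolding g''_def by (rule stop_avg_cancel[OF x0 st that])
    show "0 \<le> D * (4 * a)" using D1 a by simp
    show "avg i (\<lambda>y. norm (f' y)) y \<le> D * (4 * a)" if y: "y \<in> ?Z" and i: "m \<le> i" for y i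
    proof (rule avg_le[OF inX[OF y]])
      fix z assume "z \<in> cube i y"
      then have "z \<in> ?Z" using block_mapD(2)[OF cube_block_map[OF x0 i] y] by blast
      then show "norm (f' z) \<le> D * (4 * a)" by (rule f')
    qed
  qed
  also have "(\<Sum>x\<in>?Z. f' x * shift_op k h m (\<tau> x) g'' x) = (\<Sum>x\<in>?Z. g'' x * shift_op h k m (\<tau> x) f' x)"
    by (rule shift_op_adjoint[OF x0 st N])
  also have "real \<kappa> * (D * (4 * a)) * (\<Sum>y\<in>?Z. norm (g'' y)) \<le> real \<kappa> * (D * (4 * a)) * (2 * (b * ?C))"
    using sum_norm_diff_stop_avg_le[OF x0 st m'', of g] a(1) D1 unfolding g''_def b(3)
    by (intro mult_left_mono) auto
  finally have 2: "norm (\<Sum>x\<in>?Z. g'' x * shift_op h k m (\<tau> x) f' x) \<le> real \<kappa> * (D * (4 * a)) * (2 * (b * ?C))" .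
  have "norm (\<Sum>x\<in>?Z. g x * shift_op h k m (\<tau> x) f'' x) \<le> real \<kappa> * (4 * b) * (\<Sum>y\<in>?Z. norm (f'' y))"
  proof (rule cancelled_form_le[OF x0 st m'' N _ _ b(2)])
    show "(\<Sum>y\<in>stop_cube \<tau> x. f'' y) = 0" if "x \<in> ?Z" for x
      unfolding f''_def by (rule stop_avg_cancel[OF x0 st that])
  qed (use b in auto)
  also have "real \<kappa> * (4 * b) * (\<Sum>y\<in>?Z. norm (f'' y)) \<le> real \<kappa> * (4 * b) * (2 * (a * ?C))"
    using sum_norm_diff_stop_avg_le[OF x0 st m'', of f] b(1) unfolding f''_def a(3)
    by (intro mult_left_mono) auto
  finally have 3: "norm (\<Sum>x\<in>?Z. g x * shift_op h k m (\<tau> x) f'' x) \<le> real \<kappa> * (4 * b) * (2 * (a * ?C))" .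
  have f_eq: "f = (\<lambda>x. f' x + f'' x)" by (simp add: f'_def f''_def)
  have split: "g x * shift_op h k m n f x
      = g' x * shift_op h k m n f' x + g'' x * shift_op h k m n f' x + g x * shift_op h k m n f'' x" for x n
  proof -
    have "shift_op h k m n f x = shift_op h k m n f' x + shift_op h k m n f'' x"
      by (subst f_eq, rule shift_op_add)
    moreover have "g x = g' x + g'' x" by (simp add: g'_def g''_def)
    ultimately show ?thesis by (simp add: algebra_simps)
  qed
  have "norm (\<Sum>x\<in>?Z. g x * shift_op h k m (\<tau> x) f x)
      = norm ((\<Sum>x\<in>?Z. g' x * shift_op h k m (\<tau> x) f' x) + (\<Sum>x\<in>?Z. g'' x * shift_op h k m (\<tau> x) f' x)
           + (\<Sum>x\<in>?Z. g x * shift_op h k m (\<tau> x) f'' x))"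
    by (simp only: split sum.distrib)
  also have "\<dots> \<le> 2 * (c * (D * (4 * a)) * (D * (4 * b)) * ?C) + real \<kappa> * (D * (4 * a)) * (2 * (b * ?C))
           + real \<kappa> * (4 * b) * (2 * (a * ?C))"
    using 1 2 3 by (intro order_trans[OF norm_triangle_ineq] add_mono)
  also have "\<dots> = (32 * c * D\<^sup>2 + 8 * D * real \<kappa> + 8 * real \<kappa>) * (a * b * ?C)"
    by (simp add: algebra_simps power2_eq_square)
  also have "\<dots> \<le> sparse_const / 2 * (a * b * ?C)"
  proof (rule mult_right_mono)
    have k1: "1 \<le> real \<kappa>" using \<kappa>_pos by simp
    have D2: "D \<le> D\<^sup>2" "1 \<le> D\<^sup>2" using D1 by (auto simp: power2_eq_square mult_mono[of 1 D 1 D, simplified] mult_left_mono[of 1 D D, simplified])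
    have "32 * c * D\<^sup>2 * 1 \<le> 32 * c * D\<^sup>2 * real \<kappa>" using k1 c_nonneg by (intro mult_left_mono) auto
    moreover have "8 * D * real \<kappa> \<le> 8 * D\<^sup>2 * real \<kappa>" using D2 k1 by (intro mult_right_mono) auto
    moreover have "8 * 1 * real \<kappa> \<le> 8 * D\<^sup>2 * real \<kappa>" using D2 k1 by (intro mult_right_mono) auto
    ultimately show "32 * c * D\<^sup>2 + 8 * D * real \<kappa> + 8 * real \<kappa> \<le> sparse_const / 2"
      unfolding sparse_const_def by (simp add: algebra_simps)
    show "0 \<le> a * b * ?C" using a b by simp
  qed
  finally show ?thesis .
qed

lemma sparse_const_pos: "x \<in> X \<Longrightarrow> 0 < sparse_const"
  unfolding sparse_const_def using D_pos[of x] c_nonneg \<kappa>_pos by (auto intro!: mult_pos_pos add_nonneg_pos)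

text \<open>
  The points outside the stopping cubes carry at least half of \<open>Q\<close>.  There the product of the maximal
  functions is at least \<open>a b\<close>, so these points pay for the scales above the stopping cubes, while
  the points inside pay for the smaller cubes by induction.  No point is charged twice.
\<close>

theorem sparse_domination:
  assumes "x0 \<in> X" "m \<le> N"
  shows "norm (\<Sum>x\<in>cube m x0. g x * shift_op h k m N f x)
    \<le> sparse_const * (\<Sum>x\<in>cube m x0. maxfn m N (\<lambda>y. norm (f y)) x * maxfn m N (\<lambda>y. norm (g y)) x)"
  using assms
proof (induction "N - m" arbitrary: m x0 rule: less_induct)
  case less
  note x0 = \<open>x0 \<in> X\<close> and mN = \<open>m \<le> N\<close>
  let ?Z = "cube m x0" and ?C = "real (card (cube m x0))"
  let ?u = "\<lambda>y. norm (f y)" and ?v = "\<lambda>y. norm (g y)"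
  have C: "?C > 0" using card_cube_pos[OF x0] by simp
  have inX: "x \<in> X" if "x \<in> ?Z" for x using that x0 cube_in_X by blast
  define MM where "MM = (\<lambda>m x. maxfn m N ?u x * maxfn m N ?v x)"
  have MM0: "0 \<le> MM m x" if "m \<le> N" for m x
    unfolding MM_def using that by (intro mult_nonneg_nonneg maxfn_nonneg) auto
  define K where "K = sparse_const"
  have K0: "0 < K" unfolding K_def by (rule sparse_const_pos[OF x0])
  define a b where "a = avg m ?u x0" and "b = avg m ?v x0"
  have a_sum: "(\<Sum>x\<in>?Z. ?u x) = a * ?C" and b_sum: "(\<Sum>x\<in>?Z. ?v x) = b * ?C"
    unfolding a_def b_def by (simp_all add: sum_eq_avg[OF x0])
  have ab0: "0 \<le> a" "0 \<le> b" unfolding a_def b_def by (auto intro: avg_nonneg)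
  have fin: "finite ?Z" using finite_cube[OF x0] .
  have goal: "norm (\<Sum>x\<in>?Z. g x * shift_op h k m N f x) \<le> K * (\<Sum>x\<in>?Z. MM m x)"
  proof -
    consider "m = N \<or> a = 0 \<or> b = 0" | "m < N" "0 < a" "0 < b" using mN ab0 by linarith
    then show ?thesis
    proof cases
      case 1
      have "g x * shift_op h k m N f x = 0" if x: "x \<in> ?Z" for x
      proof -
        consider "m = N" | "a = 0" | "b = 0" using 1 by blast
        then show ?thesis
        proof cases
          case 1 then show ?thesis by (simp add: shift_op_def)
        next
          case 2
          then have "\<forall>y\<in>?Z. f y = 0" using a_sum fin by (simp add: sum_nonneg_eq_0_iff)
          moreover have "cube i x \<subseteq> ?Z" if "m \<le> i" for i using block_mapD(2)[OF cube_block_map[OF x0 that] x] .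
          ultimately have "(\<Sum>y\<in>cube i x. k i y * f y) = 0" if "m \<le> i" for i
            using that by (intro sum.neutral) force
          then show ?thesis by (simp add: shift_op_def)
        next
          case 3
          then have "\<forall>y\<in>?Z. g y = 0" using b_sum fin by (simp add: sum_nonneg_eq_0_iff)
          then show ?thesis using x by simp
        qed
      qed
      then have "(\<Sum>x\<in>?Z. g x * shift_op h k m N f x) = 0" by (intro sum.neutral) blast
      then show ?thesis using K0 MM0[OF mN] by (simp add: sum_nonneg)
    next
      case 2
      define P where "P = (\<lambda>i x. 4 * a < avg i ?u x \<or> 4 * b < avg i ?v x)"
      define \<tau> where "\<tau> = first_stop m N P"
      have Pcong: "P i y = P i x" if "x \<in> X" "y \<in> cube i x" for i x y
        unfolding P_def using avg_cong[OF that] by metis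
      have st: "stopping ?Z \<tau>" unfolding \<tau>_def by (rule first_stop_stopping[OF x0 mN Pcong])
      note fs = first_stop[OF mN, where P = P, folded \<tau>_def]
      have am: "avg m ?u x = a" "avg m ?v x = b" if "x \<in> ?Z" for x
        unfolding a_def b_def using avg_cong[OF x0 that] by metis+
      have m': "m < \<tau> x" if x: "x \<in> ?Z" for x
      proof -
        have "\<not> P m x" unfolding P_def am[OF x] using 2 by simp
        then have "\<tau> x \<noteq> m" using fs(4)[of x] 2(1) by auto
        then show ?thesis using fs(1)[of x] by simp
      qed
      have m'': "m \<le> \<tau> x" if x: "x \<in> ?Z" for x using m'[OF x] by simp
      have tree: "norm (\<Sum>x\<in>?Z. g x * shift_op h k m (\<tau> x) f x) \<le> K / 2 * (a * b * ?C)"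
        unfolding K_def
      proof (rule tree_form_le[OF x0 2(1) st m' fs(2) ab0(1) _ a_sum ab0(2) _ b_sum])
        fix x i assume "m \<le> i" "i < \<tau> x"
        then have "\<not> P i x" using fs(3) by blast
        then show "avg i ?u x \<le> 4 * a" "avg i ?v x \<le> 4 * b" unfolding P_def by auto
      qed
      \<comment> \<open>the indicator of the union of the stopping cubes with a large mean\<close>
      define S where "S = (\<lambda>x. if P (\<tau> x) x then 1 else 0 :: real)"
      have S0: "0 \<le> S x" "S x \<le> 1" for x unfolding S_def by auto
      have "(\<Sum>x\<in>?Z. 4 * (a * b * S x)) \<le> (\<Sum>x\<in>?Z. b * stop_avg \<tau> ?u x + a * stop_avg \<tau> ?v x)"
      proof (rule sum_mono)
        fix x
        have n: "0 \<le> stop_avg \<tau> ?u x" "0 \<le> stop_avg \<tau> ?v x" unfolding stop_avg_def by (auto intro: avg_nonneg)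
        show "4 * (a * b * S x) \<le> b * stop_avg \<tau> ?u x + a * stop_avg \<tau> ?v x"
        proof (cases "P (\<tau> x) x")
          case True
          then consider "4 * a \<le> stop_avg \<tau> ?u x" | "4 * b \<le> stop_avg \<tau> ?v x"
            unfolding P_def stop_avg_def by linarith
          then show ?thesis
          proof cases
            case 1
            from mult_left_mono[OF 1 ab0(2)] mult_nonneg_nonneg[OF ab0(1) n(2)] True
            show ?thesis by (simp add: S_def mult_ac)
          next
            case 2
            from mult_left_mono[OF 2 ab0(1)] mult_nonneg_nonneg[OF ab0(2) n(1)] True
            show ?thesis by (simp add: S_def mult_ac)
          qed
        next
          case False then show ?thesis using n ab0 by (simp add: S_def)
        qed
      qed
      \<comment> \<open>Each of the two kinds of stopping cubes covers at most a quarter of the cube.\<close>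
      also have "\<dots> = 2 * (a * b * ?C)"
        by (simp add: sum.distrib sum_distrib_left[symmetric] sum_stop_avg[OF x0 st m''] a_sum b_sum)
      finally have "2 * (a * b * (\<Sum>x\<in>?Z. S x)) \<le> a * b * ?C" by (simp add: sum_distrib_left[symmetric])
      then have "a * b * ?C \<le> 2 * (a * b * (\<Sum>x\<in>?Z. 1 - S x))"
        by (simp add: sum_subtractf algebra_simps)
      then have "K / 2 * (a * b * ?C) \<le> K / 2 * (2 * (a * b * (\<Sum>x\<in>?Z. 1 - S x)))"
        using K0 by (intro mult_left_mono) auto
      also have "\<dots> = (\<Sum>x\<in>?Z. K * (1 - S x) * (a * b))"
        unfolding sum_distrib_left by (intro sum.cong refl) (simp add: field_simps)
      also have "\<dots> \<le> (\<Sum>x\<in>?Z. K * (1 - S x) * MM m x)"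
      proof (intro sum_mono mult_left_mono)
        fix x assume x: "x \<in> ?Z"
        show "a * b \<le> MM m x" unfolding MM_def
          using avg_le_maxfn[of m m N ?u x] avg_le_maxfn[of m m N ?v x] mN ab0 am[OF x] by (intro mult_mono) auto
        show "0 \<le> K * (1 - S x)" using K0 S0 by simp
      qed
      finally have tree': "norm (\<Sum>x\<in>?Z. g x * shift_op h k m (\<tau> x) f x) \<le> (\<Sum>x\<in>?Z. K * (1 - S x) * MM m x)"
        using tree by linarith
      have rest: "norm (\<Sum>x\<in>?Z. g x * shift_op h k (\<tau> x) N f x) \<le> (\<Sum>x\<in>?Z. K * S x * MM m x)"
      proof (rule norm_sum_le_blocks[OF stop_block_map[OF x0 st m'']])
        fix x assume x: "x \<in> ?Z"
        have X: "x \<in> X" using inX[OF x] .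
        have \<tau>y: "\<tau> y = \<tau> x" "S y = S x" if "y \<in> cube (\<tau> x) x" for y
        proof -
          show "\<tau> y = \<tau> x" using st x that unfolding stopping_def by blast
          then show "S y = S x" unfolding S_def using Pcong[OF X that] by simp
        qed
        have "norm (\<Sum>y\<in>stop_cube \<tau> x. g y * shift_op h k (\<tau> y) N f y)
            = norm (\<Sum>y\<in>cube (\<tau> x) x. g y * shift_op h k (\<tau> x) N f y)"
          unfolding stop_cube_def using \<tau>y by (intro arg_cong[where f = norm] sum.cong) auto
        also have "\<dots> \<le> (\<Sum>y\<in>cube (\<tau> x) x. K * S x * MM m y)"
        proof (cases "P (\<tau> x) x")
          case True
          have "norm (\<Sum>y\<in>cube (\<tau> x) x. g y * shift_op h k (\<tau> x) N f y)
             \<le> K * (\<Sum>y\<in>cube (\<tau> x) x. MM (\<tau> x) y)"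
            unfolding K_def MM_def by (rule less.hyps) (use m'[OF x] fs(2) 2 X in auto)
          also have "\<dots> \<le> K * (\<Sum>y\<in>cube (\<tau> x) x. MM m y)"
            unfolding MM_def using K0 fs(2)[of x] m''[OF x]
            by (intro mult_left_mono sum_mono mult_mono maxfn_antimono maxfn_nonneg) auto
          finally show ?thesis using True by (simp add: S_def sum_distrib_left)
        next
          case False
          then have "\<tau> x = N" using fs(2)[of x] fs(4)[of x] by linarith
          then show ?thesis using K0 MM0[OF mN] S0 by (simp add: shift_op_def sum_nonneg)
        qed
        also have "\<dots> = (\<Sum>y\<in>stop_cube \<tau> x. K * S y * MM m y)"
          unfolding stop_cube_def using \<tau>y by (intro sum.cong) auto
        finally show "norm (\<Sum>y\<in>stop_cube \<tau> x. g y * shift_op h k (\<tau> y) N f y) \<le> \<dots>" .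
      qed
      have "(\<Sum>x\<in>?Z. g x * shift_op h k m N f x)
         = (\<Sum>x\<in>?Z. g x * shift_op h k m (\<tau> x) f x + g x * shift_op h k (\<tau> x) N f x)"
      proof (rule sum.cong[OF refl])
        fix x assume x: "x \<in> ?Z"
        show "g x * shift_op h k m N f x = g x * shift_op h k m (\<tau> x) f x + g x * shift_op h k (\<tau> x) N f x"
          unfolding shift_op_split[OF m''[OF x] fs(2)] by (simp add: algebra_simps)
      qed
      then have "norm (\<Sum>x\<in>?Z. g x * shift_op h k m N f x)
         \<le> (\<Sum>x\<in>?Z. K * (1 - S x) * MM m x) + (\<Sum>x\<in>?Z. K * S x * MM m x)"
        using tree' rest norm_triangle_mono by (simp add: sum.distrib)
      also have "\<dots> = K * (\<Sum>x\<in>?Z. MM m x)"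
        by (simp add: sum.distrib[symmetric] sum_distrib_left algebra_simps)
      finally show ?thesis .
    qed
  qed
  then show ?case unfolding K_def MM_def .
qed

end

section \<open>The scalar bound on \<open>L\<^sup>r\<close>\<close>

context haar_model begin

definition strong_const :: "real \<Rightarrow> real" where
  "strong_const r = 8 * r * (r / (r - 1)) * sparse_const"

text \<open>
  Test the form with \<open>g = \<bar>Tf\<bar>\<^sup>r / Tf\<close>, for which \<open>\<bar>g\<bar>\<^sup>q = \<bar>Tf\<bar>\<^sup>r\<close> with the conjugate exponent \<open>q\<close>.
  Domination, Young's inequality and the maximal inequality on \<open>L\<^sup>r\<close> and \<open>L\<^sup>q\<close> bound \<open>\<Sum> \<bar>Tf\<bar>\<^sup>r\<close> by
  a multiple of \<open>\<Sum> \<bar>f\<bar>\<^sup>r\<close> plus a multiple of itself.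
\<close>

theorem strong_type:
  assumes r: "1 < r" and x0: "x0 \<in> X" and m: "m \<le> N"
  shows "(\<Sum>x\<in>cube m x0. norm (shift_op h k m N f x) powr r)
    \<le> strong_const r powr r * (\<Sum>x\<in>cube m x0. norm (f x) powr r)"
proof -
  let ?Z = "cube m x0"
  define q where "q = r / (r - 1)"
  define K where "K = sparse_const"
  have K: "0 < K" unfolding K_def by (rule sparse_const_pos[OF x0])
  have q: "1 < q" "1 / r + 1 / q = 1" using r by (auto simp: q_def field_simps)
  have qr: "(r - 1) * q = r" "q / (q - 1) = r" "r / q = r - 1" using r by (auto simp: q_def field_simps)
  define T where "T = shift_op h k m N f"
  define g where "g = (\<lambda>x. if T x = 0 then 0 else of_real (norm (T x) powr r) / T x)"
  define S where "S = (\<Sum>x\<in>?Z. norm (T x) powr r)"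
  define F where "F = (\<Sum>x\<in>?Z. norm (f x) powr r)"
  define Mf Mg where "Mf = maxfn m N (\<lambda>y. norm (f y))" and "Mg = maxfn m N (\<lambda>y. norm (g y))"
  have S0: "0 \<le> S" and F0: "0 \<le> F" unfolding S_def F_def by (auto intro: sum_nonneg)
  have gT: "g x * T x = of_real (norm (T x) powr r)" for x by (simp add: g_def)
  have ng: "norm (g x) = norm (T x) powr (r - 1)" for x
    using r by (simp add: g_def norm_divide powr_diff)
  have ngq: "norm (g x) powr q = norm (T x) powr r" for x unfolding ng powr_powr qr(1) ..
  have M0: "0 \<le> Mf x" "0 \<le> Mg x" for x unfolding Mf_def Mg_def using m by (auto intro!: maxfn_nonneg)
  define Cr Cq where "Cr = (2 * q) powr r" and "Cq = (2 * r) powr q"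
  have C: "0 < Cr" "0 < Cq" using r q by (auto simp: Cr_def Cq_def)
  have maxf: "(\<Sum>x\<in>?Z. Mf x powr r) \<le> Cr * F"
    using maxfn_strong_type[OF x0 r _ m, of "\<lambda>y. norm (f y)"] unfolding Mf_def Cr_def F_def q_def by simp
  have maxg: "(\<Sum>x\<in>?Z. Mg x powr q) \<le> Cq * S"
    using maxfn_strong_type[OF x0 q(1) _ m, of "\<lambda>y. norm (g y)"] unfolding Mg_def Cq_def S_def qr(2) ngq by simp
  \<comment> \<open>this weight makes the term that contains \<open>S\<close> equal to \<open>S / 2\<close>, which is absorbed\<close>
  define s where "s = (2 * K * Cq) powr (1 / q)"
  have s: "0 < s" using K C by (simp add: s_def)
  have sq: "s powr q = 2 * K * Cq" using q K C by (simp add: s_def powr_powr)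
  have sr: "s powr r = (2 * K) powr (r - 1) * (2 * r) powr r"
  proof -
    have "s powr r = (2 * K * Cq) powr (r - 1)" unfolding s_def powr_powr using qr(3) by simp
    also have "\<dots> = (2 * K) powr (r - 1) * Cq powr (r - 1)" using K C by (simp add: powr_mult)
    also have "Cq powr (r - 1) = (2 * r) powr r" unfolding Cq_def powr_powr using qr(1) by (simp add: mult.commute)
    finally show ?thesis .
  qed
  have young: "Mf x * Mg x \<le> s powr r * Mf x powr r + Mg x powr q / (2 * K * Cq)" for x
  proof -
    have "Mf x * Mg x = (s * Mf x) * (Mg x / s)" using s by simp
    also have "\<dots> \<le> (s * Mf x) powr r / r + (Mg x / s) powr q / q"
      by (rule Youngs_inequality) (use r q s M0 in auto)
    also have "\<dots> \<le> (s * Mf x) powr r / 1 + (Mg x / s) powr q / 1"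
      using r q by (intro add_mono divide_left_mono) auto
    also have "\<dots> = s powr r * Mf x powr r + Mg x powr q / (2 * K * Cq)"
      using s M0 by (simp add: powr_mult powr_divide sq)
    finally show ?thesis .
  qed
  have "S = norm (of_real S :: 'b)" using S0 by simp
  also have "(of_real S :: 'b) = (\<Sum>x\<in>?Z. g x * T x)" by (simp add: S_def gT)
  also have "norm \<dots> \<le> K * (\<Sum>x\<in>?Z. Mf x * Mg x)"
    unfolding T_def K_def Mf_def Mg_def by (rule sparse_domination[OF x0 m])
  also have "\<dots> \<le> K * (\<Sum>x\<in>?Z. s powr r * Mf x powr r + Mg x powr q / (2 * K * Cq))"
    using K by (intro mult_left_mono sum_mono young) auto
  also have "\<dots> = K * s powr r * (\<Sum>x\<in>?Z. Mf x powr r) + (\<Sum>x\<in>?Z. Mg x powr q) / (2 * Cq)"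
    using K by (simp add: sum.distrib sum_distrib_left[symmetric] sum_divide_distrib[symmetric] distrib_left)
  also have "\<dots> \<le> K * s powr r * (Cr * F) + (Cq * S) / (2 * Cq)"
    using K C maxf maxg by (intro add_mono mult_left_mono divide_right_mono) auto
  also have "\<dots> = K * s powr r * (Cr * F) + S / 2" using C by simp
  finally have "S \<le> 2 * K * s powr r * (Cr * F)" by simp
  also have "\<dots> = ((2 * K) * (2 * K) powr (r - 1)) * (2 * r) powr r * (2 * q) powr r * F"
    unfolding sr Cr_def by (simp add: mult_ac)
  also have "(2 * K) * (2 * K) powr (r - 1) = (2 * K) powr r" using K by (simp add: powr_mult_base)
  also have "(2 * K) powr r * (2 * r) powr r * (2 * q) powr r = ((2 * K) * (2 * r) * (2 * q)) powr r"
    using K r q by (simp only: powr_mult[symmetric])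
  also have "(2 * K) * (2 * r) * (2 * q) = strong_const r" by (simp add: strong_const_def K_def q_def)
  finally show ?thesis unfolding S_def F_def T_def .
qed

end

section \<open>Finite \<open>\<ell>\<^sup>r\<close> norms\<close>

definition lr_upto :: "real \<Rightarrow> nat \<Rightarrow> (nat \<Rightarrow> 'a::real_normed_vector) \<Rightarrow> real" where
  "lr_upto r J a = (\<Sum>j<J. norm (a j) powr r) powr (1 / r)"

lemma lr_nonneg [simp]: "0 \<le> lr_upto r J a" by (simp add: lr_upto_def)

lemma lr_powr: "0 < r \<Longrightarrow> lr_upto r J a powr r = (\<Sum>j<J. norm (a j) powr r)"
  by (simp add: lr_upto_def powr_powr sum_nonneg)

lemma lr_of_norms [simp]: "lr_upto r J (\<lambda>j. norm (a j)) = lr_upto r J a" by (simp add: lr_upto_def)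

lemma lr_mult:
  fixes a :: "nat \<Rightarrow> real"
  assumes "0 < r" "0 \<le> c" shows "lr_upto r J (\<lambda>j. c * a j) = c * lr_upto r J a"
proof -
  have "(\<Sum>j<J. norm (c * a j) powr r) = c powr r * (\<Sum>j<J. norm (a j) powr r)"
    using assms by (simp add: abs_mult powr_mult sum_distrib_left)
  then show ?thesis using assms by (simp add: lr_upto_def powr_mult sum_nonneg powr_powr)
qed

lemma lr_zero: "0 < r \<Longrightarrow> lr_upto r J (\<lambda>j. 0) = 0"
  by (simp add: lr_upto_def)

lemma norm_le_lr: 
  assumes "0 < r" "j < J" shows "norm (a j) \<le> lr_upto r J a"
proof -
  have "norm (a j) powr r \<le> (\<Sum>j<J. norm (a j) powr r)"
    using assms(2) member_le_sum[of j "{..<J}" "\<lambda>j. norm (a j) powr r"] by simp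
  then have "(norm (a j) powr r) powr (1 / r) \<le> lr_upto r J a"
    unfolding lr_upto_def using assms by (intro powr_mono2) auto
  then show ?thesis using assms by (simp add: powr_powr)
qed

text \<open>
  The dual description of the norm.  It makes Minkowski's inequality, for sums as well as for
  integrals, a consequence of linearity.
\<close>

lemma lr_norming_functional:
  fixes a :: "nat \<Rightarrow> 'a::real_normed_vector"
  assumes r: "1 < r"
  obtains w :: "nat \<Rightarrow> real" where "\<And>j. 0 \<le> w j" "(\<Sum>j<J. w j * norm (a j)) = lr_upto r J a"
    "\<And>b :: nat \<Rightarrow> real. (\<Sum>j<J. w j * \<bar>b j\<bar>) \<le> lr_upto r J b"
proof (cases "lr_upto r J a = 0")
  case True
  then show ?thesis by (intro that[of "\<lambda>_. 0"]) auto
next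
  case False
  define A where "A = lr_upto r J a"
  have A: "0 < A" using False by (simp add: A_def order_less_le)
  define q where "q = r / (r - 1)"
  have q: "1 < q" "1 / r + 1 / q = 1" "(r - 1) * q = r" using r by (auto simp: q_def field_simps)
  define w where "w = (\<lambda>j. (norm (a j) / A) powr (r - 1))"
  have wq: "(\<Sum>j<J. w j powr q) = 1"
  proof -
    have "(\<Sum>j<J. w j powr q) = (\<Sum>j<J. norm (a j) powr r) / A powr r"
      using A by (simp add: w_def powr_powr q powr_divide sum_divide_distrib)
    also have "\<dots> = 1" using lr_powr[of r J a, symmetric] r A by (simp add: A_def)
    finally show ?thesis .
  qed
  show ?thesis
  proof (rule that[of w])
    show "0 \<le> w j" for j by (simp add: w_def)
    have "w j * norm (a j) = norm (a j) powr r * A powr (1 - r)" for j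
    proof -
      have "w j * norm (a j) = (norm (a j) * norm (a j) powr (r - 1)) / A powr (r - 1)"
        using A by (simp add: w_def powr_divide)
      also have "\<dots> = norm (a j) powr r / A powr (r - 1)" by (simp add: powr_mult_base)
      also have "\<dots> = norm (a j) powr r * A powr (1 - r)" using powr_minus_divide[of A "r - 1"] by simp
      finally show ?thesis .
    qed
    then have "(\<Sum>j<J. w j * norm (a j)) = A powr r * A powr (1 - r)"
      using lr_powr[of r J a] r by (simp add: A_def sum_distrib_right)
    also have "\<dots> = A" using A by (simp add: powr_add[symmetric])
    finally show "(\<Sum>j<J. w j * norm (a j)) = lr_upto r J a" by (simp add: A_def)
    fix b :: "nat \<Rightarrow> real"
    show "(\<Sum>j<J. w j * \<bar>b j\<bar>) \<le> lr_upto r J b"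
    proof (cases "lr_upto r J b = 0")
      case True
      then have "b j = 0" if "j < J" for j using norm_le_lr[of r j J b] r that by simp
      then have "(\<Sum>j<J. w j * \<bar>b j\<bar>) = 0" by (intro sum.neutral) auto
      then show ?thesis using True by simp
    next
      case False
      define B where "B = lr_upto r J b"
      have B: "0 < B" using False by (simp add: B_def order_less_le)
      have "(\<Sum>j<J. (\<bar>b j\<bar> / B) * w j) \<le> (\<Sum>j<J. (\<bar>b j\<bar> / B) powr r / r + w j powr q / q)"
        by (intro sum_mono Youngs_inequality) (use r q B in \<open>auto simp: w_def\<close>)
      also have "\<dots> = (\<Sum>j<J. norm (b j) powr r) / B powr r / r + 1 / q"
        using B by (simp add: sum.distrib sum_divide_distrib[symmetric] wq powr_divide)
      also have "\<dots> = 1" using lr_powr[of r J b, symmetric] r B q(2) by (simp add: B_def)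
      finally have "(\<Sum>j<J. w j * \<bar>b j\<bar>) / B \<le> 1"
        by (simp add: sum_divide_distrib mult.commute)
      then show ?thesis using B by (simp add: B_def divide_le_eq)
    qed
  qed
qed

lemma lr_le_sum:
  fixes a :: "nat \<Rightarrow> 'a::real_normed_vector" and b :: "'i \<Rightarrow> nat \<Rightarrow> real"
  assumes r: "1 < r" and le: "\<And>j. j < J \<Longrightarrow> norm (a j) \<le> (\<Sum>i\<in>I. b i j)"
  shows "lr_upto r J a \<le> (\<Sum>i\<in>I. lr_upto r J (b i))"
proof -
  obtain w where w: "\<And>j. 0 \<le> w j" "(\<Sum>j<J. w j * norm (a j)) = lr_upto r J a"
    "\<And>b :: nat \<Rightarrow> real. (\<Sum>j<J. w j * \<bar>b j\<bar>) \<le> lr_upto r J b"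
    using lr_norming_functional[OF r, where J = J and a = a] by blast
  have "lr_upto r J a \<le> (\<Sum>j<J. w j * (\<Sum>i\<in>I. \<bar>b i j\<bar>))"
    unfolding w(2)[symmetric]
    by (intro sum_mono mult_left_mono order_trans[OF le] w) auto
  also have "\<dots> = (\<Sum>i\<in>I. \<Sum>j<J. w j * \<bar>b i j\<bar>)"
    by (simp add: sum_distrib_left) (rule sum.swap)
  also have "\<dots> \<le> (\<Sum>i\<in>I. lr_upto r J (b i))" by (intro sum_mono w)
  finally show ?thesis .
qed

lemma lr_le_add:
  fixes a :: "nat \<Rightarrow> 'a::real_normed_vector" and b :: "nat \<Rightarrow> 'b::real_normed_vector"
    and c :: "nat \<Rightarrow> 'c::real_normed_vector"
  assumes r: "1 < r" and le: "\<And>j. j < J \<Longrightarrow> norm (a j) \<le> norm (b j) + norm (c j)"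
  shows "lr_upto r J a \<le> lr_upto r J b + lr_upto r J c"
  using lr_le_sum[OF r, where J = J and a = a and I = "UNIV :: bool set" and b = "\<lambda>i j. if i then norm (b j) else norm (c j)"] le
  by (simp add: UNIV_bool add.commute)

section \<open>The vector-valued weak type bound on a finite tree\<close>

definition weak_const :: "real \<Rightarrow> real \<Rightarrow> real \<Rightarrow> real" where
  "weak_const r d c = (1 + 2 powr r * d powr (r - 1)) * (8 * r * (r / (r - 1)) * ((64 * c + 32) * d\<^sup>2)) + 4"

text \<open>
  The decomposition is made at height \<open>t = \<alpha> / A\<close>, where \<open>A\<close> is the \<open>L\<^sup>r\<close> bound.  With this choice the
  exceptional set, of measure at most \<open>U / t\<close>, and the good part, for which Chebyshev gives a multiple of
  \<open>\<alpha>\<^sup>-\<^sup>r A\<^sup>r t\<^bsup>r-1\<^esup> U\<close>, both contribute a multiple of \<open>A U / \<alpha>\<close>.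
\<close>

theorem vector_weak_type:
  fixes h k :: "nat \<Rightarrow> nat \<Rightarrow> 'a \<Rightarrow> 'b::real_normed_field" and f :: "nat \<Rightarrow> 'a \<Rightarrow> 'b"
  assumes r: "1 < r" and model: "\<And>j. haar_model X cube D (h j) (k j) N \<kappa> c"
    and x0: "x0 \<in> X" and \<alpha>: "0 < \<alpha>"
  shows "\<alpha> * real (card {x\<in>cube 0 x0. \<alpha> < lr_upto r J (\<lambda>j. cube_tree.shift_op cube (h j) (k j) 0 N (f j) x)})
     \<le> weak_const r D c * real \<kappa> * (\<Sum>x\<in>cube 0 x0. lr_upto r J (\<lambda>j. f j x))"
proof -
  interpret haar_model X cube D "h j" "k j" N \<kappa> c for j by (rule model)
  let ?Z = "cube 0 x0"
  define A where "A = 8 * r * (r / (r - 1)) * ((64 * c + 32) * D\<^sup>2 * real \<kappa>)"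
  have D1: "1 \<le> D" using D_pos[OF x0] .
  have k1: "1 \<le> real \<kappa>" using \<kappa>_pos by simp
  have A0: "0 < A" unfolding A_def using r c_nonneg D1 k1 by (auto intro!: mult_pos_pos divide_pos_pos add_nonneg_pos)
  define u where "u = (\<lambda>x. lr_upto r J (\<lambda>j. f j x))"
  have u0: "0 \<le> u x" for x by (simp add: u_def)
  define T where "T = (\<lambda>j. shift_op (h j) (k j) 0 N)"
  define E where "E = {x\<in>?Z. \<alpha> < lr_upto r J (\<lambda>j. T j (f j) x)}"
  define U where "U = (\<Sum>x\<in>?Z. u x)"
  have U0: "0 \<le> U" by (simp add: U_def u0 sum_nonneg)
  have fin: "finite ?Z" using finite_cube[OF x0] .
  have inX: "x \<in> X" if "x \<in> ?Z" for x using that x0 cube_in_X by blast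
  define t where "t = \<alpha> / A"
  have t: "0 < t" using \<alpha> A0 by (simp add: t_def)
  have E_sub: "E \<subseteq> ?Z" by (auto simp: E_def)
  have W: "A + 2 powr r * A * D powr (r - 1) + 4 * real \<kappa> = weak_const r D c * real \<kappa>"
    unfolding A_def weak_const_def by (simp only: distrib_right distrib_left mult_1 mult_ac)
  have "\<alpha> * real (card E) \<le> (A + 2 powr r * A * D powr (r - 1) + 4 * real \<kappa>) * U"
  proof -
    consider "N = 0" | "t < avg 0 u x0" | "0 < N" "avg 0 u x0 \<le> t" by linarith
    then show ?thesis
    proof cases
      case 1
      then have "E = {}" using \<alpha> r by (simp add: E_def T_def shift_op_def lr_zero)
      then show ?thesis using A0 k1 U0 by simp
    next
      case 2
      have "\<alpha> * real (card E) \<le> \<alpha> * real (card ?Z)"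
        using \<alpha> card_mono[OF fin E_sub] by simp
      also have "\<dots> = A * (real (card ?Z) * t)" using A0 by (simp add: t_def)
      also have "\<dots> \<le> A * (real (card ?Z) * avg 0 u x0)" using A0 2 by (intro mult_left_mono) auto
      also have "\<dots> = A * U" using sum_eq_avg[OF x0, of u 0] by (simp add: U_def)
      also have "\<dots> \<le> (A + 2 powr r * A * D powr (r - 1) + 4 * real \<kappa>) * U"
        using A0 k1 U0 by (intro mult_right_mono) auto
      finally show ?thesis .
    next
      case 3
      define P where "P = (\<lambda>i x. t < avg i u x)"
      define \<tau> where "\<tau> = first_stop 0 N P"
      have Pcong: "P i y = P i x" if "x \<in> X" "y \<in> cube i x" for i x y
        unfolding P_def using avg_cong[OF that] by metis
      have st: "stopping ?Z \<tau>" unfolding \<tau>_def by (rule first_stop_stopping[OF x0 le0 Pcong])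
      note fs = first_stop[OF le0[of N], where P = P, folded \<tau>_def]
      have pos: "0 < \<tau> x" if x: "x \<in> ?Z" for x
      proof -
        have "avg 0 u x = avg 0 u x0" using avg_cong[OF x0 x] .
        then have "\<not> P 0 x" unfolding P_def using 3 by simp
        then have "\<tau> x \<noteq> 0" using fs(4)[of x] 3(1) by metis
        then show ?thesis by simp
      qed
      define f' f'' where "f' = (\<lambda>j. stop_avg \<tau> (f j))" and "f'' = (\<lambda>j x. f j x - stop_avg \<tau> (f j) x)"
      have f'_u: "lr_upto r J (\<lambda>j. f' j x) \<le> stop_avg \<tau> u x" for x
      proof -
        let ?n = "real (card (cube (\<tau> x) x))"
        have "lr_upto r J (\<lambda>j. f' j x) \<le> (\<Sum>y\<in>cube (\<tau> x) x. lr_upto r J (\<lambda>j. inverse ?n * norm (f j y)))"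
        proof (rule lr_le_sum[OF r])
          fix j
          show "norm (f' j x) \<le> (\<Sum>y\<in>cube (\<tau> x) x. inverse ?n * norm (f j y))"
            using norm_avg_le[of "\<tau> x" "f j" x] by (simp add: f'_def stop_avg_def avg_def[where 'b = real] sum_distrib_left)
        qed
        also have "\<dots> = stop_avg \<tau> u x"
          using r by (simp add: lr_mult stop_avg_def avg_def u_def sum_distrib_left)
        finally show ?thesis .
      qed
      have f'_t: "stop_avg \<tau> u x \<le> D * t" if x: "x \<in> ?Z" for x
      proof (rule stop_avg_le[where m = 0])
        fix i assume "i < \<tau> x"
        then show "avg i u x \<le> t" using fs(3)[of i x] by (simp add: P_def)
      qed (use inX[OF x] u0 pos[OF x] in auto)
      define v where "v = (\<lambda>x. lr_upto r J (\<lambda>j. f'' j x))"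
      have v: "(\<Sum>x\<in>?Z. v x) \<le> 2 * U"
      proof -
        have "v x \<le> u x + lr_upto r J (\<lambda>j. f' j x)" for x
          unfolding v_def u_def by (rule lr_le_add[OF r]) (simp add: f''_def f'_def norm_triangle_ineq4)
        then have "v x \<le> u x + stop_avg \<tau> u x" for x using f'_u by (meson add_left_mono order_trans)
        then have "(\<Sum>x\<in>?Z. v x) \<le> (\<Sum>x\<in>?Z. u x + stop_avg \<tau> u x)" by (intro sum_mono)
        also have "\<dots> = 2 * U" by (simp add: sum.distrib sum_stop_avg[OF x0 st fs(1)] U_def)
        finally show ?thesis .
      qed
      \<comment> \<open>a pointwise majorant for the image of the bad part, off the exceptional set\<close>
      define G where "G = (\<lambda>x. \<Sum>i\<in>{0..<\<tau> x}. \<Sum>y\<in>cube i x. (if \<tau> y < i + \<kappa> then v y else 0) / real (card (cube i x)))"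
      have G0: "0 \<le> G x" for x unfolding G_def by (intro sum_nonneg) (auto simp: v_def)
      have G_sum: "(\<Sum>x\<in>?Z. G x) \<le> real \<kappa> * (2 * U)"
      proof -
        have "(\<Sum>x\<in>?Z. 1 * G x) \<le> real \<kappa> * 1 * (\<Sum>y\<in>?Z. v y)"
          unfolding G_def
        proof (rule tree_kernel_sum_le[OF x0 st fs(2)])
          show "0 \<le> v x" for x by (simp add: v_def)
          show "avg i (\<lambda>_. 1) y \<le> (1::real)" if "y \<in> ?Z" for y i using avg_const[OF inX[OF that], of i 1] by simp
        qed auto
        also have "\<dots> \<le> real \<kappa> * (2 * U)" using v by (simp add: mult_left_mono)
        finally show ?thesis by simp
      qed
      have bad: "lr_upto r J (\<lambda>j. T j (f'' j) x) \<le> G x" if x: "x \<in> ?Z" and N: "\<tau> x = N" for x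
      proof -
        have "lr_upto r J (\<lambda>j. T j (f'' j) x) \<le> (\<Sum>i\<in>{0..<\<tau> x}. lr_upto r J (\<lambda>j.
            \<Sum>y\<in>cube i x. (if \<tau> y < i + \<kappa> then norm (f'' j y) else 0) / real (card (cube i x))))"
        proof (rule lr_le_sum[OF r])
          fix j
          have "norm (shift_op (h j) (k j) 0 (\<tau> x) (f'' j) x)
            \<le> (\<Sum>i = 0..<\<tau> x. \<Sum>y\<in>cube i x. (if \<tau> y < i + \<kappa> then norm (f'' j y) else 0) / real (card (cube i x)))"
          proof (rule cancelled_shift_op_le[OF x0 st fs(1) fs(2) _ x])
            show "(\<Sum>y\<in>stop_cube \<tau> z. f'' j y) = 0" if "z \<in> ?Z" for z
              unfolding f''_def by (rule stop_avg_cancel[OF x0 st that])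
          qed
          then show "norm (T j (f'' j) x) \<le> (\<Sum>i = 0..<\<tau> x. \<Sum>y\<in>cube i x. (if \<tau> y < i + \<kappa> then norm (f'' j y) else 0) / real (card (cube i x)))"
            by (simp add: T_def N)
        qed
        also have "\<dots> \<le> G x"
          unfolding G_def
        proof (rule sum_mono)
          fix i
          let ?n = "real (card (cube i x))"
          have "lr_upto r J (\<lambda>j. \<Sum>y\<in>cube i x. (if \<tau> y < i + \<kappa> then norm (f'' j y) else 0) / ?n)
             \<le> (\<Sum>y\<in>cube i x. lr_upto r J (\<lambda>j. inverse ?n * (if \<tau> y < i + \<kappa> then norm (f'' j y) else 0)))"
            by (rule lr_le_sum[OF r]) (simp add: sum_nonneg divide_inverse mult.commute)
          also have "\<dots> = (\<Sum>y\<in>cube i x. (if \<tau> y < i + \<kappa> then v y else 0) / ?n)"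
            using r by (intro sum.cong refl) (simp add: lr_mult lr_zero v_def divide_inverse mult.commute)
          finally show "lr_upto r J (\<lambda>j. \<Sum>y\<in>cube i x. (if \<tau> y < i + \<kappa> then norm (f'' j y) else 0) / ?n) \<le> \<dots>" .
        qed
        finally show ?thesis .
      qed
      define H where "H = (\<lambda>x. lr_upto r J (\<lambda>j. T j (f' j) x))"
      have H_sum: "(\<Sum>x\<in>?Z. H x powr r) \<le> A powr r * ((D * t) powr (r - 1) * U)"
      proof -
        have "(\<Sum>x\<in>?Z. H x powr r) = (\<Sum>x\<in>?Z. \<Sum>j<J. norm (T j (f' j) x) powr r)"
          using r by (simp add: H_def lr_powr)
        also have "\<dots> = (\<Sum>j<J. \<Sum>x\<in>?Z. norm (T j (f' j) x) powr r)" by (rule sum.swap)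
        also have "\<dots> \<le> (\<Sum>j<J. A powr r * (\<Sum>x\<in>?Z. norm (f' j x) powr r))"
          unfolding T_def A_def
          by (intro sum_mono) (rule strong_type[OF r x0 le0, unfolded strong_const_def sparse_const_def])
        also have "\<dots> = A powr r * (\<Sum>x\<in>?Z. \<Sum>j<J. norm (f' j x) powr r)"
          by (simp only: sum_distrib_left) (rule sum.swap)
        also have "(\<Sum>x\<in>?Z. \<Sum>j<J. norm (f' j x) powr r) = (\<Sum>x\<in>?Z. lr_upto r J (\<lambda>j. f' j x) powr r)"
          using r by (simp add: lr_powr)
        also have "\<dots> \<le> (\<Sum>x\<in>?Z. (D * t) powr (r - 1) * stop_avg \<tau> u x)"
        proof (rule sum_mono)
          fix x assume x: "x \<in> ?Z"
          have "lr_upto r J (\<lambda>j. f' j x) powr r \<le> stop_avg \<tau> u x powr r"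
            using r f'_u by (intro powr_mono2) auto
          also have "\<dots> = stop_avg \<tau> u x * stop_avg \<tau> u x powr (r - 1)"
            unfolding stop_avg_def using avg_nonneg[OF u0] by (simp add: powr_mult_base)
          also have "\<dots> \<le> stop_avg \<tau> u x * (D * t) powr (r - 1)"
            using f'_t[OF x] r avg_nonneg[OF u0] by (intro mult_left_mono powr_mono2) (auto simp: stop_avg_def)
          finally show "lr_upto r J (\<lambda>j. f' j x) powr r \<le> (D * t) powr (r - 1) * stop_avg \<tau> u x" by (simp add: mult.commute)
        qed
        also have "\<dots> = (D * t) powr (r - 1) * U"
          by (simp add: sum_distrib_left[symmetric] sum_stop_avg[OF x0 st fs(1)] U_def)
        finally show ?thesis by (simp add: mult_left_mono)
      qed
      define B where "B = \<alpha> * (2 / \<alpha>) powr r"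
      have B0: "0 < B" using \<alpha> by (simp add: B_def)
      have "\<alpha> * real (card E) = (\<Sum>x\<in>E. \<alpha>)" by simp
      also have "\<dots> \<le> (\<Sum>x\<in>E. A * stop_avg \<tau> u x + B * H x powr r + 2 * G x)"
      proof (rule sum_mono)
        fix x assume x: "x \<in> E"
        then have xZ: "x \<in> ?Z" and big: "\<alpha> < lr_upto r J (\<lambda>j. T j (f j) x)" by (auto simp: E_def)
        have nn: "0 \<le> A * stop_avg \<tau> u x" "0 \<le> B * H x powr r" "0 \<le> 2 * G x"
          using A0 B0 G0 avg_nonneg[OF u0] by (auto simp: stop_avg_def)
        show "\<alpha> \<le> A * stop_avg \<tau> u x + B * H x powr r + 2 * G x"
        proof (cases "P (\<tau> x) x")
          case True
          then have "t \<le> stop_avg \<tau> u x" by (simp add: P_def stop_avg_def)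
          then have "A * t \<le> A * stop_avg \<tau> u x" using A0 by simp
          moreover have "A * t = \<alpha>" using A0 by (simp add: t_def)
          ultimately show ?thesis using nn by linarith
        next
          case False
          then have N: "\<tau> x = N" using fs(2)[of x] fs(4)[of x] by linarith
          have "lr_upto r J (\<lambda>j. T j (f j) x) \<le> H x + lr_upto r J (\<lambda>j. T j (f'' j) x)"
            unfolding H_def
          proof (rule lr_le_add[OF r])
            fix j
            have "T j (f'' j) x = T j (f j) x - T j (f' j) x"
              unfolding T_def f''_def f'_def by (rule shift_op_diff)
            then show "norm (T j (f j) x) \<le> norm (T j (f' j) x) + norm (T j (f'' j) x)"
              by (simp add: norm_triangle_sub)
          qed
          then have "\<alpha> < H x + G x" using big bad[OF xZ N] by linarith
          then consider "\<alpha> / 2 \<le> H x" | "\<alpha> / 2 \<le> G x" by linarith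
          then show ?thesis
          proof cases
            case 1
            have "\<alpha> = B * (\<alpha> / 2) powr r"
              using \<alpha> by (simp add: B_def powr_divide)
            also have "\<dots> \<le> B * H x powr r" using 1 \<alpha> r B0 by (intro mult_left_mono powr_mono2) auto
            finally show ?thesis using nn by linarith
          next
            case 2 then show ?thesis using nn by linarith
          qed
        qed
      qed
      also have "\<dots> \<le> (\<Sum>x\<in>?Z. A * stop_avg \<tau> u x + B * H x powr r + 2 * G x)"
        using A0 B0 G0 avg_nonneg[OF u0]
        by (intro sum_mono2[OF fin E_sub]) (auto simp: stop_avg_def intro!: add_nonneg_nonneg)
      also have "\<dots> = A * U + B * (\<Sum>x\<in>?Z. H x powr r) + 2 * (\<Sum>x\<in>?Z. G x)"
        by (simp add: sum.distrib sum_distrib_left[symmetric] sum_stop_avg[OF x0 st fs(1)] U_def)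
      also have "\<dots> \<le> A * U + B * (A powr r * ((D * t) powr (r - 1) * U)) + 2 * (real \<kappa> * (2 * U))"
        using mult_left_mono[OF H_sum less_imp_le[OF B0]] G_sum by simp
      also have "B * (A powr r * ((D * t) powr (r - 1) * U)) = 2 powr r * A * D powr (r - 1) * U"
      proof -
        have 1: "\<alpha> powr r = \<alpha> * \<alpha> powr (r - 1)" "A powr r = A * A powr (r - 1)" using \<alpha> A0 by (simp_all add: powr_mult_base)
        have 2: "(D * t) powr (r - 1) = D powr (r - 1) * \<alpha> powr (r - 1) / A powr (r - 1)"
          unfolding t_def using \<alpha> A0 D1 by (simp add: powr_mult powr_divide)
        have 3: "B = \<alpha> * 2 powr r / \<alpha> powr r" using \<alpha> by (simp add: B_def powr_divide)
        show ?thesis unfolding 2 3 1 using \<alpha> A0 by (simp add: field_simps)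
      qed
      finally show ?thesis by (simp add: algebra_simps)
    qed
  qed
  then show ?thesis unfolding W E_def T_def U_def u_def .
qed

section \<open>Dyadic cubes and their corners\<close>

text \<open>
  The dyadic cube of generation \<open>i\<close> that contains \<open>x\<close>.
\<close>

definition dcube :: "int \<Rightarrow> real ^ 'n \<Rightarrow> (real ^ 'n) set" where
  "dcube i x = {y. \<forall>l. \<lfloor>2 powi i * y $ l\<rfloor> = \<lfloor>2 powi i * x $ l\<rfloor>}"

text \<open>
  The volume of the cubes of generation \<open>i\<close>; the first argument carries the dimension.
\<close>

definition vol :: "'n itself \<Rightarrow> int \<Rightarrow> real" where
  "vol _ i = (2 powi (- i)) ^ CARD('n)"

lemma powi_cancel [simp]: "(2::real) powi i * (2 powi (- i) * x) = x" "(2::real) powi (- i) * (2 powi i * x) = x"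
  by (simp_all add: power_int_minus)

lemma self_in_dcube [simp]: "x \<in> dcube i x" by (simp add: dcube_def)

lemma dcube_eq: "y \<in> dcube i x \<Longrightarrow> dcube i y = dcube i x"
  by (auto simp: dcube_def)

lemma dcube_sym: "y \<in> dcube i x \<longleftrightarrow> x \<in> dcube i y"
  by (auto simp: dcube_def)

lemma translated_cube_eq:
  fixes m :: "int ^ 'n"
  shows "(\<lambda>x. 2 powi (- i) *\<^sub>R (x + (\<chi> l. real_of_int (m $ l)))) ` {x. \<forall>l. 0 \<le> x $ l \<and> x $ l < 1}
    = {y. \<forall>l. \<lfloor>2 powi i * y $ l\<rfloor> = m $ l}" (is "?A = ?B")
proof (intro set_eqI iffI)
  fix y :: "real ^ 'n"
  assume "y \<in> ?A"
  then obtain x where x: "\<forall>l. 0 \<le> x $ l \<and> x $ l < 1" and y: "y = 2 powi (- i) *\<^sub>R (x + (\<chi> l. real_of_int (m $ l)))"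
    by blast
  have "2 powi i * y $ l = x $ l + real_of_int (m $ l)" for l by (simp add: y)
  then show "y \<in> ?B" using x by (auto simp: floor_eq_iff)
next
  fix y :: "real ^ 'n"
  assume y: "y \<in> ?B"
  define x where "x = (\<chi> l. 2 powi i * y $ l - real_of_int (m $ l))"
  have "\<forall>l. 0 \<le> x $ l \<and> x $ l < 1"
    using y by (auto simp: x_def floor_eq_iff less_diff_eq diff_less_eq add.commute)
  moreover have "y = 2 powi (- i) *\<^sub>R (x + (\<chi> l. real_of_int (m $ l)))" by (simp add: vec_eq_iff x_def)
  ultimately show "y \<in> ?A"
    by blast
qed

lemma dyadic_cubes_eq: "dyadic_cubes i = range (dcube i)"
proof -
  let ?C = "{{y :: real ^ 'n. \<forall>l. \<lfloor>2 powi i * y $ l\<rfloor> = m $ l} |m :: int ^ 'n. True}"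
  have "dyadic_cubes i = ?C"
    unfolding dyadic_cubes_def translated_cube_eq ..
  also have "\<dots> = range (dcube i)"
  proof (intro set_eqI iffI)
    fix I :: "(real ^ 'n) set"
    assume "I \<in> ?C"
    then obtain m :: "int ^ 'n" where I: "I = {y. \<forall>l. \<lfloor>2 powi i * y $ l\<rfloor> = m $ l}" by blast
    have "I = dcube i (\<chi> l. 2 powi (- i) * real_of_int (m $ l))" unfolding I dcube_def by simp
    then show "I \<in> range (dcube i)" by blast
  next
    fix I :: "(real ^ 'n) set"
    assume "I \<in> range (dcube i)"
    then obtain x where "I = dcube i x" by blast
    then have "I = {y. \<forall>l. \<lfloor>2 powi i * y $ l\<rfloor> = (\<chi> l. \<lfloor>2 powi i * x $ l\<rfloor>) $ l}" by (simp add: dcube_def)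
    then show "I \<in> ?C" by blast
  qed
  finally show ?thesis .
qed

lemma dcube_Suc: "dcube (i + 1) x \<subseteq> dcube i x"
proof -
  have "\<lfloor>2 powi i * t\<rfloor> = \<lfloor>2 powi (i + 1) * t\<rfloor> div 2" for t :: real
  proof -
    have "2 powi i * t = (2 powi (i + 1) * t) / real_of_int 2" by (simp add: power_int_add)
    then show ?thesis by (metis floor_divide_real_eq_div zero_le_numeral)
  qed
  then show ?thesis by (auto simp: dcube_def)
qed

lemma dcube_mono: "i \<le> j \<Longrightarrow> dcube j x \<subseteq> dcube i x"
proof (induction j rule: int_ge_induct)
  case (step j) then show ?case using dcube_Suc[of j x] by blast
qed auto

lemma dcube_subset: "i \<le> j \<Longrightarrow> y \<in> dcube i x \<Longrightarrow> dcube j y \<subseteq> dcube i x"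
  using dcube_mono[of i j y] dcube_eq[of y i x] by blast

lemma dcube_between:
  fixes x :: "real ^ 'n" and i :: int
  defines "a \<equiv> (\<chi> l. 2 powi (- i) * real_of_int \<lfloor>2 powi i * x $ l\<rfloor>)"
  defines "b \<equiv> (\<chi> l. 2 powi (- i) * (real_of_int \<lfloor>2 powi i * x $ l\<rfloor> + 1))"
  shows "dcube i x = {y. \<forall>l. a $ l \<le> y $ l \<and> y $ l < b $ l}"
proof -
  have "\<lfloor>2 powi i * y $ l\<rfloor> = \<lfloor>2 powi i * x $ l\<rfloor> \<longleftrightarrow> a $ l \<le> y $ l \<and> y $ l < b $ l" for y :: "real ^ 'n" and l
  proof -
    have p: "(2::real) powi (- i) * s = s / 2 powi i" for s by (simp add: power_int_minus field_simps)
    have "(0::real) < 2 powi i" by simp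
    then show ?thesis unfolding a_def b_def p by (simp add: floor_eq_iff field_simps)
  qed
  then show ?thesis by (auto simp: dcube_def)
qed

lemma dcube_borel [measurable]: "dcube i x \<in> sets borel"
  unfolding dcube_between by measurable

lemma dcube_sets [measurable, simp]: "dcube i x \<in> sets lebesgue"
  using dcube_borel[of i x] by (metis sets_completionI_sets sets_lborel)

lemma vol_pos [simp]: "0 < vol TYPE('n) i" by (simp add: vol_def)

lemma vol_Suc: "vol TYPE('n::finite) i = 2 ^ CARD('n) * vol TYPE('n) (i + 1)"
proof -
  have "(2::real) powi (- i) = 2 * 2 powi (- (i + 1))"
    using power_int_add[of "2::real" 1 "- (i + 1)"] by simp
  then show ?thesis unfolding vol_def by (metis power_mult_distrib)
qed

lemma emeasure_dcube: "emeasure lebesgue (dcube i (x :: real ^ 'n)) = ennreal (vol TYPE('n) i)"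
proof -
  define a b where "a = (\<chi> l. 2 powi (- i) * real_of_int \<lfloor>2 powi i * x $ l\<rfloor>)"
    and "b = (\<chi> l. 2 powi (- i) * (real_of_int \<lfloor>2 powi i * x $ l\<rfloor> + 1))"
  have eq: "dcube i x = {y. \<forall>l. a $ l \<le> y $ l \<and> y $ l < b $ l}" unfolding a_def b_def by (rule dcube_between)
  have ab: "a \<bullet> j \<le> b \<bullet> j" "b \<bullet> j - a \<bullet> j = 2 powi (- i)" if j: "j \<in> Basis" for j
  proof -
    obtain l where "j = axis l 1" using j by (auto simp: Basis_vec_def)
    then show "a \<bullet> j \<le> b \<bullet> j" "b \<bullet> j - a \<bullet> j = 2 powi (- i)"
      by (auto simp: a_def b_def inner_axis algebra_simps)
  qed
  have "(\<Prod>j\<in>Basis. (b - a) \<bullet> j) = (\<Prod>j\<in>(Basis :: (real^'n) set). 2 powi (- i))"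
    using ab by (intro prod.cong) (auto simp: inner_diff_left)
  also have "\<dots> = vol TYPE('n) i" by (simp add: vol_def)
  finally have v: "(\<Prod>j\<in>Basis. (b - a) \<bullet> j) = vol TYPE('n) i" .
  have "emeasure lborel (box a b) = vol TYPE('n) i" "emeasure lborel (cbox a b) = vol TYPE('n) i"
    using ab v by (auto simp: emeasure_lborel_box emeasure_lborel_cbox)
  then have e: "emeasure lebesgue (box a b) = vol TYPE('n) i" "emeasure lebesgue (cbox a b) = vol TYPE('n) i"
    by (simp_all add: emeasure_completion)
  have "box a b \<subseteq> dcube i x" "dcube i x \<subseteq> cbox a b"
    by (auto simp: eq mem_box_cart less_imp_le)
  then show ?thesis using emeasure_mono[of "box a b" "dcube i x" lebesgue] emeasure_mono[of "dcube i x" "cbox a b" lebesgue] e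
    by (intro antisym) auto
qed

lemma dcube_lmeasurable [simp]: "dcube i x \<in> lmeasurable"
  by (rule fmeasurableI) (auto simp: emeasure_dcube)

lemma measure_dcube: "measure lebesgue (dcube i (x :: real ^ 'n)) = vol TYPE('n) i"
  by (simp add: measure_def emeasure_dcube less_imp_le)

text \<open>
  The cells of generation \<open>L\<close> are represented by their lower left corners, the points of \<open>grid L\<close>, and
  \<open>corner L y\<close> represents the cell of \<open>y\<close>.
\<close>

definition grid :: "int \<Rightarrow> (real ^ 'n) set" where
  "grid L = {z. \<forall>l. 2 powi L * z $ l \<in> \<int>}"

definition corner :: "int \<Rightarrow> real ^ 'n \<Rightarrow> real ^ 'n" where
  "corner L y = (\<chi> l. 2 powi (- L) * real_of_int \<lfloor>2 powi L * y $ l\<rfloor>)"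

lemma corner_grid [simp]: "corner L y \<in> grid L" by (simp add: corner_def grid_def)

lemma corner_dcube: "corner L y \<in> dcube L y" by (simp add: corner_def dcube_def)

lemma dcube_corner [simp]: "dcube L (corner L y) = dcube L y"
  by (rule dcube_eq[OF corner_dcube])

lemma grid_corner: "z \<in> grid L \<Longrightarrow> corner L z = z"
  unfolding grid_def corner_def vec_eq_iff
  by simp

lemma corner_eq_iff: "corner L y = corner L x \<longleftrightarrow> y \<in> dcube L x"
  unfolding corner_def dcube_def vec_eq_iff by simp

lemma corner_unique: "z \<in> grid L \<Longrightarrow> z \<in> dcube L y \<longleftrightarrow> z = corner L y"
  using grid_corner corner_eq_iff by metis

lemma corner_in_dcube: "i \<le> L \<Longrightarrow> y \<in> dcube i x \<Longrightarrow> corner L y \<in> dcube i x"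
  using dcube_subset corner_dcube by blast

lemma disjnt_dcubes: "z \<in> grid L \<Longrightarrow> z' \<in> grid L \<Longrightarrow> z \<noteq> z' \<Longrightarrow> disjnt (dcube L z) (dcube L z')"
  unfolding disjnt_iff using dcube_sym corner_unique by metis

text \<open>
  Disjoint cells of equal volume inside a cube of finite volume.
\<close>

lemma finite_grid: 
  assumes "i \<le> L" shows "finite (dcube i (x :: real ^ 'n) \<inter> grid L)"
proof (rule finite_if_finite_subsets_card_bdd[THEN conjunct1])
  fix F assume F: "F \<subseteq> dcube i x \<inter> grid L" "finite F"
  have "real (card F) * vol TYPE('n) L = measure lebesgue (\<Union>z\<in>F. dcube L z)"
    using F by (subst measure_UNION') (auto simp: pairwise_def measure_dcube intro!: disjnt_dcubes)
  also have "\<dots> \<le> measure lebesgue (dcube i x)"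
    using F dcube_subset[OF assms, of _ x] by (intro measure_mono_fmeasurable) (auto intro!: sets.finite_UN)
  finally have "real (card F) \<le> vol TYPE('n) i / vol TYPE('n) L" by (simp add: measure_dcube field_simps)
  then show "card F \<le> nat \<lceil>vol TYPE('n) i / vol TYPE('n) L\<rceil>" by linarith
qed

lemma dcube_UN: "i \<le> L \<Longrightarrow> dcube i x = (\<Union>z\<in>dcube i x \<inter> grid L. dcube L z)"
proof (intro set_eqI iffI)
  fix y assume i: "i \<le> L" and y: "y \<in> dcube i x"
  show "y \<in> (\<Union>z\<in>dcube i x \<inter> grid L. dcube L z)"
    using corner_in_dcube[OF i y] by (intro UN_I[of "corner L y"]) auto
qed (use dcube_subset in blast)

lemma card_grid:
  assumes "i \<le> L"
  shows "real (card (dcube i (x :: real ^ 'n) \<inter> grid L)) * vol TYPE('n) L = vol TYPE('n) i"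
proof -
  have "vol TYPE('n) i = measure lebesgue (\<Union>z\<in>dcube i x \<inter> grid L. dcube L z)"
    using dcube_UN[OF assms] by (metis measure_dcube)
  also have "\<dots> = real (card (dcube i x \<inter> grid L)) * vol TYPE('n) L"
    using finite_grid[OF assms]
    by (subst measure_UNION') (auto simp: pairwise_def measure_dcube intro!: disjnt_dcubes)
  finally show ?thesis ..
qed

lemma grid_dcube_fine: "z \<in> grid L \<Longrightarrow> L \<le> i \<Longrightarrow> dcube i z \<inter> grid L = {z}"
  using dcube_mono[of L i z] corner_unique[of _ L z] grid_corner[of z L] by fastforce

text \<open>
  The corners in one cube form a finite tree.  From generation \<open>L\<close> on its cubes are singletons, which
  makes the conditions on deep generations hold trivially.
\<close>

lemma dcube_tree:
  fixes x0 :: "real ^ 'n"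
  assumes "i0 \<le> L"
  shows "cube_tree (dcube i0 x0 \<inter> grid L) (\<lambda>n x. dcube (i0 + int n) x \<inter> grid L) (2 ^ CARD('n))"
proof
  show "finite (dcube i0 x0 \<inter> grid L)" by (rule finite_grid[OF assms])
  fix x :: "real ^ 'n" and i assume x: "x \<in> dcube i0 x0 \<inter> grid L"
  show "dcube (i0 + int i) x \<inter> grid L \<subseteq> dcube i0 x0 \<inter> grid L"
    using dcube_subset[of i0 "i0 + int i" x x0] x by auto
  show "x \<in> dcube (i0 + int i) x \<inter> grid L" using x by simp
  show "dcube (i0 + int i) y \<inter> grid L = dcube (i0 + int i) x \<inter> grid L" if "y \<in> dcube (i0 + int i) x \<inter> grid L" for y
    using dcube_eq that by blast
  show "dcube (i0 + int (Suc i)) x \<inter> grid L \<subseteq> dcube (i0 + int i) x \<inter> grid L"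
    using dcube_mono[of "i0 + int i" "i0 + int (Suc i)" x] by auto
  show "real (card (dcube (i0 + int i) x \<inter> grid L)) \<le> 2 ^ CARD('n) * real (card (dcube (i0 + int (Suc i)) x \<inter> grid L))"
  proof (cases "i0 + int i < L")
    case True
    have "vol TYPE('n) (i0 + int i) = 2 ^ CARD('n) * vol TYPE('n) (i0 + int (Suc i))"
      using vol_Suc[where 'n = 'n, of "i0 + int i"] by (simp add: ac_simps)
    then have "real (card (dcube (i0 + int i) x \<inter> grid L)) * vol TYPE('n) L
      = 2 ^ CARD('n) * real (card (dcube (i0 + int (Suc i)) x \<inter> grid L)) * vol TYPE('n) L"
      using card_grid[of "i0 + int i" L x] card_grid[of "i0 + int (Suc i)" L x] True by simp
    then show ?thesis by (metis mult_right_cancel order_refl vol_pos less_irrefl)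
  next
    case False
    then show ?thesis using x by (simp add: grid_dcube_fine)
  qed
qed

lemma sum_cell_indicators:
  fixes c :: "real ^ 'n \<Rightarrow> 'b::real_vector"
  assumes "i \<le> L"
  shows "(\<Sum>z\<in>dcube i x \<inter> grid L. indicat_real (dcube L z) y *\<^sub>R c z) = indicat_real (dcube i x) y *\<^sub>R c (corner L y)"
proof (cases "y \<in> dcube i x")
  case True
  have fin: "finite (dcube i x \<inter> grid L)" by (rule finite_grid[OF assms])
  have "(\<Sum>z\<in>dcube i x \<inter> grid L. indicat_real (dcube L z) y *\<^sub>R c z) = (\<Sum>z\<in>dcube i x \<inter> grid L. if z = corner L y then c z else 0)"
  proof (intro sum.cong refl)
    fix z assume "z \<in> dcube i x \<inter> grid L"
    then have "y \<in> dcube L z \<longleftrightarrow> z = corner L y" using corner_unique dcube_sym by blast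
    then show "indicat_real (dcube L z) y *\<^sub>R c z = (if z = corner L y then c z else 0)" by (cases "z = corner L y") simp_all
  qed
  also have "\<dots> = c (corner L y)" using corner_in_dcube[OF assms True] fin by simp
  finally show ?thesis using True by simp
next
  case False
  have "indicat_real (dcube L z) y *\<^sub>R c z = 0" if "z \<in> dcube i x \<inter> grid L" for z
    using dcube_subset[OF assms, of z x] that False by (auto simp: indicator_def)
  then have "(\<Sum>z\<in>dcube i x \<inter> grid L. indicat_real (dcube L z) y *\<^sub>R c z) = 0" by (rule sum.neutral[rule_format])
  then show ?thesis using False by simp
qed

lemma vol_strict: "i < j \<Longrightarrow> vol TYPE('n::finite) j < vol TYPE('n) i"
proof (induction j rule: int_gr_induct)
  case base
  have "1 * vol TYPE('n) (i + 1) < 2 ^ CARD('n) * vol TYPE('n) (i + 1)"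
    by (intro mult_strict_right_mono one_less_power) auto
  then show ?case unfolding vol_Suc[of i] by simp
next
  case (step j)
  have "1 * vol TYPE('n) (j + 1) < 2 ^ CARD('n) * vol TYPE('n) (j + 1)"
    by (intro mult_strict_right_mono one_less_power) auto
  also have "\<dots> < vol TYPE('n) i" using step by (simp flip: vol_Suc)
  finally show ?case by simp
qed

text \<open>
  Going to smaller generations, the terms at least halve from one to the next.
\<close>

lemma sum_inverse_vol_le:
  assumes "c \<le> a" shows "(\<Sum>i\<in>{c..<a}. 1 / vol TYPE('n::finite) i) \<le> 1 / vol TYPE('n) a"
  using assms
proof (induction a rule: int_ge_induct)
  case base then show ?case by (simp add: less_imp_le)
next
  case (step a)
  have "{c..<a + 1} = insert a {c..<a}" using step by auto
  then have "(\<Sum>i\<in>{c..<a + 1}. 1 / vol TYPE('n) i) = 1 / vol TYPE('n) a + (\<Sum>i\<in>{c..<a}. 1 / vol TYPE('n) i)" by simp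
  also have "\<dots> \<le> 2 * (1 / vol TYPE('n) a)" using step by simp
  also have "\<dots> \<le> 2 ^ CARD('n) * (1 / vol TYPE('n) a)"
    using self_le_power[of "2::real" "CARD('n)"] by (intro mult_right_mono) (auto simp: less_imp_le)
  also have "\<dots> = 1 / vol TYPE('n) (a + 1)" unfolding vol_Suc[of a] by simp
  finally show ?case .
qed

lemma dcube_inject: "dcube i x = dcube j (x :: real ^ 'n) \<Longrightarrow> i = j"
  using vol_strict[where 'n = 'n, of i j] vol_strict[where 'n = 'n, of j i] measure_dcube[of i x] measure_dcube[of j x]
  by (metis less_irrefl linorder_neqE)

lemma cell_constant_integral:
  fixes \<phi> :: "real ^ 'n \<Rightarrow> 'b::{banach, second_countable_topology}"
  assumes i: "i \<le> L" and const: "\<And>y. y \<in> dcube i x \<Longrightarrow> \<phi> y = \<phi> (corner L y)"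
  shows "integrable lebesgue (\<lambda>y. indicator (dcube i x) y *\<^sub>R \<phi> y)"
    "(\<integral>y. indicator (dcube i x) y *\<^sub>R \<phi> y \<partial>lebesgue) = vol TYPE('n) L *\<^sub>R (\<Sum>z\<in>dcube i x \<inter> grid L. \<phi> z)"
proof -
  have eq: "(\<lambda>y. indicat_real (dcube i x) y *\<^sub>R \<phi> y) = (\<lambda>y. \<Sum>z\<in>dcube i x \<inter> grid L. indicat_real (dcube L z) y *\<^sub>R \<phi> z)"
    unfolding sum_cell_indicators[OF i]
  proof
    fix y show "indicat_real (dcube i x) y *\<^sub>R \<phi> y = indicat_real (dcube i x) y *\<^sub>R \<phi> (corner L y)"
      using const[of y] by (cases "y \<in> dcube i x") simp_all
  qed
  have int: "integrable lebesgue (\<lambda>y. indicat_real (dcube L z) y *\<^sub>R \<phi> z)" for z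
    by (intro integrable_scaleR_left integrable_real_indicator) (auto simp: emeasure_dcube)
  show "integrable lebesgue (\<lambda>y. indicator (dcube i x) y *\<^sub>R \<phi> y)"
    unfolding eq using int by (rule Bochner_Integration.integrable_sum)
  show "(\<integral>y. indicator (dcube i x) y *\<^sub>R \<phi> y \<partial>lebesgue) = vol TYPE('n) L *\<^sub>R (\<Sum>z\<in>dcube i x \<inter> grid L. \<phi> z)"
  proof -
    have "(\<integral>y. indicat_real (dcube L z) y *\<^sub>R \<phi> z \<partial>lebesgue) = vol TYPE('n) L *\<^sub>R \<phi> z" for z
      using has_bochner_integral_indicator[of "dcube L z" lebesgue "\<phi> z", THEN has_bochner_integral_integral_eq]
      by (simp add: measure_dcube emeasure_dcube)
    then show ?thesis unfolding eq using int by (simp add: scaleR_sum_right)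
  qed
qed

lemma integral_dcube_split:
  fixes \<phi> :: "real ^ 'n \<Rightarrow> 'b::{banach, second_countable_topology}"
  assumes i: "i \<le> L" and int: "\<And>z. z \<in> dcube i x \<inter> grid L \<Longrightarrow> integrable lebesgue (\<lambda>y. indicator (dcube L z) y *\<^sub>R \<phi> y)"
  shows "(\<integral>y. indicator (dcube i x) y *\<^sub>R \<phi> y \<partial>lebesgue)
    = (\<Sum>z\<in>dcube i x \<inter> grid L. \<integral>y. indicator (dcube L z) y *\<^sub>R \<phi> y \<partial>lebesgue)"
proof -
  have "indicat_real (dcube i x) y *\<^sub>R \<phi> y = (\<Sum>z\<in>dcube i x \<inter> grid L. indicat_real (dcube L z) y *\<^sub>R \<phi> y)" for y
    using sum_cell_indicators[OF i, where c = "\<lambda>_. \<phi> y" and x = x and y = y] by simp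
  then show ?thesis using int by simp
qed

section \<open>Shifts as operators on a finite tree\<close>

definition cell_mean :: "int \<Rightarrow> (real ^ 'n \<Rightarrow> 'k::{real_normed_field, euclidean_space}) \<Rightarrow> real ^ 'n \<Rightarrow> 'k" where
  "cell_mean L f z = (\<integral>y. indicator (dcube L z) y *\<^sub>R f y \<partial>lebesgue) /\<^sub>R vol TYPE('n) L"

locale dyadic_shift =
  fixes \<kappa> :: nat and h k :: "(real ^ 'n) set \<Rightarrow> real ^ 'n \<Rightarrow> 'k::{real_normed_field, euclidean_space}"
  assumes shift: "haar_shift \<kappa> h k"
begin

lemma dcube_in_grid: "dcube i x \<in> dyadic_grid" "dcube i x \<in> dyadic_cubes i"
  unfolding dyadic_grid_def dyadic_cubes_eq by blast+

lemma haar_support: "y \<notin> dcube i x \<Longrightarrow> h (dcube i x) y = 0" "y \<notin> dcube i x \<Longrightarrow> k (dcube i x) y = 0"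
proof -
  have "\<forall>I\<in>dyadic_grid. \<forall>x. x \<notin> I \<longrightarrow> h I x = 0 \<and> k I x = 0"
    using shift unfolding haar_shift_def by (elim conjE)
  from bspec[OF this dcube_in_grid(1)]
  show "y \<notin> dcube i x \<Longrightarrow> h (dcube i x) y = 0" "y \<notin> dcube i x \<Longrightarrow> k (dcube i x) y = 0" by simp_all
qed

lemma haar_const:
  assumes "y \<in> dcube i x" "z \<in> dcube (i + int \<kappa>) y"
  shows "h (dcube i x) z = h (dcube i x) y" "k (dcube i x) z = k (dcube i x) y"
proof -
  have "dcube (i + int \<kappa>) y \<subseteq> dcube i x" using assms by (intro dcube_subset) auto
  moreover have "\<forall>i. \<forall>I\<in>dyadic_cubes i. \<forall>J\<in>dyadic_cubes (i + int \<kappa>). J \<subseteq> I \<longrightarrow> h I constant_on J \<and> k I constant_on J"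
    using shift unfolding haar_shift_def by (elim conjE)
  ultimately have "h (dcube i x) constant_on dcube (i + int \<kappa>) y" "k (dcube i x) constant_on dcube (i + int \<kappa>) y"
    using dcube_in_grid(2) by metis+
  then show "h (dcube i x) z = h (dcube i x) y" "k (dcube i x) z = k (dcube i x) y"
    using assms(2) self_in_dcube[of y "i + int \<kappa>"] unfolding constant_on_def by metis+
qed

lemma haar_corner:
  assumes "i + int \<kappa> \<le> L"
  shows "h (dcube i x) (corner L y) = h (dcube i x) y" "k (dcube i x) (corner L y) = k (dcube i x) y"
proof -
  have c: "corner L y \<in> dcube (i + int \<kappa>) y" using corner_dcube dcube_mono[OF assms, of y] by blast
  have "corner L y \<in> dcube i y" using c dcube_mono[of i "i + int \<kappa>" y] by auto
  then have "corner L y \<in> dcube i x \<longleftrightarrow> y \<in> dcube i x" using dcube_eq dcube_sym by blast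
  then show "h (dcube i x) (corner L y) = h (dcube i x) y" "k (dcube i x) (corner L y) = k (dcube i x) y"
    using haar_const[OF _ c] haar_support by metis+
qed

lemma haar_bdd: "bdd_above (range (\<lambda>y. norm (h (dcube i x) y)))" "bdd_above (range (\<lambda>y. norm (k (dcube i x) y)))"
proof -
  let ?L = "i + int \<kappa>"
  let ?G = "dcube i x \<inter> grid ?L"
  have fin: "finite ?G" by (rule finite_grid) simp
  have "y \<in> dcube i x \<Longrightarrow> corner ?L y \<in> ?G" for y using corner_in_dcube[of i ?L y x] by simp
  then have "h (dcube i x) y \<in> insert 0 (h (dcube i x) ` ?G)" "k (dcube i x) y \<in> insert 0 (k (dcube i x) ` ?G)" for y
    using haar_corner[of i ?L x y] haar_support[of y i x] by (metis imageI insert_iff order_refl)+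
  then have "range (\<lambda>y. norm (h (dcube i x) y)) \<subseteq> norm ` insert 0 (h (dcube i x) ` ?G)"
    "range (\<lambda>y. norm (k (dcube i x) y)) \<subseteq> norm ` insert 0 (k (dcube i x) ` ?G)" by blast+
  then show "bdd_above (range (\<lambda>y. norm (h (dcube i x) y)))" "bdd_above (range (\<lambda>y. norm (k (dcube i x) y)))"
    using fin by (meson bdd_above_finite finite_imageI finite.insertI finite_subset)+
qed

text \<open>
  The suprema in the size condition are over real numbers and majorise the values only because the
  ranges are bounded, which support and constancy on subcubes guarantee.
\<close>

lemma haar_size: "norm (h (dcube i x) y) * norm (k (dcube i x) z) \<le> 1 / vol TYPE('n) i"
proof -
  have "norm (h (dcube i x) y) * norm (k (dcube i x) z)
      \<le> (SUP x'. norm (h (dcube i x) x')) * (SUP x'. norm (k (dcube i x) x'))"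
    by (intro mult_mono cSUP_upper haar_bdd cSUP_upper2[OF haar_bdd(1)]) auto
  also have "\<dots> \<le> inverse (measure lebesgue (dcube i x))"
  proof -
    have "\<forall>I\<in>dyadic_grid. (SUP x. norm (h I x)) * (SUP x. norm (k I x)) \<le> inverse (measure lebesgue I)"
      using shift unfolding haar_shift_def by (elim conjE)
    then show ?thesis using dcube_in_grid(1) by (rule bspec)
  qed
  finally show ?thesis by (simp add: measure_dcube inverse_eq_divide)
qed

text \<open>
  The single term of generation \<open>i\<close> that contributes to the truncated shift at \<open>x\<close>.
\<close>

definition layer :: "int \<Rightarrow> (real ^ 'n \<Rightarrow> 'k) \<Rightarrow> real ^ 'n \<Rightarrow> 'k" where
  "layer i f x = pairing f (k (dcube i x)) * h (dcube i x) x"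

lemma haar_trunc_layers: "haar_trunc h k N f x = (\<Sum>i\<in>{- int N..int N}. layer i f x)"
proof -
  have "{I \<in> (\<Union>i\<in>{- int N..int N}. dyadic_cubes i). x \<in> I} = (\<lambda>i. dcube i x) ` {- int N..int N}"
  proof (intro set_eqI iffI)
    fix I assume "I \<in> {I \<in> (\<Union>i\<in>{- int N..int N}. dyadic_cubes i). x \<in> I}"
    then obtain i z where "i \<in> {- int N..int N}" "I = dcube i z" "x \<in> dcube i z" unfolding dyadic_cubes_eq by blast
    then show "I \<in> (\<lambda>i. dcube i x) ` {- int N..int N}" using dcube_eq by blast
  next
    fix I assume "I \<in> (\<lambda>i. dcube i x) ` {- int N..int N}"
    then show "I \<in> {I \<in> (\<Union>i\<in>{- int N..int N}. dyadic_cubes i). x \<in> I}"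
      unfolding dyadic_cubes_eq using self_in_dcube by blast
  qed
  moreover have "inj_on (\<lambda>i. dcube i x) {- int N..int N}" by (rule inj_onI) (rule dcube_inject)
  ultimately show ?thesis unfolding haar_trunc_def layer_def by (simp add: sum.reindex)
qed

lemma step_kernel:
  assumes "i + int \<kappa> \<le> L"
  shows "k (dcube i x) y = (\<Sum>z\<in>dcube i x \<inter> grid L. indicat_real (dcube L z) y *\<^sub>R k (dcube i x) z)"
proof -
  have iL: "i \<le> L" using assms by simp
  show ?thesis unfolding sum_cell_indicators[OF iL] haar_corner(2)[OF assms]
    using haar_support(2)[of y i x] by (auto simp: indicator_def)
qed

lemma integrable_on_cell: "integrable lebesgue f \<Longrightarrow> integrable lebesgue (\<lambda>y. indicator (dcube L z) y *\<^sub>R f y)"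
  for f :: "real ^ 'n \<Rightarrow> 'k"
  by (rule integrable_mult_indicator) auto

lemma pairing_eq:
  assumes L: "i + int \<kappa> \<le> L" and f: "integrable lebesgue f"
  shows "integrable lebesgue (\<lambda>y. f y * k (dcube i x) y)"
    "pairing f (k (dcube i x)) = (\<Sum>z\<in>dcube i x \<inter> grid L. (vol TYPE('n) L *\<^sub>R k (dcube i x) z) * cell_mean L f z)"
proof -
  have eq: "(\<lambda>y. f y * k (dcube i x) y) = (\<lambda>y. \<Sum>z\<in>dcube i x \<inter> grid L. (indicator (dcube L z) y *\<^sub>R f y) * k (dcube i x) z)"
    by (subst step_kernel[OF L]) (simp add: sum_distrib_left)
  have int: "integrable lebesgue (\<lambda>y. (indicator (dcube L z) y *\<^sub>R f y) * k (dcube i x) z)" for z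
    using integrable_on_cell[OF f] by (rule integrable_mult_left)
  show "integrable lebesgue (\<lambda>y. f y * k (dcube i x) y)" unfolding eq using int by (rule Bochner_Integration.integrable_sum)
  have "pairing f (k (dcube i x)) = (\<Sum>z\<in>dcube i x \<inter> grid L. (\<integral>y. indicator (dcube L z) y *\<^sub>R f y \<partial>lebesgue) * k (dcube i x) z)"
    unfolding pairing_def eq Bochner_Integration.integral_sum[OF int]
    by (intro sum.cong refl Bochner_Integration.integral_mult_left integrable_on_cell[OF f])
  also have "\<dots> = (\<Sum>z\<in>dcube i x \<inter> grid L. (vol TYPE('n) L *\<^sub>R k (dcube i x) z) * cell_mean L f z)"
    by (intro sum.cong refl) (simp add: cell_mean_def less_imp_neq[OF vol_pos, symmetric] mult.commute)
  finally show "pairing f (k (dcube i x)) = \<dots>" .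
qed

lemma layer_le:
  assumes f: "integrable lebesgue f"
  shows "norm (layer i f x) \<le> (\<integral>y. norm (f y) \<partial>lebesgue) / vol TYPE('n) i"
proof -
  have int: "integrable lebesgue (\<lambda>y. f y * k (dcube i x) y * h (dcube i x) x)"
    using pairing_eq(1)[OF order_refl f] by (rule integrable_mult_left)
  have "layer i f x = (\<integral>y. f y * k (dcube i x) y * h (dcube i x) x \<partial>lebesgue)"
    unfolding layer_def pairing_def using pairing_eq(1)[OF order_refl f, of i x] by simp
  then have "norm (layer i f x) \<le> (\<integral>y. norm (f y * k (dcube i x) y * h (dcube i x) x) \<partial>lebesgue)"
    using integral_norm_bound by metis
  also have "\<dots> \<le> (\<integral>y. norm (f y) * (1 / vol TYPE('n) i) \<partial>lebesgue)"
  proof (rule integral_mono)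
    fix y
    show "norm (f y * k (dcube i x) y * h (dcube i x) x) \<le> norm (f y) * (1 / vol TYPE('n) i)"
      using mult_left_mono[OF haar_size[of i x x y] norm_ge_zero[of "f y"]] by (simp add: norm_mult mult_ac)
  qed (use int f in auto)
  finally show ?thesis by simp
qed

lemma layer_cong:
  assumes "\<And>y. y \<in> dcube i x \<Longrightarrow> f y = g y" shows "layer i f x = layer i g x"
proof -
  have "f y * k (dcube i x) y = g y * k (dcube i x) y" for y
    using assms haar_support(2)[of y i x] by (cases "y \<in> dcube i x") auto
  then have "(\<lambda>y. f y * k (dcube i x) y) = (\<lambda>y. g y * k (dcube i x) y)" by (rule ext)
  then show ?thesis by (simp only: layer_def pairing_def)
qed

lemma layer_corner:
  assumes "i + int \<kappa> \<le> L" shows "layer i f (corner L x) = layer i f x"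
proof -
  have "corner L x \<in> dcube i x" using corner_in_dcube[of i L x x] assms by simp
  then show ?thesis unfolding layer_def by (simp add: dcube_eq haar_corner(1)[OF assms])
qed

text \<open>
  The volume factor in \<open>model_k\<close> turns integrals over cells into sums of means, and the size condition
  with volumes into one with numbers of cells.
\<close>

definition model_h :: "int \<Rightarrow> nat \<Rightarrow> real ^ 'n \<Rightarrow> 'k" where
  "model_h i0 n z = h (dcube (i0 + int n) z) z"

definition model_k :: "int \<Rightarrow> int \<Rightarrow> nat \<Rightarrow> real ^ 'n \<Rightarrow> 'k" where
  "model_k L i0 n z = vol TYPE('n) L *\<^sub>R k (dcube (i0 + int n) z) z"

lemma haar_kernel_model:
  assumes L: "i0 + int N + int \<kappa> \<le> L + 1" "i0 \<le> L"
  shows "haar_kernel (dcube i0 x0 \<inter> grid L) (\<lambda>n x. dcube (i0 + int n) x \<inter> grid L) (2 ^ CARD('n))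
    (model_h i0) (model_k L i0) N \<kappa>"
proof -
  interpret cube_tree "dcube i0 x0 \<inter> grid L" "\<lambda>n x. dcube (i0 + int n) x \<inter> grid L" "2 ^ CARD('n)"
    by (rule dcube_tree[OF L(2)])
  show ?thesis
  proof
    fix x y :: "real ^ 'n" and i assume x: "x \<in> dcube i0 x0 \<inter> grid L" and y: "y \<in> dcube (i0 + int i) x \<inter> grid L" and i: "i < N"
    have "dcube (i0 + int i) y = dcube (i0 + int i) x" using y dcube_eq by blast
    then have "norm (model_h i0 i x) * norm (model_k L i0 i y)
      = vol TYPE('n) L * (norm (h (dcube (i0 + int i) x) x) * norm (k (dcube (i0 + int i) x) y))"
      unfolding model_h_def model_k_def by (simp add: less_imp_le)
    also have "\<dots> \<le> vol TYPE('n) L * (1 / vol TYPE('n) (i0 + int i))"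
      by (intro mult_left_mono haar_size) (simp add: less_imp_le)
    also have "\<dots> = 1 / real (card (dcube (i0 + int i) x \<inter> grid L))"
    proof -
      have "real (card (dcube (i0 + int i) x \<inter> grid L)) = vol TYPE('n) (i0 + int i) / vol TYPE('n) L"
        using card_grid[of "i0 + int i" L x] L i by (simp add: eq_divide_eq less_imp_neq[OF vol_pos, symmetric])
      then show ?thesis by simp
    qed
    finally show "norm (model_h i0 i x) * norm (model_k L i0 i y) \<le> \<dots>" .
  next
    fix x y :: "real ^ 'n" and i assume y: "y \<in> dcube (i0 + int (i + \<kappa>)) x \<inter> grid L"
    have y': "y \<in> dcube (i0 + int i + int \<kappa>) x" using y by (simp add: add.assoc)
    have "y \<in> dcube (i0 + int i) x" using y' dcube_mono[of "i0 + int i" "i0 + int i + int \<kappa>" x] by auto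
    then have "dcube (i0 + int i) y = dcube (i0 + int i) x" by (rule dcube_eq)
    then show "model_h i0 i y = model_h i0 i x" "model_k L i0 i y = model_k L i0 i x"
      unfolding model_h_def model_k_def using haar_const[OF self_in_dcube y'] by simp_all
  qed
qed

text \<open>
  The kernels of generation \<open>i\<close> are constant on cells of generation \<open>i + \<kappa>\<close>, so that the pairings only
  see the means of \<open>f\<close> over cells of generation \<open>L\<close>.
\<close>

lemma layers_eq_shift_op:
  assumes L: "i0 + int n + int \<kappa> \<le> L + 1" "i0 \<le> L" and f: "integrable lebesgue f"
  shows "(\<Sum>i\<in>{i0 + int m..<i0 + int n}. layer i f x)
    = cube_tree.shift_op (\<lambda>n x. dcube (i0 + int n) x \<inter> grid L) (model_h i0) (model_k L i0) m n (cell_mean L f) (corner L x)"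
proof -
  interpret cube_tree "dcube i0 x \<inter> grid L" "\<lambda>n x. dcube (i0 + int n) x \<inter> grid L" "2 ^ CARD('n)"
    by (rule dcube_tree[OF L(2)])
  let ?c = "corner L x"
  have "(\<Sum>i\<in>{i0 + int m..<i0 + int n}. layer i f x) = (\<Sum>j\<in>{m..<n}. layer (i0 + int j) f x)"
    by (rule sum.reindex_bij_witness[of _ "\<lambda>j. i0 + int j" "\<lambda>i. nat (i - i0)"]) auto
  also have "\<dots> = shift_op (model_h i0) (model_k L i0) m n (cell_mean L f) ?c"
    unfolding shift_op_def
  proof (intro sum.cong refl)
    fix j assume "j \<in> {m..<n}"
    then have j: "i0 + int j + int \<kappa> \<le> L" using L by simp
    let ?I = "dcube (i0 + int j) ?c"
    have "layer (i0 + int j) f x = layer (i0 + int j) f ?c" using layer_corner[OF j] by simp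
    also have "\<dots> = (\<Sum>z\<in>?I \<inter> grid L. (vol TYPE('n) L *\<^sub>R k ?I z) * cell_mean L f z) * h ?I ?c"
      unfolding layer_def pairing_eq(2)[OF j f] ..
    also have "(\<Sum>z\<in>?I \<inter> grid L. (vol TYPE('n) L *\<^sub>R k ?I z) * cell_mean L f z)
      = (\<Sum>z\<in>?I \<inter> grid L. model_k L i0 j z * cell_mean L f z)"
      unfolding model_k_def by (intro sum.cong refl) (use dcube_eq in \<open>metis IntD1\<close>)
    finally show "layer (i0 + int j) f x = model_h i0 j ?c * (\<Sum>z\<in>?I \<inter> grid L. model_k L i0 j z * cell_mean L f z)"
      by (simp add: model_h_def mult.commute)
  qed
  finally show ?thesis .
qed

end

section \<open>The \<open>L\<^sup>2\<close> bound inside a cube\<close>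

lemma corner_corner [simp]: "corner L (corner L y) = corner L y"
  by (rule grid_corner[OF corner_grid])

definition step_fn :: "int \<Rightarrow> int \<Rightarrow> real ^ 'n \<Rightarrow> (real ^ 'n \<Rightarrow> 'k::{real_normed_field, euclidean_space}) \<Rightarrow> real ^ 'n \<Rightarrow> 'k" where
  "step_fn L a x F y = indicat_real (dcube a x) y *\<^sub>R F (corner L y)"

text \<open>
  The squared \<open>L\<^sup>2\<close> norm of \<open>step_fn L a x F\<close>.
\<close>

definition energy :: "int \<Rightarrow> int \<Rightarrow> real ^ 'n \<Rightarrow> (real ^ 'n \<Rightarrow> 'k::{real_normed_field, euclidean_space}) \<Rightarrow> real" where
  "energy L a x F = vol TYPE('n) L * (\<Sum>z\<in>dcube a x \<inter> grid L. (norm (F z))\<^sup>2)"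

lemma energy_nonneg: "0 \<le> energy L a x F"
  unfolding energy_def by (intro mult_nonneg_nonneg sum_nonneg) (auto simp: less_imp_le)

lemma energy_integral:
  fixes F :: "real ^ 'n \<Rightarrow> 'k::{real_normed_field, euclidean_space}"
  assumes "a \<le> L"
  shows "integrable lebesgue (\<lambda>y. indicat_real (dcube a x) y *\<^sub>R (norm (F (corner L y)))\<^sup>2)"
    "(\<integral>y. indicat_real (dcube a x) y *\<^sub>R (norm (F (corner L y)))\<^sup>2 \<partial>lebesgue) = energy L a x F"
proof -
  note * = cell_constant_integral[OF assms, where x = x and \<phi> = "\<lambda>y. (norm (F (corner L y)))\<^sup>2"]
  show "integrable lebesgue (\<lambda>y. indicat_real (dcube a x) y *\<^sub>R (norm (F (corner L y)))\<^sup>2)"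
    by (rule *(1)) simp
  have "(\<integral>y. indicat_real (dcube a x) y *\<^sub>R (norm (F (corner L y)))\<^sup>2 \<partial>lebesgue)
    = vol TYPE('n) L *\<^sub>R (\<Sum>z\<in>dcube a x \<inter> grid L. (norm (F (corner L z)))\<^sup>2)" by (rule *(2)) simp
  also have "\<dots> = energy L a x F" unfolding energy_def by (simp add: grid_corner)
  finally show "(\<integral>y. indicat_real (dcube a x) y *\<^sub>R (norm (F (corner L y)))\<^sup>2 \<partial>lebesgue) = energy L a x F" .
qed

lemma energy_split:
  fixes F :: "real ^ 'n \<Rightarrow> 'k::{real_normed_field, euclidean_space}"
  assumes "a \<le> b" "b \<le> L"
  shows "(\<Sum>w\<in>dcube a x \<inter> grid b. energy L b w F) = energy L a x F"
  using integral_dcube_split[OF assms(1), of x "\<lambda>y. (norm (F (corner L y)))\<^sup>2"] energy_integral[of _ L _ F] assms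
  by simp

lemma step_fn_integrable:
  fixes F :: "real ^ 'n \<Rightarrow> 'k::{real_normed_field, euclidean_space}"
  assumes "a \<le> L" shows "integrable lebesgue (step_fn L a x F)"
  unfolding step_fn_def by (rule cell_constant_integral(1)[OF assms]) simp

lemma step_fn_sq: "(norm (step_fn L a x F y))\<^sup>2 = indicat_real (dcube a x) y *\<^sub>R (norm (F (corner L y)))\<^sup>2"
  by (simp add: step_fn_def indicator_def)

lemma step_fn_L2:
  fixes F :: "real ^ 'n \<Rightarrow> 'k::{real_normed_field, euclidean_space}"
  assumes "a \<le> L"
  shows "step_fn L a x F \<in> L2" "(\<integral>y. (norm (step_fn L a x F y))\<^sup>2 \<partial>lebesgue) = energy L a x F"
proof -
  have "integrable lebesgue (\<lambda>y. (norm (step_fn L a x F y))\<^sup>2)"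
    unfolding step_fn_sq by (rule energy_integral(1)[OF assms])
  then show "step_fn L a x F \<in> L2"
    using borel_measurable_integrable[OF step_fn_integrable[OF assms, of x F]] by (simp add: L2_def)
  show "(\<integral>y. (norm (step_fn L a x F y))\<^sup>2 \<partial>lebesgue) = energy L a x F"
    unfolding step_fn_sq by (rule energy_integral(2)[OF assms])
qed

lemma step_fn_L1_sq_le:
  fixes F :: "real ^ 'n \<Rightarrow> 'k::{real_normed_field, euclidean_space}"
  assumes "a \<le> L"
  shows "(\<integral>y. norm (step_fn L a x F y) \<partial>lebesgue)\<^sup>2 \<le> vol TYPE('n) a * energy L a x F"
proof -
  let ?G = "dcube a x \<inter> grid L"
  have eq: "norm (step_fn L a x F y) = indicat_real (dcube a x) y *\<^sub>R norm (F (corner L y))" for y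
    by (simp add: step_fn_def)
  have "(\<integral>y. norm (step_fn L a x F y) \<partial>lebesgue) = vol TYPE('n) L *\<^sub>R (\<Sum>z\<in>?G. norm (F (corner L z)))"
    unfolding eq by (rule cell_constant_integral(2)[OF assms]) simp
  also have "\<dots> = vol TYPE('n) L * (\<Sum>z\<in>?G. norm (F z))" by (simp add: grid_corner)
  finally have "(\<integral>y. norm (step_fn L a x F y) \<partial>lebesgue)\<^sup>2 = (vol TYPE('n) L)\<^sup>2 * (\<Sum>z\<in>?G. norm (F z))\<^sup>2"
    by (simp add: power_mult_distrib)
  also have "\<dots> \<le> (vol TYPE('n) L)\<^sup>2 * ((\<Sum>z\<in>?G. (norm (F z))\<^sup>2) * real (card ?G))"
    by (intro mult_left_mono sum_squared_le_sum_of_squares) auto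
  also have "\<dots> = (real (card ?G) * vol TYPE('n) L) * energy L a x F"
    by (simp add: energy_def power2_eq_square mult_ac)
  finally show ?thesis unfolding card_grid[OF assms] .
qed

lemma square_le_double:
  fixes u v c :: real
  assumes "0 \<le> u" "u \<le> v + c" shows "u\<^sup>2 \<le> 2 * v\<^sup>2 + 2 * c\<^sup>2"
proof -
  have "u\<^sup>2 \<le> (v + c)\<^sup>2" using assms by (intro power_mono) auto
  also have "\<dots> \<le> 2 * v\<^sup>2 + 2 * c\<^sup>2" using zero_le_power2[of "v - c"] by (simp add: power2_eq_square algebra_simps)
  finally show ?thesis .
qed

context dyadic_shift begin

definition layers :: "int \<Rightarrow> int \<Rightarrow> (real ^ 'n \<Rightarrow> 'k) \<Rightarrow> real ^ 'n \<Rightarrow> 'k" where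
  "layers a b f y = (\<Sum>i\<in>{a..<b}. layer i f y)"

lemma layers_corner: "b + int \<kappa> \<le> L + 1 \<Longrightarrow> layers a b f (corner L y) = layers a b f y"
  unfolding layers_def by (intro sum.cong refl layer_corner) auto

lemma layers_sq_integrable:
  "integrable lebesgue (\<lambda>y. indicat_real (dcube i x) y *\<^sub>R (norm (layers a b f y))\<^sup>2)"
proof -
  define L where "L = max i (b + int \<kappa>)"
  show ?thesis by (rule cell_constant_integral(1)[of i L]) (auto simp: layers_corner L_def)
qed

text \<open>
  The truncations converge to a function of norm at most that of \<open>f\<close>; the factor \<open>2\<close> comes from
  squaring the triangle inequality.
\<close>

lemma trunc_sq_integral:
  assumes f: "f \<in> L2" and e: "0 < e"
  shows "\<forall>\<^sub>F N in sequentially. integrable lebesgue (\<lambda>y. (norm (haar_trunc h k N f y))\<^sup>2) \<and>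
    (\<integral>y. (norm (haar_trunc h k N f y))\<^sup>2 \<partial>lebesgue) \<le> 2 * (\<integral>y. (norm (f y))\<^sup>2 \<partial>lebesgue) + 2 * e"
proof -
  have "\<forall>f\<in>L2. \<exists>g. tendsto_L2 (\<lambda>N. haar_trunc h k N f) g \<and> L2_norm g \<le> L2_norm f"
    using shift unfolding haar_shift_def by (elim conjE)
  then obtain g where g: "tendsto_L2 (\<lambda>N. haar_trunc h k N f) g" and gf: "L2_norm g \<le> L2_norm f"
    using f by blast
  let ?T = "\<lambda>N. haar_trunc h k N f"
  have T2: "?T N \<in> L2" for N using g unfolding tendsto_L2_def by blast
  have g2: "g \<in> L2" using g unfolding tendsto_L2_def by blast
  have lim: "(\<lambda>N. L2_norm (\<lambda>x. ?T N x - g x)) \<longlonglongrightarrow> 0" using g unfolding tendsto_L2_def by blast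
  have gf2: "(\<integral>y. (norm (g y))\<^sup>2 \<partial>lebesgue) \<le> (\<integral>y. (norm (f y))\<^sup>2 \<partial>lebesgue)"
    using gf unfolding L2_norm_def by simp
  have "\<forall>\<^sub>F N in sequentially. L2_norm (\<lambda>x. ?T N x - g x) < sqrt e"
    using order_tendstoD(2)[OF lim, of "sqrt e"] e by simp
  then show ?thesis
  proof (rule eventually_mono)
    fix N assume N: "L2_norm (\<lambda>x. ?T N x - g x) < sqrt e"
    have m: "?T N \<in> borel_measurable lebesgue" "g \<in> borel_measurable lebesgue"
      and i: "integrable lebesgue (\<lambda>x. (norm (?T N x))\<^sup>2)" "integrable lebesgue (\<lambda>x. (norm (g x))\<^sup>2)"
      using T2[of N] g2 unfolding L2_def by auto
    note m [measurable]
    have d: "integrable lebesgue (\<lambda>x. (norm (?T N x - g x))\<^sup>2)"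
    proof (rule Bochner_Integration.integrable_bound)
      show "integrable lebesgue (\<lambda>x. 2 * (norm (?T N x))\<^sup>2 + 2 * (norm (g x))\<^sup>2)" using i by simp
      show "(\<lambda>x. (norm (?T N x - g x))\<^sup>2) \<in> borel_measurable lebesgue" by measurable
      show "AE x in lebesgue. norm ((norm (?T N x - g x))\<^sup>2) \<le> norm (2 * (norm (?T N x))\<^sup>2 + 2 * (norm (g x))\<^sup>2)"
        using square_le_double[OF norm_ge_zero norm_triangle_ineq4] by (intro AE_I2) (simp add: abs_of_nonneg)
    qed
    have "(\<integral>x. (norm (?T N x))\<^sup>2 \<partial>lebesgue) \<le> (\<integral>x. 2 * (norm (g x))\<^sup>2 + 2 * (norm (?T N x - g x))\<^sup>2 \<partial>lebesgue)"
    proof (rule integral_mono)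
      fix x show "(norm (?T N x))\<^sup>2 \<le> 2 * (norm (g x))\<^sup>2 + 2 * (norm (?T N x - g x))\<^sup>2"
        by (rule square_le_double) (auto simp: norm_triangle_sub)
    qed (use i d in auto)
    also have "\<dots> = 2 * (\<integral>x. (norm (g x))\<^sup>2 \<partial>lebesgue) + 2 * (\<integral>x. (norm (?T N x - g x))\<^sup>2 \<partial>lebesgue)"
      using i d by simp
    also have "(\<integral>x. (norm (?T N x - g x))\<^sup>2 \<partial>lebesgue) \<le> e"
      using N unfolding L2_norm_def by simp
    finally show "integrable lebesgue (\<lambda>y. (norm (?T N y))\<^sup>2) \<and>
      (\<integral>y. (norm (?T N y))\<^sup>2 \<partial>lebesgue) \<le> 2 * (\<integral>y. (norm (f y))\<^sup>2 \<partial>lebesgue) + 2 * e"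
      using gf2 i by linarith
  qed
qed

text \<open>
  On the cube \<open>Q\<close> of generation \<open>a\<close>, the layers inside \<open>Q\<close> are the whole truncated shift minus the layers
  of the larger cubes.  The latter are at most \<open>\<integral>\<bar>f\<bar>\<close> times the sum of \<open>1 / vol i\<close> over \<open>i < a\<close>, hence at most the mean of
  \<open>\<bar>f\<bar>\<close> over \<open>Q\<close>.  Only the limit of the truncations is known to be bounded, so the estimate holds
  for late \<open>N\<close> and up to \<open>e\<close>.
\<close>

lemma tail_energy_le:
  assumes a: "a \<le> L" and e: "0 < e"
  shows "\<forall>\<^sub>F N in sequentially.
    (\<integral>y. indicat_real (dcube a x) y *\<^sub>R (norm (layers a (int N + 1) (step_fn L a x F) y))\<^sup>2 \<partial>lebesgue)
      \<le> 6 * energy L a x F + e"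
proof -
  let ?f = "step_fn L a x F" and ?E = "energy L a x F" and ?Q = "dcube a x"
  define I where "I = (\<integral>y. norm (?f y) \<partial>lebesgue)"
  have I0: "0 \<le> I" unfolding I_def by simp
  have fi: "integrable lebesgue ?f" by (rule step_fn_integrable[OF a])
  have "\<forall>\<^sub>F N in sequentially. a \<le> int N + 1 \<and> - int N \<le> a"
    using eventually_ge_at_top[of "nat \<bar>a\<bar>"] by (rule eventually_mono) auto
  from eventually_conj[OF this trunc_sq_integral[OF step_fn_L2(1)[OF a, of x F], of "e / 4"]] e
  have "\<forall>\<^sub>F N in sequentially. (a \<le> int N + 1 \<and> - int N \<le> a) \<and> (integrable lebesgue (\<lambda>y. (norm (haar_trunc h k N ?f y))\<^sup>2) \<and>
    (\<integral>y. (norm (haar_trunc h k N ?f y))\<^sup>2 \<partial>lebesgue) \<le> 2 * (\<integral>y. (norm (?f y))\<^sup>2 \<partial>lebesgue) + 2 * (e / 4))"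
    by simp
  then show ?thesis
  proof (rule eventually_mono, elim conjE)
    fix N assume N: "a \<le> int N + 1" "- int N \<le> a"
      and int: "integrable lebesgue (\<lambda>y. (norm (haar_trunc h k N ?f y))\<^sup>2)"
      and le: "(\<integral>y. (norm (haar_trunc h k N ?f y))\<^sup>2 \<partial>lebesgue) \<le> 2 * (\<integral>y. (norm (?f y))\<^sup>2 \<partial>lebesgue) + 2 * (e / 4)"
    let ?T = "haar_trunc h k N ?f" and ?R = "layers a (int N + 1) ?f"
    have R: "norm (?R y) \<le> norm (?T y) + I / vol TYPE('n) a" for y
    proof -
      have "{- int N..int N} = {- int N..<a} \<union> {a..<int N + 1}" using N by auto
      then have "?T y = (\<Sum>i\<in>{- int N..<a}. layer i ?f y) + ?R y"
        unfolding haar_trunc_layers layers_def by (simp add: sum.union_disjoint)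
      then have "?R y = ?T y - (\<Sum>i\<in>{- int N..<a}. layer i ?f y)" by simp
      then have "norm (?R y) \<le> norm (?T y) + norm (\<Sum>i\<in>{- int N..<a}. layer i ?f y)"
        by (metis norm_triangle_ineq4)
      also have "norm (\<Sum>i\<in>{- int N..<a}. layer i ?f y) \<le> (\<Sum>i\<in>{- int N..<a}. I / vol TYPE('n) i)"
        unfolding I_def by (intro order_trans[OF norm_sum] sum_mono layer_le fi)
      also have "\<dots> = I * (\<Sum>i\<in>{- int N..<a}. 1 / vol TYPE('n) i)" by (simp add: sum_distrib_left)
      also have "\<dots> \<le> I * (1 / vol TYPE('n) a)" by (intro mult_left_mono sum_inverse_vol_le N I0)
      finally show ?thesis by simp
    qed
    have ind: "integrable lebesgue (\<lambda>y. indicat_real ?Q y * (2 * (I / vol TYPE('n) a)\<^sup>2))"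
      by (intro integrable_mult_left integrable_real_indicator) (auto simp: emeasure_dcube)
    have "(\<integral>y. indicat_real ?Q y *\<^sub>R (norm (?R y))\<^sup>2 \<partial>lebesgue)
      \<le> (\<integral>y. 2 * (norm (?T y))\<^sup>2 + indicat_real ?Q y * (2 * (I / vol TYPE('n) a)\<^sup>2) \<partial>lebesgue)"
    proof (rule integral_mono[OF layers_sq_integrable])
      show "integrable lebesgue (\<lambda>y. 2 * (norm (?T y))\<^sup>2 + indicat_real ?Q y * (2 * (I / vol TYPE('n) a)\<^sup>2))"
        using int ind by simp
      fix y
      show "indicat_real ?Q y *\<^sub>R (norm (?R y))\<^sup>2 \<le> 2 * (norm (?T y))\<^sup>2 + indicat_real ?Q y * (2 * (I / vol TYPE('n) a)\<^sup>2)"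
        using square_le_double[OF norm_ge_zero R[of y]] by (cases "y \<in> ?Q") simp_all
    qed
    also have "\<dots> = 2 * (\<integral>y. (norm (?T y))\<^sup>2 \<partial>lebesgue) + vol TYPE('n) a * (2 * (I / vol TYPE('n) a)\<^sup>2)"
      using int ind by (simp add: measure_dcube)
    also have "vol TYPE('n) a * (2 * (I / vol TYPE('n) a)\<^sup>2) = 2 * (I\<^sup>2 / vol TYPE('n) a)"
      using vol_pos[where 'n = 'n, of a] by (simp add: power_divide power2_eq_square)
    also have "I\<^sup>2 / vol TYPE('n) a \<le> ?E"
      using step_fn_L1_sq_le[OF a, where x = x and F = F] by (simp add: I_def divide_le_eq mult.commute)
    finally show "(\<integral>y. indicat_real ?Q y *\<^sub>R (norm (?R y))\<^sup>2 \<partial>lebesgue) \<le> 6 * ?E + e"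
      using le unfolding step_fn_L2(2)[OF a] by linarith
  qed
qed

text \<open>
  Finitely many layers are a difference of two tails: the layers from \<open>a\<close> on minus the layers from \<open>b\<close>
  on.  The second tail acts separately on the cubes of generation \<open>b\<close>, so the preceding bound applies
  to each of these cubes.  The result does not mention \<open>N\<close>, and \<open>e\<close> can be sent to \<open>0\<close>.
\<close>

lemma layers_energy_le:
  assumes ab: "a \<le> b" and b: "b \<le> L"
  shows "(\<integral>y. indicat_real (dcube a x) y *\<^sub>R (norm (layers a b (step_fn L a x F) y))\<^sup>2 \<partial>lebesgue) \<le> 24 * energy L a x F"
proof (rule field_le_epsilon)
  let ?I = "\<lambda>i z \<phi>. \<integral>y. indicat_real (dcube i z) y *\<^sub>R (norm (\<phi> y))\<^sup>2 \<partial>lebesgue"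
  fix e :: real assume e: "0 < e"
  let ?Q = "dcube a x" and ?f = "step_fn L a x F"
  define W where "W = ?Q \<inter> grid b"
  have finW: "finite W" unfolding W_def by (rule finite_grid[OF ab])
  define d where "d = e / (4 * (real (card W) + 1))"
  have d: "0 < d" "real (card W) * d \<le> e / 4" using e by (auto simp: d_def field_simps)
  have aL: "a \<le> L" using ab b by simp
  have ev1: "\<forall>\<^sub>F N in sequentially.
      ?I a x (layers a (int N + 1) ?f) \<le> 6 * energy L a x F + e / 4"
    by (rule tail_energy_le[OF aL]) (use e in simp)
  have ev2: "\<forall>\<^sub>F N in sequentially. \<forall>w\<in>W.
      ?I b w (layers b (int N + 1) (step_fn L b w F)) \<le> 6 * energy L b w F + d"
    using finW tail_energy_le[OF b d(1)] by (intro eventually_ball_finite) auto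
  have ev3: "\<forall>\<^sub>F N in sequentially. b \<le> int N + 1"
    using eventually_ge_at_top[of "nat \<bar>b\<bar>"] by (rule eventually_mono) auto
  obtain N where
    1: "?I a x (layers a (int N + 1) ?f) \<le> 6 * energy L a x F + e / 4"
    and 2: "\<And>w. w \<in> W \<Longrightarrow> ?I b w (layers b (int N + 1) (step_fn L b w F)) \<le> 6 * energy L b w F + d"
    and 3: "b \<le> int N + 1"
    using eventually_happens[OF eventually_conj[OF ev1 eventually_conj[OF ev2 ev3]]] by auto
  let ?A = "layers a (int N + 1) ?f" and ?B = "layers b (int N + 1) ?f"
  have local: "indicat_real (dcube b w) y *\<^sub>R (norm (?B y))\<^sup>2
      = indicat_real (dcube b w) y *\<^sub>R (norm (layers b (int N + 1) (step_fn L b w F) y))\<^sup>2" if w: "w \<in> W" for w y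
  proof (cases "y \<in> dcube b w")
    case True
    have "?B y = layers b (int N + 1) (step_fn L b w F) y"
      unfolding layers_def
    proof (intro sum.cong refl layer_cong)
      fix i z assume "i \<in> {b..<int N + 1}" and z: "z \<in> dcube i y"
      then have zb: "z \<in> dcube b w" using dcube_subset[of b i y w] True by auto
      moreover have "z \<in> ?Q" using zb dcube_subset[OF ab, of w x] w by (auto simp: W_def)
      ultimately show "?f z = step_fn L b w F z" by (simp add: step_fn_def)
    qed
    then show ?thesis by simp
  qed simp
  have B: "?I a x ?B \<le> 6 * energy L a x F + e / 4"
  proof -
    have "?I a x ?B
       = (\<Sum>w\<in>W. ?I b w ?B)"
      unfolding W_def by (rule integral_dcube_split[OF ab layers_sq_integrable])
    also have "\<dots> = (\<Sum>w\<in>W. ?I b w (layers b (int N + 1) (step_fn L b w F)))"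
      by (intro sum.cong refl Bochner_Integration.integral_cong local)
    also have "\<dots> \<le> (\<Sum>w\<in>W. 6 * energy L b w F + d)" by (intro sum_mono 2)
    also have "\<dots> = 6 * energy L a x F + real (card W) * d"
      using energy_split[OF ab b, where x = x and F = F] by (simp add: sum.distrib sum_distrib_left[symmetric] W_def)
    finally show ?thesis using d by linarith
  qed
  have "?I a x (layers a b ?f)
    \<le> (\<integral>y. 2 * (indicat_real ?Q y *\<^sub>R (norm (?A y))\<^sup>2) + 2 * (indicat_real ?Q y *\<^sub>R (norm (?B y))\<^sup>2) \<partial>lebesgue)"
  proof (rule integral_mono[OF layers_sq_integrable])
    show "integrable lebesgue (\<lambda>y. 2 * (indicat_real ?Q y *\<^sub>R (norm (?A y))\<^sup>2) + 2 * (indicat_real ?Q y *\<^sub>R (norm (?B y))\<^sup>2))"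
      by (intro Bochner_Integration.integrable_add integrable_mult_right layers_sq_integrable)
    fix y
    have "{a..<int N + 1} = {a..<b} \<union> {b..<int N + 1}" using ab 3 by auto
    then have "?A y = layers a b ?f y + ?B y" unfolding layers_def by (simp add: sum.union_disjoint)
    then have "norm (layers a b ?f y) \<le> norm (?A y) + norm (?B y)" by (metis add_diff_cancel_right' norm_triangle_ineq4)
    from square_le_double[OF norm_ge_zero this]
    show "indicat_real ?Q y *\<^sub>R (norm (layers a b ?f y))\<^sup>2
      \<le> 2 * (indicat_real ?Q y *\<^sub>R (norm (?A y))\<^sup>2) + 2 * (indicat_real ?Q y *\<^sub>R (norm (?B y))\<^sup>2)"
      by (cases "y \<in> ?Q") simp_all
  qed
  also have "\<dots> = 2 * ?I a x ?A + 2 * ?I a x ?B"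
    by (subst Bochner_Integration.integral_add; (intro integrable_mult_right layers_sq_integrable)?)
      (simp only: Bochner_Integration.integral_mult_right_zero)
  finally show "?I a x (layers a b ?f) \<le> 24 * energy L a x F + e"
    using 1 B by linarith
qed

lemma cell_mean_step_fn:
  fixes F :: "real ^ 'n \<Rightarrow> 'k"
  assumes a: "a \<le> L" and z: "z \<in> dcube a x \<inter> grid L"
  shows "cell_mean L (step_fn L a x F) z = F z"
proof -
  have c: "step_fn L a x F y = F z" if "y \<in> dcube L z" for y
  proof -
    have "corner L y = z" using corner_eq_iff[of L y z] that grid_corner[of z L] z by auto
    moreover have "y \<in> dcube a x" using dcube_subset[OF a, of z x] that z by blast
    ultimately show ?thesis by (simp add: step_fn_def)
  qed
  have "(\<integral>y. indicat_real (dcube L z) y *\<^sub>R step_fn L a x F y \<partial>lebesgue)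
     = (\<integral>y. indicat_real (dcube L z) y *\<^sub>R F z \<partial>lebesgue)"
    by (intro Bochner_Integration.integral_cong refl) (use c in \<open>auto simp: indicator_def\<close>)
  also have "\<dots> = vol TYPE('n) L *\<^sub>R F z"
    using has_bochner_integral_indicator[of "dcube L z" lebesgue "F z", THEN has_bochner_integral_integral_eq]
    by (simp add: measure_dcube emeasure_dcube)
  finally show ?thesis by (simp add: cell_mean_def less_imp_neq[OF vol_pos, symmetric])
qed

text \<open>
  Applied to step functions, the bound above is the \<open>L\<^sup>2\<close> hypothesis of the finite model; \<open>5\<close> is
  \<open>sqrt 24\<close> rounded up.
\<close>

theorem haar_model_of_shift:
  assumes L: "i0 + int N + int \<kappa> \<le> L + 1" "i0 + int N \<le> L" and \<kappa>: "1 \<le> \<kappa>"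
  shows "haar_model (dcube i0 x0 \<inter> grid L) (\<lambda>n x. dcube (i0 + int n) x \<inter> grid L) (2 ^ CARD('n))
    (model_h i0) (model_k L i0) N \<kappa> 5"
proof -
  have i0: "i0 \<le> L" using L by simp
  interpret haar_kernel "dcube i0 x0 \<inter> grid L" "\<lambda>n x. dcube (i0 + int n) x \<inter> grid L" "2 ^ CARD('n)"
    "model_h i0" "model_k L i0" N \<kappa> by (rule haar_kernel_model[OF L(1) i0])
  show ?thesis
  proof
    show "(0::real) \<le> 5" "1 \<le> \<kappa>" using \<kappa> by auto
    fix z0 m and F :: "real ^ 'n \<Rightarrow> 'k"
    assume z0: "z0 \<in> dcube i0 x0 \<inter> grid L" and m: "m \<le> N"
    let ?a = "i0 + int m" and ?b = "i0 + int N"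
    let ?G = "dcube ?a z0 \<inter> grid L" and ?f = "step_fn L ?a z0 F"
    have a: "?a \<le> ?b" "?a \<le> L" using m L by auto
    have S: "shift_op (model_h i0) (model_k L i0) m N F z = layers ?a ?b ?f z" if z: "z \<in> ?G" for z
    proof -
      have "layers ?a ?b ?f z = shift_op (model_h i0) (model_k L i0) m N (cell_mean L ?f) (corner L z)"
        unfolding layers_def by (rule layers_eq_shift_op[OF L(1) i0 step_fn_integrable[OF a(2)]])
      also have "corner L z = z" using z grid_corner by blast
      also have "shift_op (model_h i0) (model_k L i0) m N (cell_mean L ?f) z = shift_op (model_h i0) (model_k L i0) m N F z"
        unfolding shift_op_def
      proof (intro sum.cong refl arg_cong2[where f = "(*)"])
        fix i y assume "i \<in> {m..<N}" and y: "y \<in> dcube (i0 + int i) z \<inter> grid L"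
        then have "y \<in> ?G" using dcube_subset[of ?a "i0 + int i" z z0] z by auto
        then show "cell_mean L ?f y = F y" by (rule cell_mean_step_fn[OF a(2)])
      qed
      finally show ?thesis ..
    qed
    have "vol TYPE('n) L * (\<Sum>z\<in>?G. (norm (layers ?a ?b ?f z))\<^sup>2)
       = (\<integral>y. indicat_real (dcube ?a z0) y *\<^sub>R (norm (layers ?a ?b ?f y))\<^sup>2 \<partial>lebesgue)"
      by (subst cell_constant_integral(2)[OF a(2)]) (auto simp: layers_corner L)
    also have "\<dots> \<le> 24 * energy L ?a z0 F" by (rule layers_energy_le[OF a(1) L(2)])
    also have "\<dots> \<le> 25 * energy L ?a z0 F" using energy_nonneg[where L = L and a = ?a and x = z0 and F = F] by simp
    also have "\<dots> = vol TYPE('n) L * (5\<^sup>2 * (\<Sum>z\<in>?G. (norm (F z))\<^sup>2))" by (simp add: energy_def)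
    finally have "(\<Sum>z\<in>?G. (norm (layers ?a ?b ?f z))\<^sup>2) \<le> 5\<^sup>2 * (\<Sum>z\<in>?G. (norm (F z))\<^sup>2)"
      by (simp only: mult_le_cancel_left_pos vol_pos)
    then show "(\<Sum>z\<in>?G. (norm (shift_op (model_h i0) (model_k L i0) m N F z))\<^sup>2) \<le> 5\<^sup>2 * (\<Sum>z\<in>?G. (norm (F z))\<^sup>2)"
      using S by simp
  qed
qed

end

section \<open>The weak type bound for truncations\<close>

lemma lr_measurable [measurable]:
  assumes [measurable]: "\<And>j. f j \<in> borel_measurable M"
  shows "(\<lambda>y. lr_upto r J (\<lambda>j. f j y)) \<in> borel_measurable M"
  unfolding lr_upto_def by measurable

lemma lr_le_l1:
  assumes r: "1 < r" shows "lr_upto r J a \<le> (\<Sum>j<J. norm (a j))"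
proof -
  have "lr_upto r J a \<le> (\<Sum>i<J. lr_upto r J (\<lambda>j. if j = i then norm (a i) else 0))"
    by (rule lr_le_sum[OF r]) simp
  also have "\<dots> = (\<Sum>i<J. norm (a i))"
  proof (intro sum.cong refl)
    fix i assume i: "i \<in> {..<J}"
    have "(\<Sum>j<J. norm (if j = i then norm (a i) else 0) powr r) = (\<Sum>j<J. if j = i then norm (a i) powr r else 0)"
      using r by (intro sum.cong) auto
    also have "\<dots> = norm (a i) powr r" using i by simp
    finally show "lr_upto r J (\<lambda>j. if j = i then norm (a i) else 0) = norm (a i)"
      using r unfolding lr_upto_def by (simp add: powr_powr)
  qed
  finally show ?thesis .
qed

lemma lr_integrable:
  fixes f :: "nat \<Rightarrow> 'a \<Rightarrow> 'b::{banach, second_countable_topology}"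
  assumes r: "1 < r" and f: "\<And>j. integrable M (f j)"
  shows "integrable M (\<lambda>y. lr_upto r J (\<lambda>j. f j y))"
proof (rule Bochner_Integration.integrable_bound)
  show "integrable M (\<lambda>y. \<Sum>j<J. norm (f j y))" using f by simp
  show "(\<lambda>y. lr_upto r J (\<lambda>j. f j y)) \<in> borel_measurable M" using f by (intro lr_measurable) auto
  show "AE y in M. norm (lr_upto r J (\<lambda>j. f j y)) \<le> norm (\<Sum>j<J. norm (f j y))"
    using lr_le_l1[OF r] by (intro AE_I2) (simp add: abs_of_nonneg sum_nonneg)
qed

lemma lr_integral_le:
  fixes f :: "nat \<Rightarrow> 'a \<Rightarrow> 'b::{banach, second_countable_topology}"
  assumes r: "1 < r" and f: "\<And>j. integrable M (f j)"
  shows "lr_upto r J (\<lambda>j. \<integral>y. f j y \<partial>M) \<le> (\<integral>y. lr_upto r J (\<lambda>j. f j y) \<partial>M)"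
proof -
  obtain w where w: "\<And>j. 0 \<le> w j" "(\<Sum>j<J. w j * norm (\<integral>y. f j y \<partial>M)) = lr_upto r J (\<lambda>j. \<integral>y. f j y \<partial>M)"
    "\<And>b :: nat \<Rightarrow> real. (\<Sum>j<J. w j * \<bar>b j\<bar>) \<le> lr_upto r J b"
    using lr_norming_functional[OF r, where J = J and a = "\<lambda>j. \<integral>y. f j y \<partial>M"] by blast
  have "lr_upto r J (\<lambda>j. \<integral>y. f j y \<partial>M) \<le> (\<Sum>j<J. w j * (\<integral>y. norm (f j y) \<partial>M))"
    unfolding w(2)[symmetric] by (intro sum_mono mult_left_mono w integral_norm_bound)
  also have "\<dots> = (\<integral>y. (\<Sum>j<J. w j * norm (f j y)) \<partial>M)" using f by simp
  also have "\<dots> \<le> (\<integral>y. lr_upto r J (\<lambda>j. f j y) \<partial>M)"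
  proof (rule integral_mono)
    show "integrable M (\<lambda>y. lr_upto r J (\<lambda>j. f j y))" by (rule lr_integrable[OF r f])
    show "(\<Sum>j<J. w j * norm (f j y)) \<le> lr_upto r J (\<lambda>j. f j y)" for y
      using w(3)[of "\<lambda>j. norm (f j y)"] by simp
  qed (use f in simp)
  finally show ?thesis .
qed

text \<open>
  On a cube of side \<open>2\<^sup>N\<close> the truncated shift is the finite model with \<open>2 N + 1\<close> scales and cells
  of generation \<open>N + \<kappa>\<close>.  Passing from \<open>f\<close> to its cell means decreases the \<open>L\<^sup>1(\<ell>\<^sup>r)\<close> norm by
  Minkowski's inequality.
\<close>

lemma trunc_weak_type_top_cube:
  fixes h k :: "nat \<Rightarrow> (real ^ 'n) set \<Rightarrow> real ^ 'n \<Rightarrow> 'k::{real_normed_field, euclidean_space}"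
  assumes r: "1 < r" and \<kappa>: "1 \<le> \<kappa>" and shift: "\<And>j. haar_shift \<kappa> (h j) (k j)"
    and f: "\<And>j. integrable lebesgue (f j)" and \<alpha>: "0 < \<alpha>"
  defines "W \<equiv> weak_const r (2 ^ CARD('n)) 5"
  shows "ennreal \<alpha> * emeasure lebesgue {y\<in>dcube (- int N) x. \<alpha> < lr_upto r J (\<lambda>j. haar_trunc (h j) (k j) N (f j) y)}
    \<le> ennreal (W * real \<kappa>) * (\<integral>\<^sup>+y. ennreal (lr_upto r J (\<lambda>j. f j y)) * indicator (dcube (- int N) x) y \<partial>lebesgue)"
proof -
  let ?i0 = "- int N"
  let ?S = "{y\<in>dcube (- int N) x. \<alpha> < lr_upto r J (\<lambda>j. haar_trunc (h j) (k j) N (f j) y)}"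
  interpret dyadic_shift \<kappa> "h j" "k j" for j by standard (rule shift)
  define L where "L = int N + int \<kappa>"
  define n where "n = 2 * N + 1"
  let ?c = "\<lambda>n x. dcube (- int N + int n) x \<inter> grid L"
  let ?X = "dcube ?i0 x \<inter> grid L"
  have L: "?i0 + int n + int \<kappa> \<le> L + 1" "?i0 + int n \<le> L" "?i0 \<le> L" using \<kappa> by (auto simp: L_def n_def)
  let ?h = "\<lambda>j. model_h j ?i0" and ?k = "\<lambda>j. model_k j L ?i0"
  have model: "haar_model ?X ?c (2 ^ CARD('n)) (?h j) (?k j) n \<kappa> 5" for j
    by (rule haar_model_of_shift[OF L(1,2) \<kappa>])
  define S where "S = (\<lambda>z. lr_upto r J (\<lambda>j. cube_tree.shift_op ?c (?h j) (?k j) 0 n (cell_mean L (f j)) z))"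
  have trunc: "lr_upto r J (\<lambda>j. haar_trunc (h j) (k j) N (f j) y) = S (corner L y)" for y
  proof -
    have "{- int N..int N} = {?i0 + int 0..<?i0 + int n}" by (auto simp: n_def)
    then have "haar_trunc (h j) (k j) N (f j) y
      = cube_tree.shift_op ?c (?h j) (?k j) 0 n (cell_mean L (f j)) (corner L y)" for j
      unfolding haar_trunc_layers using layers_eq_shift_op[OF L(1,3) f[of j], where m = 0 and x = y] by simp
    then show ?thesis by (simp add: S_def)
  qed
  define E where "E = {z\<in>?X. \<alpha> < S z}"
  have finX: "finite ?X" by (rule finite_grid[OF L(3)])
  have finE: "finite E" by (rule finite_subset[OF _ finX]) (auto simp: E_def)
  have sub: "?S \<subseteq> (\<Union>z\<in>E. dcube L z)"
  proof
    fix y assume y: "y \<in> ?S"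
    then have "corner L y \<in> E" using corner_in_dcube[OF L(3), of y x] by (simp add: E_def trunc)
    then show "y \<in> (\<Union>z\<in>E. dcube L z)" by (intro UN_I[of "corner L y"]) auto
  qed
  have E_meas: "emeasure lebesgue ?S \<le> ennreal (real (card E) * vol TYPE('n) L)"
  proof -
    have "emeasure lebesgue ?S \<le> emeasure lebesgue (\<Union>z\<in>E. dcube L z)"
      by (rule emeasure_mono[OF sub]) (use finE in \<open>auto intro!: sets.finite_UN\<close>)
    also have "\<dots> \<le> (\<Sum>z\<in>E. emeasure lebesgue (dcube L z))"
      by (rule emeasure_subadditive_finite) (use finE in auto)
    also have "\<dots> = ennreal (real (card E) * vol TYPE('n) L)"
      by (simp add: emeasure_dcube ennreal_mult less_imp_le ennreal_of_nat_eq_real_of_nat)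
    finally show ?thesis .
  qed
  let ?x = "corner L x"
  have x: "?x \<in> ?X" using corner_in_dcube[OF L(3), of x x] by simp
  have top: "?c 0 ?x = ?X" using dcube_eq[of ?x ?i0 x] x by simp
  let ?u = "\<lambda>y. lr_upto r J (\<lambda>j. f j y)"
  have u: "integrable lebesgue ?u" by (rule lr_integrable[OF r f])
  have W0: "0 \<le> W * real \<kappa>"
    unfolding W_def weak_const_def using r by (intro mult_nonneg_nonneg add_nonneg_nonneg) auto
  have uc: "integrable lebesgue (\<lambda>y. indicat_real (dcube i z) y *\<^sub>R ?u y)" for i z
    using u by (intro integrable_mult_indicator) auto
  have mean: "vol TYPE('n) L * lr_upto r J (\<lambda>j. cell_mean L (f j) z) \<le> (\<integral>y. indicat_real (dcube L z) y *\<^sub>R ?u y \<partial>lebesgue)" for z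
  proof -
    have "vol TYPE('n) L * lr_upto r J (\<lambda>j. cell_mean L (f j) z) = lr_upto r J (\<lambda>j. vol TYPE('n) L * norm (cell_mean L (f j) z))"
      using r by (simp add: lr_mult less_imp_le)
    also have "(\<lambda>j. vol TYPE('n) L * norm (cell_mean L (f j) z)) = (\<lambda>j. norm (\<integral>y. indicat_real (dcube L z) y *\<^sub>R f j y \<partial>lebesgue))"
    proof -
      have eq: "vol TYPE('n) L * (inverse (vol TYPE('n) L) * v) = v" for v
        using less_imp_neq[OF vol_pos[where 'n = 'n, of L]] by simp
      have "\<bar>vol TYPE('n) L\<bar> = vol TYPE('n) L" by (simp add: less_imp_le)
      then show ?thesis by (simp only: cell_mean_def norm_scaleR abs_inverse eq)
    qed
    also have "lr_upto r J \<dots> = lr_upto r J (\<lambda>j. \<integral>y. indicat_real (dcube L z) y *\<^sub>R f j y \<partial>lebesgue)" by simp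
    also have "\<dots> \<le> (\<integral>y. lr_upto r J (\<lambda>j. indicat_real (dcube L z) y *\<^sub>R f j y) \<partial>lebesgue)"
      using f by (intro lr_integral_le[OF r] integrable_mult_indicator) auto
    also have "(\<lambda>y. lr_upto r J (\<lambda>j. indicat_real (dcube L z) y *\<^sub>R f j y)) = (\<lambda>y. indicat_real (dcube L z) y *\<^sub>R ?u y)"
      using r by (auto simp: indicator_def lr_upto_def fun_eq_iff)
    finally show ?thesis .
  qed
  have "\<alpha> * real (card E) \<le> W * real \<kappa> * (\<Sum>z\<in>?X. lr_upto r J (\<lambda>j. cell_mean L (f j) z))"
    using vector_weak_type[OF r model x \<alpha>, where J = J and f = "\<lambda>j. cell_mean L (f j)"] unfolding top E_def S_def W_def .
  then have "\<alpha> * real (card E) * vol TYPE('n) L \<le> W * real \<kappa> * (\<Sum>z\<in>?X. lr_upto r J (\<lambda>j. cell_mean L (f j) z)) * vol TYPE('n) L"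
    by (intro mult_right_mono) (auto simp: less_imp_le)
  also have "\<dots> = W * real \<kappa> * (\<Sum>z\<in>?X. vol TYPE('n) L * lr_upto r J (\<lambda>j. cell_mean L (f j) z))"
    by (simp add: sum_distrib_left mult_ac)
  also have "\<dots> \<le> W * real \<kappa> * (\<Sum>z\<in>?X. \<integral>y. indicat_real (dcube L z) y *\<^sub>R ?u y \<partial>lebesgue)"
    by (intro mult_left_mono sum_mono mean W0)
  also have "(\<Sum>z\<in>?X. \<integral>y. indicat_real (dcube L z) y *\<^sub>R ?u y \<partial>lebesgue) = (\<integral>y. indicat_real (dcube ?i0 x) y *\<^sub>R ?u y \<partial>lebesgue)"
    by (rule integral_dcube_split[OF L(3) uc, symmetric])
  finally have main: "\<alpha> * real (card E) * vol TYPE('n) L \<le> W * real \<kappa> * (\<integral>y. indicat_real (dcube ?i0 x) y *\<^sub>R ?u y \<partial>lebesgue)" .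
  have nn: "(\<integral>\<^sup>+y. ennreal (?u y) * indicator (dcube ?i0 x) y \<partial>lebesgue) = ennreal (\<integral>y. indicat_real (dcube ?i0 x) y *\<^sub>R ?u y \<partial>lebesgue)"
    by (subst nn_integral_eq_integral[OF uc, symmetric]) (auto intro!: nn_integral_cong simp: indicator_def)
  have "ennreal \<alpha> * emeasure lebesgue ?S
    \<le> ennreal \<alpha> * ennreal (real (card E) * vol TYPE('n) L)" by (rule mult_left_mono[OF E_meas]) simp
  also have "\<dots> = ennreal (\<alpha> * real (card E) * vol TYPE('n) L)" using \<alpha> by (simp add: ennreal_mult less_imp_le mult.assoc)
  also have "\<dots> \<le> ennreal (W * real \<kappa> * (\<integral>y. indicat_real (dcube ?i0 x) y *\<^sub>R ?u y \<partial>lebesgue))"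
    using main by (rule ennreal_leI)
  also have "\<dots> = ennreal (W * real \<kappa>) * (\<integral>\<^sup>+y. ennreal (?u y) * indicator (dcube ?i0 x) y \<partial>lebesgue)"
    unfolding nn using W0 by (intro ennreal_mult integral_nonneg_AE AE_I2) auto
  finally show ?thesis .
qed

text \<open>
  Both sides are countably additive over the cubes of side \<open>2\<^sup>N\<close>.
\<close>

lemma trunc_weak_type:
  fixes h k :: "nat \<Rightarrow> (real ^ 'n) set \<Rightarrow> real ^ 'n \<Rightarrow> 'k::{real_normed_field, euclidean_space}"
  assumes r: "1 < r" and \<kappa>: "1 \<le> \<kappa>" and shift: "\<And>j. haar_shift \<kappa> (h j) (k j)"
    and f: "\<And>j. integrable lebesgue (f j)" and \<alpha>: "0 < \<alpha>"
    and m[measurable]: "\<And>j. haar_trunc (h j) (k j) N (f j) \<in> borel_measurable lebesgue"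
  defines "W \<equiv> weak_const r (2 ^ CARD('n)) 5"
  shows "ennreal \<alpha> * emeasure lebesgue {y. \<alpha> < lr_upto r J (\<lambda>j. haar_trunc (h j) (k j) N (f j) y)}
    \<le> ennreal (W * real \<kappa>) * (\<integral>\<^sup>+y. ennreal (lr_upto r J (\<lambda>j. f j y)) \<partial>lebesgue)"
proof -
  let ?S = "{y. \<alpha> < lr_upto r J (\<lambda>j. haar_trunc (h j) (k j) N (f j) y)}"
  let ?u = "\<lambda>y. ennreal (lr_upto r J (\<lambda>j. f j y))"
  let ?C = "dyadic_cubes (- int N) :: (real ^ 'n) set set"
  have fm[measurable]: "f j \<in> borel_measurable lebesgue" for j using f by auto
  have S[measurable]: "?S \<in> sets lebesgue"
  proof -
    have "{y\<in>space lebesgue. \<alpha> < lr_upto r J (\<lambda>j. haar_trunc (h j) (k j) N (f j) y)} \<in> sets lebesgue" by measurable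
    then show ?thesis by simp
  qed
  have um[measurable]: "?u \<in> borel_measurable lebesgue" by measurable
  have count: "countable ?C"
  proof -
    have *: "?C = (\<lambda>m. (\<lambda>x. 2 powi (- (- int N)) *\<^sub>R (x + (\<chi> l. real_of_int (m $ l)))) ` {x. \<forall>l. 0 \<le> x $ l \<and> x $ l < 1}) ` (UNIV :: (int ^ 'n) set)"
      unfolding dyadic_cubes_def by (simp only: full_SetCompr_eq simp_thms)
    show ?thesis unfolding * by (intro countable_image countableI_type)
  qed
  have C_sets: "I \<in> sets lebesgue" if "I \<in> ?C" for I using that unfolding dyadic_cubes_eq by auto
  have disj: "I = I'" if I: "I \<in> ?C" "I' \<in> ?C" "y \<in> I" "y \<in> I'" for I I' y
  proof -
    obtain x x' where "I = dcube (- int N) x" "I' = dcube (- int N) x'" using I(1,2) unfolding dyadic_cubes_eq by blast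
    then show ?thesis using dcube_eq[of y "- int N" x] dcube_eq[of y "- int N" x'] I(3,4) by simp
  qed
  have cover: "\<Union>?C = UNIV" unfolding dyadic_cubes_eq using self_in_dcube by blast
  have "emeasure lebesgue ?S = emeasure lebesgue (\<Union>I\<in>?C. I \<inter> ?S)"
    using cover by (intro arg_cong[where f = "emeasure lebesgue"]) blast
  also have "\<dots> = (\<integral>\<^sup>+I. emeasure lebesgue (I \<inter> ?S) \<partial>count_space ?C)"
    by (rule emeasure_UN_countable) (use C_sets S count disj in \<open>auto simp: disjoint_family_on_def\<close>)
  finally have 1: "emeasure lebesgue ?S = \<dots>" .
  have "(\<integral>\<^sup>+y. ?u y \<partial>lebesgue) = emeasure (density lebesgue ?u) (\<Union>I\<in>?C. I)"
    using cover by (simp add: emeasure_density)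
  also have "\<dots> = (\<integral>\<^sup>+I. emeasure (density lebesgue ?u) I \<partial>count_space ?C)"
    by (rule emeasure_UN_countable) (use C_sets count disj in \<open>auto simp: disjoint_family_on_def\<close>)
  finally have 2: "(\<integral>\<^sup>+y. ?u y \<partial>lebesgue) = \<dots>" .
  have "ennreal \<alpha> * emeasure lebesgue ?S = (\<integral>\<^sup>+I. ennreal \<alpha> * emeasure lebesgue (I \<inter> ?S) \<partial>count_space ?C)"
    unfolding 1 by (rule nn_integral_cmult[symmetric]) simp
  also have "\<dots> \<le> (\<integral>\<^sup>+I. ennreal (W * real \<kappa>) * emeasure (density lebesgue ?u) I \<partial>count_space ?C)"
  proof (rule nn_integral_mono)
    fix I assume "I \<in> space (count_space ?C)"
    then obtain x where I: "I = dcube (- int N) x" unfolding dyadic_cubes_eq by auto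
    have eq: "I \<inter> ?S = {y\<in>dcube (- int N) x. \<alpha> < lr_upto r J (\<lambda>j. haar_trunc (h j) (k j) N (f j) y)}" unfolding I by blast
    have "ennreal \<alpha> * emeasure lebesgue (I \<inter> ?S)
      \<le> ennreal (W * real \<kappa>) * (\<integral>\<^sup>+y. ?u y * indicator (dcube (- int N) x) y \<partial>lebesgue)"
      unfolding eq W_def by (rule trunc_weak_type_top_cube[OF r \<kappa> shift f \<alpha>])
    also have "(\<integral>\<^sup>+y. ?u y * indicator (dcube (- int N) x) y \<partial>lebesgue) = emeasure (density lebesgue ?u) I"
      unfolding I by (rule emeasure_density[symmetric]) auto
    finally show "ennreal \<alpha> * emeasure lebesgue (I \<inter> ?S) \<le> ennreal (W * real \<kappa>) * emeasure (density lebesgue ?u) I" .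
  qed
  also have "\<dots> = ennreal (W * real \<kappa>) * (\<integral>\<^sup>+y. ?u y \<partial>lebesgue)"
    unfolding 2 by (rule nn_integral_cmult) simp
  finally show ?thesis .
qed

section \<open>Passage to the limit\<close>

lemma lr_mono_length:
  assumes "0 < r" "J \<le> J'" shows "lr_upto r J a \<le> lr_upto r J' a"
  unfolding lr_upto_def using assms by (intro powr_mono2 sum_mono2 sum_nonneg) auto

lemma lr_le_lr_norm:
  fixes a :: "nat \<Rightarrow> 'a::real_normed_vector"
  assumes r: "0 < r" shows "ennreal (lr_upto r J a) \<le> lr_norm r a"
proof (cases "(\<Sum>j. ennreal (norm (a j) powr r)) = \<infinity>")
  case True then show ?thesis by (simp add: lr_norm_def ennreal_powr_def)
next
  case False
  define S where "S = enn2real (\<Sum>j. ennreal (norm (a j) powr r))"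
  have S: "(\<Sum>j. ennreal (norm (a j) powr r)) = ennreal S" "0 \<le> S"
    using False by (auto simp: S_def less_top)
  have "(\<Sum>j<J. ennreal (norm (a j) powr r)) \<le> (\<Sum>j. ennreal (norm (a j) powr r))"
    by (rule sum_le_suminf) auto
  then have "ennreal (\<Sum>j<J. norm (a j) powr r) \<le> ennreal S" unfolding S(1) by (simp add: sum_nonneg)
  then have "(\<Sum>j<J. norm (a j) powr r) \<le> S" using S(2) by simp
  then have "lr_upto r J a \<le> S powr (1 / r)" unfolding lr_upto_def using r by (intro powr_mono2) (auto simp: sum_nonneg)
  then show ?thesis unfolding lr_norm_def ennreal_powr_def S(1) using S(2) by (simp add: ennreal_leI)
qed

lemma lr_norm_le:
  fixes a :: "nat \<Rightarrow> 'a::real_normed_vector"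
  assumes r: "0 < r" and t: "0 \<le> t" and le: "\<And>J. lr_upto r J a \<le> t" shows "lr_norm r a \<le> ennreal t"
proof -
  have "(\<Sum>j<J. norm (a j) powr r) \<le> t powr r" for J
    unfolding lr_powr[OF r, symmetric] using r le by (intro powr_mono2) auto
  then have "(\<Sum>j<J. ennreal (norm (a j) powr r)) \<le> ennreal (t powr r)" for J
    by (simp add: sum_nonneg ennreal_leI)
  then have le: "(\<Sum>j. ennreal (norm (a j) powr r)) \<le> ennreal (t powr r)"
    by (intro suminf_le_const) auto
  then have fin: "(\<Sum>j. ennreal (norm (a j) powr r)) \<noteq> \<infinity>" by (auto simp: top_unique)
  have "enn2real (\<Sum>j. ennreal (norm (a j) powr r)) \<le> t powr r"
    using le by (simp add: enn2real_leI)
  then have "enn2real (\<Sum>j. ennreal (norm (a j) powr r)) powr (1 / r) \<le> (t powr r) powr (1 / r)"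
    using r by (intro powr_mono2) auto
  also have "\<dots> = t" using r t by (simp add: powr_powr)
  finally show ?thesis unfolding lr_norm_def ennreal_powr_def using fin by (simp add: ennreal_leI)
qed

lemma less_lr_norm_iff:
  assumes "0 < r" "0 \<le> t" shows "ennreal t < lr_norm r a \<longleftrightarrow> (\<exists>J. t < lr_upto r J a)"
  using lr_norm_le[OF assms, of a] lr_le_lr_norm[OF assms(1), of _ a] assms(2)
  by (metis ennreal_less_iff leD le_less_trans lr_nonneg not_le order_less_le_trans)

lemma L1_lr_integrable:
  assumes r: "0 < r" and f: "f \<in> L1_lr r" shows "integrable lebesgue (f j)"
proof (rule integrableI_bounded)
  show "f j \<in> borel_measurable lebesgue" using f by (simp add: L1_lr_def)
  have "ennreal (norm (f j x)) \<le> lr_norm r (\<lambda>j. f j x)" for x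
    using order_trans[OF ennreal_leI[OF norm_le_lr[OF r lessI[of j]]] lr_le_lr_norm[OF r]] .
  then have "(\<integral>\<^sup>+x. ennreal (norm (f j x)) \<partial>lebesgue) \<le> L1_lr_norm r f"
    unfolding L1_lr_norm_def by (intro nn_integral_mono)
  also have "\<dots> < \<infinity>" using f by (simp add: L1_lr_def)
  finally show "(\<integral>\<^sup>+x. ennreal (norm (f j x)) \<partial>lebesgue) < \<infinity>" .
qed

lemma haar_apply_limit:
  assumes "haar_defined h k f"
  shows "tendsto_in_measure_on_bounded (\<lambda>N. haar_trunc h k N f) (haar_apply h k f)"
  using assms unfolding haar_defined_def haar_apply_def by (metis (mono_tags, lifting) someI_ex)

text \<open>
  Where all of the first \<open>J\<close> truncations are within \<open>e\<close> of their limits, the \<open>\<ell>\<^sup>r\<close> norm of the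
  truncations exceeds \<open>t / 2\<close> if that of the limits exceeds \<open>t\<close>.  The measure of the other points of \<open>B\<close>
  tends to \<open>0\<close>.
\<close>

lemma limit_weak_type:
  fixes h k :: "nat \<Rightarrow> (real ^ 'n) set \<Rightarrow> real ^ 'n \<Rightarrow> 'k::{real_normed_field, euclidean_space}"
  assumes r: "1 < r" and \<kappa>: "1 \<le> \<kappa>" and shift: "\<And>j. haar_shift \<kappa> (h j) (k j)"
    and f: "f \<in> L1_lr r" and def: "vector_haar_defined h k f" and t: "0 < t"
    and B: "bounded B" "B \<in> sets lebesgue"
  shows "ennreal (t / 2) * emeasure lebesgue {x\<in>B. t < lr_upto r J (\<lambda>j. haar_apply (h j) (k j) (f j) x)}
    \<le> ennreal (weak_const r (2 ^ CARD('n)) 5 * real \<kappa>) * L1_lr_norm r f"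
proof -
  let ?E = "{x\<in>B. t < lr_upto r J (\<lambda>j. haar_apply (h j) (k j) (f j) x)}"
  let ?T = "\<lambda>N j. haar_trunc (h j) (k j) N (f j)" and ?g = "\<lambda>j. haar_apply (h j) (k j) (f j)"
  let ?R = "ennreal (weak_const r (2 ^ CARD('n)) 5 * real \<kappa>) * L1_lr_norm r f"
  have lim: "tendsto_in_measure_on_bounded (\<lambda>N. ?T N j) (?g j)" for j
    using def haar_apply_limit unfolding vector_haar_defined_def by blast
  have Tm[measurable]: "?T N j \<in> borel_measurable lebesgue" and gm[measurable]: "?g j \<in> borel_measurable lebesgue" for N j
    using lim[of j] unfolding tendsto_in_measure_on_bounded_def by blast+
  have fi: "integrable lebesgue (f j)" for j using L1_lr_integrable[OF _ f] r by simp
  define c where "c = lr_upto r J (\<lambda>j. 1 :: real)"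
  have c: "0 \<le> c" by (simp add: c_def)
  define e where "e = (t / 2) / (c + 1)"
  have e: "0 < e" "e * c \<le> t / 2" using t c by (auto simp: e_def field_simps)
  let ?D = "\<lambda>N j. {x\<in>B. norm (?T N j x - ?g j x) > e}"
  have D0: "(\<lambda>N. emeasure lebesgue (?D N j)) \<longlonglongrightarrow> 0" for j
    using lim[of j] B e unfolding tendsto_in_measure_on_bounded_def by blast
  have "(\<lambda>N. ?R + ennreal (t / 2) * (\<Sum>j<J. emeasure lebesgue (?D N j))) \<longlonglongrightarrow> ?R + ennreal (t / 2) * (\<Sum>j<J. 0)"
    by (intro tendsto_add tendsto_const ennreal_tendsto_cmult tendsto_sum D0) simp
  then have conv: "(\<lambda>N. ?R + ennreal (t / 2) * (\<Sum>j<J. emeasure lebesgue (?D N j))) \<longlonglongrightarrow> ?R" by simp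
  have le: "ennreal (t / 2) * emeasure lebesgue ?E
     \<le> ?R + ennreal (t / 2) * (\<Sum>j<J. emeasure lebesgue (?D N j))" for N
  proof -
    let ?S = "{x. t / 2 < lr_upto r J (\<lambda>j. ?T N j x)}"
    have Bs[measurable]: "B \<in> sets lebesgue" by fact
    have Ss[measurable]: "?S \<in> sets lebesgue"
    proof -
      have "{x\<in>space lebesgue. t / 2 < lr_upto r J (\<lambda>j. ?T N j x)} \<in> sets lebesgue" by measurable
      then show ?thesis by simp
    qed
    have Ds[measurable]: "?D N j \<in> sets lebesgue" for j
    proof -
      have "B \<inter> {x\<in>space lebesgue. norm (?T N j x - ?g j x) > e} \<in> sets lebesgue" by measurable
      moreover have "B \<inter> {x\<in>space lebesgue. norm (?T N j x - ?g j x) > e} = ?D N j" by auto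
      ultimately show ?thesis by simp
    qed
    have DU: "(\<Union>j<J. ?D N j) \<in> sets lebesgue" by (rule sets.finite_UN[OF finite_lessThan Ds])
    have "?E \<subseteq> ?S \<union> (\<Union>j<J. ?D N j)"
    proof
      fix x assume x: "x \<in> ?E"
      show "x \<in> ?S \<union> (\<Union>j<J. ?D N j)"
      proof (rule ccontr)
        assume "x \<notin> ?S \<union> (\<Union>j<J. ?D N j)"
        then have 1: "lr_upto r J (\<lambda>j. ?T N j x) \<le> t / 2" and 2: "\<And>j. j < J \<Longrightarrow> norm (?T N j x - ?g j x) \<le> e"
          using x by (auto simp: not_less)
        have "lr_upto r J (\<lambda>j. ?g j x) \<le> lr_upto r J (\<lambda>j. ?T N j x) + lr_upto r J (\<lambda>j. e * 1)"
        proof (rule lr_le_add[OF r])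
          fix j assume "j < J"
          then show "norm (?g j x) \<le> norm (?T N j x) + norm (e * 1)"
            using 2[of j] norm_triangle_sub[of "?g j x" "?T N j x"] e by (simp add: norm_minus_commute)
        qed
        also have "\<dots> \<le> t / 2 + e * c" unfolding c_def using 1 r e by (subst lr_mult) auto
        finally show False using x e by simp
      qed
    qed
    then have "emeasure lebesgue ?E \<le> emeasure lebesgue (?S \<union> (\<Union>j<J. ?D N j))"
      by (rule emeasure_mono) (rule sets.Un[OF Ss DU])
    also have "\<dots> \<le> emeasure lebesgue ?S + emeasure lebesgue (\<Union>j<J. ?D N j)"
      by (rule emeasure_subadditive[OF Ss DU])
    also have "\<dots> \<le> emeasure lebesgue ?S + (\<Sum>j<J. emeasure lebesgue (?D N j))"
      by (rule add_left_mono, rule emeasure_subadditive_finite[OF finite_lessThan]) (use Ds in blast)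
    finally have "emeasure lebesgue ?E
      \<le> emeasure lebesgue ?S + (\<Sum>j<J. emeasure lebesgue (?D N j))" .
    from mult_left_mono[OF this zero_le, of "ennreal (t / 2)"]
    have "ennreal (t / 2) * emeasure lebesgue ?E
      \<le> ennreal (t / 2) * emeasure lebesgue ?S + ennreal (t / 2) * (\<Sum>j<J. emeasure lebesgue (?D N j))"
      unfolding distrib_left .
    also have "ennreal (t / 2) * emeasure lebesgue ?S
      \<le> ennreal (weak_const r (2 ^ CARD('n)) 5 * real \<kappa>) * (\<integral>\<^sup>+y. ennreal (lr_upto r J (\<lambda>j. f j y)) \<partial>lebesgue)"
      by (rule trunc_weak_type[OF r \<kappa> shift fi _ Tm]) (use t in simp)
    also have "\<dots> \<le> ?R"
      unfolding L1_lr_norm_def using r by (intro mult_left_mono nn_integral_mono lr_le_lr_norm) auto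
    finally show ?thesis by (simp add: add_right_mono)
  qed
  show ?thesis by (rule LIMSEQ_le_const[OF conv]) (use le in blast)
qed

text \<open>
  The level set is the increasing union of the sets treated above, taken over larger and larger balls
  and longer and longer initial segments of the sequence.
\<close>

lemma vector_haar_weak_type:
  fixes h k :: "nat \<Rightarrow> (real ^ 'n) set \<Rightarrow> real ^ 'n \<Rightarrow> 'k::{real_normed_field, euclidean_space}"
  assumes r: "1 < r" and \<kappa>: "1 \<le> \<kappa>" and shift: "\<And>j. haar_shift \<kappa> (h j) (k j)"
    and f: "f \<in> L1_lr r" and def: "vector_haar_defined h k f"
  shows "weak_norm (vector_haar_apply r h k f)
    \<le> ennreal (2 * weak_const r (2 ^ CARD('n)) 5 * real \<kappa>) * L1_lr_norm r f"
  unfolding weak_norm_def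
proof (rule SUP_least)
  fix t :: real assume "t \<in> {0<..}"
  then have t: "0 < t" by simp
  let ?g = "\<lambda>j. haar_apply (h j) (k j) (f j)"
  let ?W = "weak_const r (2 ^ CARD('n)) 5"
  have gm[measurable]: "?g j \<in> borel_measurable lebesgue" for j
    using def haar_apply_limit unfolding vector_haar_defined_def tendsto_in_measure_on_bounded_def by blast
  define A where "A = (\<lambda>n. {x\<in>ball 0 (real n). t < lr_upto r n (\<lambda>j. ?g j x)})"
  have A_sets: "A n \<in> sets lebesgue" for n
  proof -
    have "{x\<in>space lebesgue. t < lr_upto r n (\<lambda>j. ?g j x)} \<in> sets lebesgue" by measurable
    then have "ball 0 (real n) \<inter> {x\<in>space lebesgue. t < lr_upto r n (\<lambda>j. ?g j x)} \<in> sets lebesgue"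
      by (rule sets.Int[OF fmeasurableD[OF lmeasurable_ball]])
    moreover have "ball 0 (real n) \<inter> {x\<in>space lebesgue. t < lr_upto r n (\<lambda>j. ?g j x)} = A n" by (auto simp: A_def)
    ultimately show ?thesis by simp
  qed
  have A_inc: "incseq A"
  proof (rule incseq_SucI, rule subsetI)
    fix n x assume "x \<in> A n"
    then show "x \<in> A (Suc n)"
      using lr_mono_length[of r n "Suc n" "\<lambda>j. ?g j x"] r by (auto simp: A_def)
  qed
  have "{x. vector_haar_apply r h k f x > ennreal t} = (\<Union>n. A n)"
  proof (intro set_eqI iffI)
    fix x assume "x \<in> {x. vector_haar_apply r h k f x > ennreal t}"
    then obtain J where J: "t < lr_upto r J (\<lambda>j. ?g j x)"
      using r t less_lr_norm_iff[of r t] by (auto simp: vector_haar_apply_def)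
    define n where "n = max J (nat \<lceil>norm x\<rceil> + 1)"
    have "norm x < real n" unfolding n_def by linarith
    moreover have "t < lr_upto r n (\<lambda>j. ?g j x)"
      using J lr_mono_length[of r J n "\<lambda>j. ?g j x"] r by (simp add: n_def)
    ultimately show "x \<in> (\<Union>n. A n)" by (auto simp: A_def)
  next
    fix x assume "x \<in> (\<Union>n. A n)"
    then show "x \<in> {x. vector_haar_apply r h k f x > ennreal t}"
      using r t less_lr_norm_iff[of r t] by (auto simp: vector_haar_apply_def A_def)
  qed
  then have eq: "emeasure lebesgue {x. vector_haar_apply r h k f x > ennreal t} = (SUP n. emeasure lebesgue (A n))"
    using SUP_emeasure_incseq[OF image_subsetI[OF A_sets] A_inc] by (simp only:)
  have "ennreal (t / 2) * (SUP n. emeasure lebesgue (A n)) \<le> ennreal (?W * real \<kappa>) * L1_lr_norm r f"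
    unfolding SUP_mult_left_ennreal A_def
    by (intro SUP_least limit_weak_type[OF r \<kappa> shift f def t]) auto
  then have "ennreal 2 * (ennreal (t / 2) * (SUP n. emeasure lebesgue (A n))) \<le> ennreal 2 * (ennreal (?W * real \<kappa>) * L1_lr_norm r f)"
    by (rule mult_left_mono) simp
  moreover have "ennreal 2 * ennreal (t / 2) = ennreal t" "ennreal 2 * ennreal (?W * real \<kappa>) = ennreal (2 * ?W * real \<kappa>)"
    using ennreal_mult'[of 2 "t / 2"] ennreal_mult'[of 2 "?W * real \<kappa>"] by (simp_all add: mult.assoc)
  ultimately show "ennreal t * emeasure lebesgue {x. vector_haar_apply r h k f x > ennreal t}
    \<le> ennreal (2 * ?W * real \<kappa>) * L1_lr_norm r f"
    unfolding eq by (metis mult.assoc)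
qed

theorem theorem1p12:
  fixes r :: real
  assumes "1 < r"
  shows "\<exists>C::real. C > 0 \<and>
    (\<forall>\<kappa>::nat. \<kappa> \<ge> 1 \<longrightarrow>
      (\<forall>(h :: nat \<Rightarrow> (real ^ 'n) set \<Rightarrow> real ^ 'n \<Rightarrow> 'k::{real_normed_field, euclidean_space})
        (k :: nat \<Rightarrow> (real ^ 'n) set \<Rightarrow> real ^ 'n \<Rightarrow> 'k).
        (\<forall>j. haar_shift \<kappa> (h j) (k j)) \<longrightarrow>
        vector_haar_weak_norm r h k \<le> ennreal (C * real \<kappa> powr (1 + 1 / r))))"
proof -
  define C where "C = 2 * weak_const r (2 ^ CARD('n)) 5"
  have C: "0 < C" unfolding C_def weak_const_def using assms by (intro mult_pos_pos add_nonneg_pos mult_nonneg_nonneg) auto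
  show ?thesis
  proof (intro exI conjI allI impI)
    show "0 < C" by (rule C)
    fix \<kappa> :: nat and h k :: "nat \<Rightarrow> (real ^ 'n) set \<Rightarrow> real ^ 'n \<Rightarrow> 'k"
    assume \<kappa>: "1 \<le> \<kappa>" and shift: "\<forall>j. haar_shift \<kappa> (h j) (k j)"
    \<comment> \<open>The bound proved is linear in \<open>\<kappa>\<close>, and \<open>\<kappa> \<ge> 1\<close>.\<close>
    have "real \<kappa> powr 1 \<le> real \<kappa> powr (1 + 1 / r)"
      using \<kappa> assms by (intro powr_mono) auto
    then have "C * real \<kappa> \<le> C * real \<kappa> powr (1 + 1 / r)" using C \<kappa> by simp
    then have "ennreal (C * real \<kappa>) * L1_lr_norm r f \<le> ennreal (C * real \<kappa> powr (1 + 1 / r)) * L1_lr_norm r f" for f :: "nat \<Rightarrow> real ^ 'n \<Rightarrow> 'k"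
      by (intro mult_right_mono ennreal_leI) auto
    then have "\<forall>f\<in>L1_lr r. vector_haar_defined h k f \<longrightarrow>
        weak_norm (vector_haar_apply r h k f) \<le> ennreal (C * real \<kappa> powr (1 + 1 / r)) * L1_lr_norm r f"
      using vector_haar_weak_type[OF assms \<kappa>, of h k] shift unfolding C_def by (meson order_trans)
    then show "vector_haar_weak_norm r h k \<le> ennreal (C * real \<kappa> powr (1 + 1 / r))"
      unfolding vector_haar_weak_norm_def by (intro Inf_lower) blast
  qed
qed

end
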